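(* Let $R$ be an indecomposable commutative ring, let $(\Sigma,i,q)$ be a discrete $R$-twist over an ample Hausdorff groupoid $G$, let $A=A_R(G;\Sigma)$ and let $B=A_R(G^{(0)};q^{-1}(G^{(0)}))\subseteq A$. Let $\Sigma'$ be the groupoid of ultrafilters of $N(B)$, and let $\Phi\colon\Sigma\to\Sigma'$ be the map $\Phi(\sigma)=(\tilde 1_XU_{s(\sigma)})^{\uparrow}$, where $X$ is any compact open bisection of $\Sigma$ containing $\sigma$. The following are equivalent. (1) The pair $(A,B)$ is an algebraic quasi-Cartan pair. (2) The twist $(\Sigma,i,q)$ satisfies the local bisection hypothesis. (3) The map $\Phi$ is surjective and, in particular, it is an isomorphism of topological groupoids.
   Context: **Rings and groupoids.** A commutative ring $R$ with identity is indecomposable if $0\ne1$ and its only idempotents are $0$ and $1$. $R^\times$ is its group of units, with the discrete topology. Groupoids are locally compact topological groupoids with Hausdorff unit space $G^{(0)}$, range/source maps $r,s$; $\gamma\gamma^{-1}=r(\gamma)$, $\gamma^{-1}\gamma=s(\gamma)$. A bisection is a subset $D$ contained in an open set $O$ such that $r|_O,s|_O$ are homeomorphisms onto open subsets of $G^{(0)}$. $G$ is étale if $r$ is a local homeomorphism, and ample if it is étale with a basis of compact open bisections. **Twists.** A discrete $R$-twist $(\Sigma,i,q)$ over an étale groupoid $G$ is a sequence $G^{(0)}\times R^\times\xrightarrow{i}\Sigma\xrightarrow{q}G$, where $G^{(0)}\times R^\times$ is the trivial group bundle, $\Sigma$ is a topological groupoid with $\Sigma^{(0)}=i(G^{(0)}\times\{1\})$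 (identified with $G^{(0)}$), and $i,q$ are continuous groupoid homomorphisms restricting to homeomorphisms of unit spaces, such that: (DT1) $i(\{x\}\times R^\times)=q^{-1}(x)$ for $x\in G^{(0)}$, $i$ injective, $q$ surjective; (DT2) each $\alpha\in G$ has an open bisection $B_\alpha\ni\alpha$ and a continuous $P_\alpha\colon B_\alpha\to\Sigma$ with $q\circ P_\alpha=\mathrm{id}$ and $(\beta,t)\mapsto i(r(\beta),t)P_\alpha(\beta)$ a homeomorphism $B_\alpha\times R^\times\to q^{-1}(B_\alpha)$; (DT3) $i(r(\sigma),t)\sigma=\sigma i(s(\sigma),t)$. Write $t\cdot\sigma=i(r(\sigma),t)\sigma$. **Twisted Steinberg algebra.** $\operatorname{supp}(f)=\{f\neq0\}$, $\operatorname{supp}_G(f)=q(\operatorname{supp}(f))$. $A_R(G;\Sigma)$ is the set of locally constant $f\colon\Sigma\to R$ with $f(t\cdot\sigma)=t^{-1}f(\sigma)$ for $t\in R^\times$ and $q(\operatorname{supp}(f))$ compact; it is an $R$-algebra under pointwise operations and $(f*g)(\sigma)=\sum_{\alpha\in r^{-1}(r(\sigma))\cap\operatorname{supp}_G(f)}f(S(\alpha))g(S(\alpha)^{-1}\sigma)$, with $S\colon\operatorname{supp}_G(f)\to\operatorname{supp}(f)$ any section for $q$. $A_R(G^{(0)};q^{-1}(G^{(0)}))$ is the commutative subalgebra of those $f$ supported in $q^{-1}(G^{(0)})$. For a compact open bisection $X\subseteq\Sigma$, $\tilde1_X$ is the unique element of $A_R(G;\Sigma)$ with support contained in $R^\times\cdot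 X$ and equal to $1$ on $X$. **Normalisers and pairs.** For an $R$-algebra $A$ and commutative subalgebra $B$: $I(B)$ is the set of idempotents of $B$, called a set of local units for $A$ if every finite $\{a_1,\dots,a_n\}\subseteq A$ admits $e\in I(B)$ with $ea_i=a_i=a_ie$. $N(B)=\{n\in A:\exists k\in A,\ knk=k,\ nkn=n,\ kBn\cup nBk\subseteq B\}$; $k$ is unique, denoted $n^\dagger$; $N(B)$ is an inverse semigroup with partial order $n\le m\iff n=nn^\dagger m$. A conditional expectation $P\colon A\to B$ is $R$-linear with $P|_B=\mathrm{id}_B$, $P(bab')=bP(a)b'$; it is faithful if for each $a\neq0$ there is $n\in N(B)$ with $P(na)\neq0$, and implemented by idempotents if for each $n\in N(B)$ there is $e\in I(B)$ with $P(n)=ne=en$. $(A,B)$ is an algebraic quasi-Cartan pair if $te=0$ with $e\in I(B)\setminus\{0\}$, $t\in R$ implies $t=0$; $I(B)$ is a set of local units for $A$; $B=\operatorname{span}_RI(B)$; $A=\operatorname{span}_RN(B)$; and there is a faithful conditional expectation $A\to B$ implemented by idempotents. The twist satisfies the local bisection hypothesis if $\operatorname{supp}_G(n)$ is a bisection of $G$ for every normaliser $n\in N(B)$ of $B=A_R(G^{(0)};q^{-1}(G^{(0)}))$ in $A=A_R(G;\Sigma)$. **Ultrafilter groupoid and $\Phi$.** $U^\uparrow=\{m\in N(B):n\le m\text{ for some }n\in U\}$. A filter is $U\subseteq N(B)\setminus\{0\}$ with $U=U^\uparrow$ in which any two elements have a common lower bound in $U$; an ultrafilter is a maximal (nonempty)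 filter. $\Sigma'$ is the set of ultrafilters, with $U^{-1}=\{n^\dagger:n\in U\}$, $(U,V)$ composable iff $mn\ne0$ for all $m\in U,n\in V$, then $UV=\{mn\}^\uparrow$, and topology with basis $\mathcal V_n=\{U:n\in U\}$, $n\in N(B)$. For $x\in\Sigma^{(0)}$, $U_x=\{e\in I(B):e(x)=1\}$, and $\tilde1_XU_{s(\sigma)}=\{\tilde1_Xe:e\in U_{s(\sigma)}\}$. The set $\Phi(\sigma)$ is an ultrafilter of $N(B)$ that does not depend on the choice of $X$. *)

theory Defs
  imports "HOL-Analysis.Analysis" "HOL-Library.Function_Algebras"
begin

section \<open>Rings\<close>

text \<open>The condition \<open>0 \<noteq> 1\<close> is part of the class \<open>comm_ring_1\<close>; it is repeated for readability.\<close>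

definition indecomposable_ring :: "'r::comm_ring_1 itself \<Rightarrow> bool" where
  "indecomposable_ring _ \<longleftrightarrow> (0::'r) \<noteq> 1 \<and> (\<forall>e::'r. e * e = e \<longrightarrow> e = 0 \<or> e = 1)"

definition ring_units :: "'r::comm_ring_1 set" where
  "ring_units = {t. t dvd 1}"

definition unit_inv :: "'r::comm_ring_1 \<Rightarrow> 'r" where
  "unit_inv t = (THE u. t * u = 1)"


section \<open>Topological groupoids\<close>

text \<open>A groupoid is given by its partial multiplication and its inversion; the set of arrows is the
  underlying set of the topology, and units are particular arrows. Range and source are derived:
  \<open>r(\<gamma>) = \<gamma>\<gamma>\<inverse>\<close> and \<open>s(\<gamma>) = \<gamma>\<inverse>\<gamma>\<close>.\<close>

record 'g tgroupoid =
  gtop :: "'g topology"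
  composable :: "'g \<Rightarrow> 'g \<Rightarrow> bool"
  gmult :: "'g \<Rightarrow> 'g \<Rightarrow> 'g" (infixl \<open>\<odot>\<index>\<close> 70)
  ginv :: "'g \<Rightarrow> 'g"

abbreviation arrows :: "'g tgroupoid \<Rightarrow> 'g set" where
  "arrows G \<equiv> topspace (gtop G)"

definition rng :: "'g tgroupoid \<Rightarrow> 'g \<Rightarrow> 'g" where
  "rng G a = a \<odot>\<^bsub>G\<^esub> ginv G a"

definition src :: "'g tgroupoid \<Rightarrow> 'g \<Rightarrow> 'g" where
  "src G a = ginv G a \<odot>\<^bsub>G\<^esub> a"

definition unit_space :: "'g tgroupoid \<Rightarrow> 'g set" where
  "unit_space G = rng G ` arrows G"

definition unit_top :: "'g tgroupoid \<Rightarrow> 'g topology" where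
  "unit_top G = subtopology (gtop G) (unit_space G)"

definition groupoid :: "'g tgroupoid \<Rightarrow> bool" where
  "groupoid G \<longleftrightarrow>
     (\<forall>a b. composable G a b \<longrightarrow> a \<in> arrows G \<and> b \<in> arrows G \<and> a \<odot>\<^bsub>G\<^esub> b \<in> arrows G) \<and>
     (\<forall>a \<in> arrows G. ginv G a \<in> arrows G \<and> ginv G (ginv G a) = a \<and> composable G a (ginv G a)) \<and>
     (\<forall>a b c. composable G a b \<and> composable G b c \<longrightarrow>
        composable G (a \<odot>\<^bsub>G\<^esub> b) c \<and> composable G a (b \<odot>\<^bsub>G\<^esub> c) \<and>
        (a \<odot>\<^bsub>G\<^esub> b) \<odot>\<^bsub>G\<^esub> c = a \<odot>\<^bsub>G\<^esub> (b \<odot>\<^bsub>G\<^esub> c)) \<and>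
     (\<forall>a b. composable G a b \<longrightarrow>
        ginv G a \<odot>\<^bsub>G\<^esub> (a \<odot>\<^bsub>G\<^esub> b) = b \<and> (a \<odot>\<^bsub>G\<^esub> b) \<odot>\<^bsub>G\<^esub> ginv G b = a)"

text \<open>By convention all topological groupoids are locally compact with Hausdorff unit space.\<close>

definition topological_groupoid :: "'g tgroupoid \<Rightarrow> bool" where
  "topological_groupoid G \<longleftrightarrow>
     groupoid G \<and>
     continuous_map
       (subtopology (prod_topology (gtop G) (gtop G)) {(a, b). composable G a b})
       (gtop G) (\<lambda>(a, b). a \<odot>\<^bsub>G\<^esub> b) \<and>
     continuous_map (gtop G) (gtop G) (ginv G) \<and>
     locally_compact_space (gtop G) \<and>
     Hausdorff_space (unit_top G)"

definition groupoid_hom :: "'g tgroupoid \<Rightarrow> 'h tgroupoid \<Rightarrow> ('g \<Rightarrow> 'h) \<Rightarrow> bool" where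
  "groupoid_hom G H \<phi> \<longleftrightarrow>
     \<phi> \<in> arrows G \<rightarrow> arrows H \<and>
     (\<forall>a b. composable G a b \<longrightarrow>
        composable H (\<phi> a) (\<phi> b) \<and> \<phi> (a \<odot>\<^bsub>G\<^esub> b) = \<phi> a \<odot>\<^bsub>H\<^esub> \<phi> b)"

definition topological_groupoid_iso :: "'g tgroupoid \<Rightarrow> 'h tgroupoid \<Rightarrow> ('g \<Rightarrow> 'h) \<Rightarrow> bool" where
  "topological_groupoid_iso G H \<phi> \<longleftrightarrow>
     (\<exists>\<psi>. homeomorphic_maps (gtop G) (gtop H) \<phi> \<psi> \<and> groupoid_hom G H \<phi> \<and> groupoid_hom H G \<psi>)"

definition open_bisection :: "'g tgroupoid \<Rightarrow> 'g set \<Rightarrow> bool" where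
  "open_bisection G U \<longleftrightarrow>
     openin (gtop G) U \<and>
     openin (unit_top G) (rng G ` U) \<and>
     homeomorphic_map (subtopology (gtop G) U) (subtopology (unit_top G) (rng G ` U)) (rng G) \<and>
     openin (unit_top G) (src G ` U) \<and>
     homeomorphic_map (subtopology (gtop G) U) (subtopology (unit_top G) (src G ` U)) (src G)"

definition bisection :: "'g tgroupoid \<Rightarrow> 'g set \<Rightarrow> bool" where
  "bisection G D \<longleftrightarrow> (\<exists>U. open_bisection G U \<and> D \<subseteq> U)"

definition compact_open_bisection :: "'g tgroupoid \<Rightarrow> 'g set \<Rightarrow> bool" where
  "compact_open_bisection G D \<longleftrightarrow> bisection G D \<and> openin (gtop G) D \<and> compactin (gtop G) D"

definition etale :: "'g tgroupoid \<Rightarrow> bool" where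
  "etale G \<longleftrightarrow>
     topological_groupoid G \<and>
     (\<forall>a \<in> arrows G. \<exists>U. openin (gtop G) U \<and> a \<in> U \<and> openin (unit_top G) (rng G ` U) \<and>
        homeomorphic_map (subtopology (gtop G) U) (subtopology (unit_top G) (rng G ` U)) (rng G))"

definition ample :: "'g tgroupoid \<Rightarrow> bool" where
  "ample G \<longleftrightarrow>
     etale G \<and>
     (\<forall>U. openin (gtop G) U \<longrightarrow>
        (\<forall>a \<in> U. \<exists>K. compact_open_bisection G K \<and> a \<in> K \<and> K \<subseteq> U))"


section \<open>Discrete twists\<close>

definition trivial_bundle :: "'g tgroupoid \<Rightarrow> ('g \<times> 'r::comm_ring_1) tgroupoid" where
  "trivial_bundle G =
     \<lparr> gtop = prod_topology (unit_top G) (discrete_topology ring_units),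
       composable = (\<lambda>(x, t) (y, u). x \<in> unit_space G \<and> x = y \<and> t \<in> ring_units \<and> u \<in> ring_units),
       gmult = (\<lambda>(x, t) (y, u). (x, t * u)),
       ginv = (\<lambda>(x, t). (x, unit_inv t)) \<rparr>"

text \<open>The identification of the unit space of \<open>\<Sigma>\<close> with that of \<open>G\<close> sends \<open>i (x, 1)\<close> to \<open>x\<close>, that is,
  it is the restriction of \<open>q\<close>. So \<open>i(r(\<sigma>), t)\<close> is written \<open>i (q (rng \<Sigma> \<sigma>), t)\<close>.\<close>

definition twist_act ::
    "'s tgroupoid \<Rightarrow> ('g \<times> 'r::comm_ring_1 \<Rightarrow> 's) \<Rightarrow> ('s \<Rightarrow> 'g) \<Rightarrow> 'r \<Rightarrow> 's \<Rightarrow> 's" where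
  "twist_act \<Sigma> i q t \<sigma> = i (q (rng \<Sigma> \<sigma>), t) \<odot>\<^bsub>\<Sigma>\<^esub> \<sigma>"

definition discrete_twist ::
    "'g tgroupoid \<Rightarrow> 's tgroupoid \<Rightarrow> ('g \<times> 'r::comm_ring_1 \<Rightarrow> 's) \<Rightarrow> ('s \<Rightarrow> 'g) \<Rightarrow> bool" where
  "discrete_twist G \<Sigma> i q \<longleftrightarrow>
     etale G \<and> topological_groupoid \<Sigma> \<and>
     unit_space \<Sigma> = i ` (unit_space G \<times> {1}) \<and>
     groupoid_hom (trivial_bundle G) \<Sigma> i \<and>
     continuous_map (gtop (trivial_bundle G :: ('g \<times> 'r) tgroupoid)) (gtop \<Sigma>) i \<and>
     homeomorphic_map (unit_top (trivial_bundle G :: ('g \<times> 'r) tgroupoid)) (unit_top \<Sigma>) i \<and>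
     groupoid_hom \<Sigma> G q \<and>
     continuous_map (gtop \<Sigma>) (gtop G) q \<and>
     homeomorphic_map (unit_top \<Sigma>) (unit_top G) q \<and>
     \<comment> \<open>(DT1)\<close>
     (\<forall>x \<in> unit_space G. i ` ({x} \<times> ring_units) = {\<sigma> \<in> arrows \<Sigma>. q \<sigma> = x}) \<and>
     inj_on i (unit_space G \<times> ring_units) \<and>
     q ` arrows \<Sigma> = arrows G \<and>
     \<comment> \<open>(DT2)\<close>
     (\<forall>\<alpha> \<in> arrows G. \<exists>D P. open_bisection G D \<and> \<alpha> \<in> D \<and>
        continuous_map (subtopology (gtop G) D) (gtop \<Sigma>) P \<and>
        (\<forall>\<beta> \<in> D. q (P \<beta>) = \<beta>) \<and>
        homeomorphic_map
          (prod_topology (subtopology (gtop G) D) (discrete_topology (ring_units :: 'r set)))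
          (subtopology (gtop \<Sigma>) {\<sigma> \<in> arrows \<Sigma>. q \<sigma> \<in> D})
          (\<lambda>(\<beta>, t). i (rng G \<beta>, t) \<odot>\<^bsub>\<Sigma>\<^esub> P \<beta>)) \<and>
     \<comment> \<open>(DT3)\<close>
     (\<forall>\<sigma> \<in> arrows \<Sigma>. \<forall>t \<in> ring_units.
        i (q (rng \<Sigma> \<sigma>), t) \<odot>\<^bsub>\<Sigma>\<^esub> \<sigma> = \<sigma> \<odot>\<^bsub>\<Sigma>\<^esub> i (q (src \<Sigma> \<sigma>), t))"


section \<open>Algebras, normalisers, quasi-Cartan pairs\<close>

text \<open>An algebra is a subset of an ambient abelian group on which \<open>R\<close> acts, together with a
  multiplication that matters only on that subset. No unit element is assumed.\<close>

record ('r, 'a) ralgebra =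
  acarrier :: "'a set"
  ascale :: "'r \<Rightarrow> 'a \<Rightarrow> 'a"
  amult :: "'a \<Rightarrow> 'a \<Rightarrow> 'a" (infixl \<open>\<star>\<index>\<close> 70)

definition r_algebra :: "('r::comm_ring_1, 'a::ab_group_add) ralgebra \<Rightarrow> bool" where
  "r_algebra A \<longleftrightarrow>
     module (ascale A) \<and> module.subspace (ascale A) (acarrier A) \<and>
     (\<forall>a \<in> acarrier A. \<forall>b \<in> acarrier A. a \<star>\<^bsub>A\<^esub> b \<in> acarrier A) \<and>
     (\<forall>a \<in> acarrier A. \<forall>b \<in> acarrier A. \<forall>c \<in> acarrier A.
        (a \<star>\<^bsub>A\<^esub> b) \<star>\<^bsub>A\<^esub> c = a \<star>\<^bsub>A\<^esub> (b \<star>\<^bsub>A\<^esub> c) \<and>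
        (a + b) \<star>\<^bsub>A\<^esub> c = a \<star>\<^bsub>A\<^esub> c + b \<star>\<^bsub>A\<^esub> c \<and>
        a \<star>\<^bsub>A\<^esub> (b + c) = a \<star>\<^bsub>A\<^esub> b + a \<star>\<^bsub>A\<^esub> c) \<and>
     (\<forall>t. \<forall>a \<in> acarrier A. \<forall>b \<in> acarrier A.
        ascale A t a \<star>\<^bsub>A\<^esub> b = ascale A t (a \<star>\<^bsub>A\<^esub> b) \<and>
        a \<star>\<^bsub>A\<^esub> ascale A t b = ascale A t (a \<star>\<^bsub>A\<^esub> b))"

definition comm_subalgebra :: "('r::comm_ring_1, 'a::ab_group_add) ralgebra \<Rightarrow> 'a set \<Rightarrow> bool" where
  "comm_subalgebra A B \<longleftrightarrow>
     B \<subseteq> acarrier A \<and> module.subspace (ascale A) B \<and>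
     (\<forall>a \<in> B. \<forall>b \<in> B. a \<star>\<^bsub>A\<^esub> b \<in> B \<and> a \<star>\<^bsub>A\<^esub> b = b \<star>\<^bsub>A\<^esub> a)"

definition idempotents :: "('r, 'a) ralgebra \<Rightarrow> 'a set \<Rightarrow> 'a set" where
  "idempotents A B = {e \<in> B. e \<star>\<^bsub>A\<^esub> e = e}"

definition idempotents_local_units :: "('r, 'a) ralgebra \<Rightarrow> 'a set \<Rightarrow> bool" where
  "idempotents_local_units A B \<longleftrightarrow>
     (\<forall>F. finite F \<and> F \<subseteq> acarrier A \<longrightarrow>
        (\<exists>e \<in> idempotents A B. \<forall>a \<in> F. e \<star>\<^bsub>A\<^esub> a = a \<and> a \<star>\<^bsub>A\<^esub> e = a))"

definition normaliser_inverse :: "('r, 'a) ralgebra \<Rightarrow> 'a set \<Rightarrow> 'a \<Rightarrow> 'a \<Rightarrow> bool" where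
  "normaliser_inverse A B n k \<longleftrightarrow>
     k \<in> acarrier A \<and> k \<star>\<^bsub>A\<^esub> n \<star>\<^bsub>A\<^esub> k = k \<and> n \<star>\<^bsub>A\<^esub> k \<star>\<^bsub>A\<^esub> n = n \<and>
     (\<forall>b \<in> B. k \<star>\<^bsub>A\<^esub> b \<star>\<^bsub>A\<^esub> n \<in> B \<and> n \<star>\<^bsub>A\<^esub> b \<star>\<^bsub>A\<^esub> k \<in> B)"

definition normalisers :: "('r, 'a) ralgebra \<Rightarrow> 'a set \<Rightarrow> 'a set" where
  "normalisers A B = {n \<in> acarrier A. \<exists>k. normaliser_inverse A B n k}"

definition dagger :: "('r, 'a) ralgebra \<Rightarrow> 'a set \<Rightarrow> 'a \<Rightarrow> 'a" where
  "dagger A B n = (THE k. normaliser_inverse A B n k)"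

definition nle :: "('r, 'a) ralgebra \<Rightarrow> 'a set \<Rightarrow> 'a \<Rightarrow> 'a \<Rightarrow> bool" where
  "nle A B n m \<longleftrightarrow> n = n \<star>\<^bsub>A\<^esub> dagger A B n \<star>\<^bsub>A\<^esub> m"

definition conditional_expectation ::
    "('r, 'a::ab_group_add) ralgebra \<Rightarrow> 'a set \<Rightarrow> ('a \<Rightarrow> 'a) \<Rightarrow> bool" where
  "conditional_expectation A B P \<longleftrightarrow>
     P \<in> acarrier A \<rightarrow> B \<and>
     (\<forall>a \<in> acarrier A. \<forall>b \<in> acarrier A. P (a + b) = P a + P b) \<and>
     (\<forall>t. \<forall>a \<in> acarrier A. P (ascale A t a) = ascale A t (P a)) \<and>
     (\<forall>b \<in> B. P b = b) \<and>
     (\<forall>a \<in> acarrier A. \<forall>b \<in> B. \<forall>b' \<in> B. P (b \<star>\<^bsub>A\<^esub> a \<star>\<^bsub>A\<^esub> b') = b \<star>\<^bsub>A\<^esub> P a \<star>\<^bsub>A\<^esub> b')"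

definition faithful :: "('r, 'a::ab_group_add) ralgebra \<Rightarrow> 'a set \<Rightarrow> ('a \<Rightarrow> 'a) \<Rightarrow> bool" where
  "faithful A B P \<longleftrightarrow>
     (\<forall>a \<in> acarrier A. a \<noteq> 0 \<longrightarrow> (\<exists>n \<in> normalisers A B. P (n \<star>\<^bsub>A\<^esub> a) \<noteq> 0))"

definition implemented_by_idempotents :: "('r, 'a) ralgebra \<Rightarrow> 'a set \<Rightarrow> ('a \<Rightarrow> 'a) \<Rightarrow> bool" where
  "implemented_by_idempotents A B P \<longleftrightarrow>
     (\<forall>n \<in> normalisers A B. \<exists>e \<in> idempotents A B. P n = n \<star>\<^bsub>A\<^esub> e \<and> n \<star>\<^bsub>A\<^esub> e = e \<star>\<^bsub>A\<^esub> n)"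

definition algebraic_quasi_Cartan_pair ::
    "('r::comm_ring_1, 'a::ab_group_add) ralgebra \<Rightarrow> 'a set \<Rightarrow> bool" where
  "algebraic_quasi_Cartan_pair A B \<longleftrightarrow>
     r_algebra A \<and> comm_subalgebra A B \<and>
     (\<forall>t. \<forall>e \<in> idempotents A B - {0}. ascale A t e = 0 \<longrightarrow> t = 0) \<and>
     idempotents_local_units A B \<and>
     B = module.span (ascale A) (idempotents A B) \<and>
     acarrier A = module.span (ascale A) (normalisers A B) \<and>
     (\<exists>P. conditional_expectation A B P \<and> faithful A B P \<and> implemented_by_idempotents A B P)"


section \<open>The groupoid of ultrafilters\<close>

definition up_closure :: "('r, 'a) ralgebra \<Rightarrow> 'a set \<Rightarrow> 'a set \<Rightarrow> 'a set" where
  "up_closure A B U = {m \<in> normalisers A B. \<exists>n \<in> U. nle A B n m}"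

definition normaliser_filter :: "('r, 'a::ab_group_add) ralgebra \<Rightarrow> 'a set \<Rightarrow> 'a set \<Rightarrow> bool" where
  "normaliser_filter A B U \<longleftrightarrow>
     U \<subseteq> normalisers A B - {0} \<and> U = up_closure A B U \<and>
     (\<forall>m \<in> U. \<forall>n \<in> U. \<exists>k \<in> U. nle A B k m \<and> nle A B k n)"

definition normaliser_ultrafilter :: "('r, 'a::ab_group_add) ralgebra \<Rightarrow> 'a set \<Rightarrow> 'a set \<Rightarrow> bool" where
  "normaliser_ultrafilter A B U \<longleftrightarrow>
     normaliser_filter A B U \<and> U \<noteq> {} \<and>
     (\<forall>V. normaliser_filter A B V \<and> U \<subseteq> V \<longrightarrow> V = U)"

definition ultrafilter_groupoid ::
    "('r, 'a::ab_group_add) ralgebra \<Rightarrow> 'a set \<Rightarrow> 'a set tgroupoid" where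
  "ultrafilter_groupoid A B =
     \<lparr> gtop = topology_generated_by
         ((\<lambda>n. {U. normaliser_ultrafilter A B U \<and> n \<in> U}) ` normalisers A B),
       composable = (\<lambda>U V. normaliser_ultrafilter A B U \<and> normaliser_ultrafilter A B V \<and>
         (\<forall>m \<in> U. \<forall>n \<in> V. m \<star>\<^bsub>A\<^esub> n \<noteq> 0)),
       gmult = (\<lambda>U V. up_closure A B {m \<star>\<^bsub>A\<^esub> n | m n. m \<in> U \<and> n \<in> V}),
       ginv = (\<lambda>U. dagger A B ` U) \<rparr>"


section \<open>Twisted Steinberg algebras\<close>

text \<open>Functions on \<open>\<Sigma>\<close> are extended by \<open>0\<close> to the whole type.\<close>

definition supp :: "('s \<Rightarrow> 'r::zero) \<Rightarrow> 's set" where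
  "supp f = {\<sigma>. f \<sigma> \<noteq> 0}"

definition supp_G :: "('s \<Rightarrow> 'g) \<Rightarrow> ('s \<Rightarrow> 'r::zero) \<Rightarrow> 'g set" where
  "supp_G q f = q ` supp f"

definition steinberg_carrier ::
    "'g tgroupoid \<Rightarrow> 's tgroupoid \<Rightarrow> ('g \<times> 'r::comm_ring_1 \<Rightarrow> 's) \<Rightarrow> ('s \<Rightarrow> 'g) \<Rightarrow> ('s \<Rightarrow> 'r) set" where
  "steinberg_carrier G \<Sigma> i q = {f.
     supp f \<subseteq> arrows \<Sigma> \<and>
     (\<forall>\<sigma> \<in> arrows \<Sigma>. \<exists>W. openin (gtop \<Sigma>) W \<and> \<sigma> \<in> W \<and> (\<forall>\<tau> \<in> W. f \<tau> = f \<sigma>)) \<and>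
     (\<forall>\<sigma> \<in> arrows \<Sigma>. \<forall>t \<in> ring_units. f (twist_act \<Sigma> i q t \<sigma>) = unit_inv t * f \<sigma>) \<and>
     compactin (gtop G) (supp_G q f)}"

text \<open>The section \<open>S\<close> of \<open>q\<close> over the support of \<open>f\<close> is an arbitrary one. For \<open>f\<close> in the algebra the
  index set of the sum is finite.\<close>

definition twisted_conv ::
    "'g tgroupoid \<Rightarrow> 's tgroupoid \<Rightarrow> ('s \<Rightarrow> 'g) \<Rightarrow> ('s \<Rightarrow> 'r::comm_ring_1) \<Rightarrow> ('s \<Rightarrow> 'r) \<Rightarrow> 's \<Rightarrow> 'r" where
  "twisted_conv G \<Sigma> q f g \<sigma> =
     (if \<sigma> \<in> arrows \<Sigma> then
        let S = (\<lambda>\<alpha>. SOME \<tau>. \<tau> \<in> supp f \<and> q \<tau> = \<alpha>)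
        in \<Sum>\<alpha> \<in> {\<alpha> \<in> arrows G. rng G \<alpha> = q (rng \<Sigma> \<sigma>)} \<inter> supp_G q f.
             f (S \<alpha>) * g (ginv \<Sigma> (S \<alpha>) \<odot>\<^bsub>\<Sigma>\<^esub> \<sigma>)
      else 0)"

definition steinberg_algebra ::
    "'g tgroupoid \<Rightarrow> 's tgroupoid \<Rightarrow> ('g \<times> 'r::comm_ring_1 \<Rightarrow> 's) \<Rightarrow> ('s \<Rightarrow> 'g) \<Rightarrow>
      ('r, 's \<Rightarrow> 'r) ralgebra" where
  "steinberg_algebra G \<Sigma> i q =
     \<lparr> acarrier = steinberg_carrier G \<Sigma> i q,
       ascale = (\<lambda>t f \<sigma>. t * f \<sigma>),
       amult = twisted_conv G \<Sigma> q \<rparr>"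

definition steinberg_diagonal ::
    "'g tgroupoid \<Rightarrow> 's tgroupoid \<Rightarrow> ('g \<times> 'r::comm_ring_1 \<Rightarrow> 's) \<Rightarrow> ('s \<Rightarrow> 'g) \<Rightarrow> ('s \<Rightarrow> 'r) set" where
  "steinberg_diagonal G \<Sigma> i q =
     {f \<in> steinberg_carrier G \<Sigma> i q. supp f \<subseteq> {\<sigma> \<in> arrows \<Sigma>. q \<sigma> \<in> unit_space G}}"

definition local_bisection_hypothesis ::
    "'g tgroupoid \<Rightarrow> 's tgroupoid \<Rightarrow> ('g \<times> 'r::comm_ring_1 \<Rightarrow> 's) \<Rightarrow> ('s \<Rightarrow> 'g) \<Rightarrow> bool" where
  "local_bisection_hypothesis G \<Sigma> i q \<longleftrightarrow>
     (\<forall>n \<in> normalisers (steinberg_algebra G \<Sigma> i q) (steinberg_diagonal G \<Sigma> i q).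
        bisection G (supp_G q n))"

definition tilde_one ::
    "'g tgroupoid \<Rightarrow> 's tgroupoid \<Rightarrow> ('g \<times> 'r::comm_ring_1 \<Rightarrow> 's) \<Rightarrow> ('s \<Rightarrow> 'g) \<Rightarrow> 's set \<Rightarrow> 's \<Rightarrow> 'r" where
  "tilde_one G \<Sigma> i q X =
     (THE f. f \<in> steinberg_carrier G \<Sigma> i q \<and>
        supp f \<subseteq> {twist_act \<Sigma> i q t \<sigma> | t \<sigma>. t \<in> ring_units \<and> \<sigma> \<in> X} \<and> (\<forall>\<sigma> \<in> X. f \<sigma> = 1))"

definition unit_ultrafilter ::
    "'g tgroupoid \<Rightarrow> 's tgroupoid \<Rightarrow> ('g \<times> 'r::comm_ring_1 \<Rightarrow> 's) \<Rightarrow> ('s \<Rightarrow> 'g) \<Rightarrow> 's \<Rightarrow> ('s \<Rightarrow> 'r) set" where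
  "unit_ultrafilter G \<Sigma> i q x =
     {e \<in> idempotents (steinberg_algebra G \<Sigma> i q) (steinberg_diagonal G \<Sigma> i q). e x = 1}"

text \<open>The set attached to \<open>\<sigma>\<close> through a given compact open bisection \<open>X\<close> containing \<open>\<sigma>\<close>.\<close>

definition Phi_via ::
    "'g tgroupoid \<Rightarrow> 's tgroupoid \<Rightarrow> ('g \<times> 'r::comm_ring_1 \<Rightarrow> 's) \<Rightarrow> ('s \<Rightarrow> 'g) \<Rightarrow>
      's set \<Rightarrow> 's \<Rightarrow> ('s \<Rightarrow> 'r) set" where
  "Phi_via G \<Sigma> i q X \<sigma> =
     up_closure (steinberg_algebra G \<Sigma> i q) (steinberg_diagonal G \<Sigma> i q)
       {twisted_conv G \<Sigma> q (tilde_one G \<Sigma> i q X) e | e. e \<in> unit_ultrafilter G \<Sigma> i q (src \<Sigma> \<sigma>)}"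

text \<open>The result is independent of \<open>X\<close>, so an arbitrary choice is made.\<close>

definition Phi ::
    "'g tgroupoid \<Rightarrow> 's tgroupoid \<Rightarrow> ('g \<times> 'r::comm_ring_1 \<Rightarrow> 's) \<Rightarrow> ('s \<Rightarrow> 'g) \<Rightarrow> 's \<Rightarrow> ('s \<Rightarrow> 'r) set" where
  "Phi G \<Sigma> i q \<sigma> = Phi_via G \<Sigma> i q (SOME X. compact_open_bisection \<Sigma> X \<and> \<sigma> \<in> X) \<sigma>"

end

theory Submission
  imports Defs
begin

text \<open>
  Call the restriction of a function on \<open>\<Sigma>\<close> to the arrows with range \<open>x\<close> its row at \<open>x\<close>. For
  normalisers, \<open>n \<le> m\<close> means that the rows of \<open>n\<close> and \<open>m\<close> agree at every point where the row of \<open>n\<close> is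
  nonzero. Two elements of the algebra whose rows agree at \<open>x\<close> have equal rows near \<open>x\<close>, so for
  every normaliser \<open>n\<close> with a nonzero row at \<open>x\<close> the normalisers with the same row at \<open>x\<close> form an
  ultrafilter. The ultrafilter \<open>\<Phi>(\<sigma>)\<close> belongs to the row that is the point mass at \<open>\<sigma>\<close>.

  If \<open>\<Phi>\<close> is surjective, every nonzero row of a normaliser is a multiple of a point mass, so \<open>r\<close> is
  injective on its support, and \<open>s\<close> is too, by passing to \<open>n\<^sup>\<dagger>\<close>. Conversely, the compact sets of
  points with nonzero row have a common point as \<open>n\<close> runs through an ultrafilter, and under the
  local bisection hypothesis the row there is a multiple of a point mass.

  A conditional expectation implemented by idempotents is restriction to the unit space. If \<open>\<sigma>, \<tau>\<close>
  lie in the support of \<open>n\<close> over distinct arrows with the same range, multiply \<open>n\<close> on the left by the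
  indicator of a slice through \<open>\<sigma>\<inverse>\<close>: the product is nonzero at \<open>s(\<sigma>)\<close> and off the unit space at
  \<open>\<sigma>\<inverse>\<tau>\<close>, which contradicts \<open>P(n) = n e = e n\<close>.
\<close>

section \<open>Groupoids\<close>

text \<open>Two facts carry the row-by-row reading. On units, convolution in \<open>B\<close> is
  pointwise multiplication, so indecomposability of \<open>R\<close> makes every idempotent of
  \<open>B\<close> the indicator of a compact open set of units. Hence
  \<open>n n\<^sup>\<dagger>\<close> is the indicator of the points where \<open>n\<close> has a
  nonzero row, and multiplying by it on the left keeps or deletes whole rows. Since \<open>G\<close>
  is Hausdorff, the set of nonzero rows of \<open>f - g\<close> is open and compact, hence clopen;
  agreement and disagreement of rows both persist nearby. Filters need the first, maximality the
  second. The obstacle is that a row of a normaliser may a priori spread over several arrows and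
  take values that are not units. Ultrafilters are therefore attached to whole rows, before anything
  is known about supports. Once a row lies over a single arrow,
  \<open>n n\<^sup>\<dagger> = 1\<close> at its range forces its nonzero values to be units, and
  acting by such a value moves to an arrow \<open>\<sigma>\<close> of which the row is the point
  mass. \<open>\<Sigma>\<close> itself is not assumed Hausdorff: steps from compact to closed take
  place in \<open>G\<close>.\<close>

locale algebraic_groupoid =
  fixes G :: "'g tgroupoid" (structure)
  assumes groupoid: "groupoid G"
begin

lemma inv_closed [simp]: "a \<in> arrows G \<Longrightarrow> ginv G a \<in> arrows G"
  and inv_inv [simp]: "a \<in> arrows G \<Longrightarrow> ginv G (ginv G a) = a"
  and composable_inv: "a \<in> arrows G \<Longrightarrow> composable G a (ginv G a)"
  using groupoid unfolding groupoid_def by blast+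

lemma composable_closed:
  "composable G a b \<Longrightarrow> a \<in> arrows G \<and> b \<in> arrows G \<and> a \<odot> b \<in> arrows G"
  using groupoid unfolding groupoid_def by blast

lemma composable_assoc:
  assumes "composable G a b" "composable G b c"
  shows "composable G (a \<odot> b) c" "composable G a (b \<odot> c)" "(a \<odot> b) \<odot> c = a \<odot> (b \<odot> c)"
  using groupoid assms unfolding groupoid_def by blast+

lemma composable_cancel:
  assumes "composable G a b"
  shows "ginv G a \<odot> (a \<odot> b) = b" "(a \<odot> b) \<odot> ginv G b = a"
  using groupoid assms unfolding groupoid_def by blast+

lemma composable_inv': "a \<in> arrows G \<Longrightarrow> composable G (ginv G a) a"
  using composable_inv[of "ginv G a"] by simp

lemma rng_closed [simp]: "a \<in> arrows G \<Longrightarrow> rng G a \<in> arrows G"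
  and src_closed [simp]: "a \<in> arrows G \<Longrightarrow> src G a \<in> arrows G"
  using composable_closed[OF composable_inv] composable_closed[OF composable_inv']
  unfolding rng_def src_def by auto

lemma rng_inv [simp]: "a \<in> arrows G \<Longrightarrow> rng G (ginv G a) = src G a"
  and src_inv [simp]: "a \<in> arrows G \<Longrightarrow> src G (ginv G a) = rng G a"
  unfolding rng_def src_def by auto

text \<open>The product \<open>src G a \<odot> rng G b\<close> equals each of its factors:
  \<open>src G a\<close> fixes \<open>b\<close> from the left and \<open>rng G b\<close> fixes
  \<open>a\<close> from the right. Composability is primitive in the axioms; this is the hard half
  of reducing it to matching endpoints.\<close>

lemma src_eq_rng_if_composable:
  assumes c: "composable G a b"
  shows "src G a = rng G b"
proof -
  have a: "a \<in> arrows G" and b: "b \<in> arrows G" using composable_closed[OF c] by auto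
  have c1: "composable G (src G a) b" "src G a \<odot> b = b"
    using composable_assoc[OF composable_inv'[OF a] c] composable_cancel[OF c]
    unfolding src_def by auto
  have c2: "composable G a (rng G b)" "a \<odot> rng G b = a"
    using composable_assoc[OF c composable_inv[OF b]] composable_cancel[OF c]
    unfolding rng_def by auto
  have "src G a \<odot> rng G b = rng G b"
    using composable_assoc[OF c1(1) composable_inv[OF b]] c1(2) unfolding rng_def by auto
  moreover have "src G a \<odot> rng G b = src G a"
    using composable_assoc[OF composable_inv'[OF a] c2(1)] c2(2) unfolding src_def by auto
  ultimately show ?thesis by simp
qed

lemma rng_mult_self [simp]: "a \<in> arrows G \<Longrightarrow> rng G a \<odot> a = a"
  and composable_rng: "a \<in> arrows G \<Longrightarrow> composable G (rng G a) a"
  and mult_src_self [simp]: "a \<in> arrows G \<Longrightarrow> a \<odot> src G a = a"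
  and composable_src: "a \<in> arrows G \<Longrightarrow> composable G a (src G a)"
proof -
  assume a: "a \<in> arrows G"
  note 1 = composable_assoc[OF composable_inv[OF a] composable_inv'[OF a]]
  show "rng G a \<odot> a = a" "composable G (rng G a) a" "a \<odot> src G a = a" "composable G a (src G a)"
    using 1 composable_cancel(2)[OF composable_inv[OF a]] a unfolding rng_def src_def by auto
qed

lemma composable_iff:
  "composable G a b \<longleftrightarrow> a \<in> arrows G \<and> b \<in> arrows G \<and> src G a = rng G b"
proof
  assume "a \<in> arrows G \<and> b \<in> arrows G \<and> src G a = rng G b"
  then show "composable G a b"
    using composable_assoc(1)[of a "src G a" b] composable_src[of a] composable_rng[of b]
      mult_src_self[of a] by auto
qed (use composable_closed src_eq_rng_if_composable in auto)

lemma mult_closed [simp]: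
  "a \<in> arrows G \<Longrightarrow> b \<in> arrows G \<Longrightarrow> src G a = rng G b \<Longrightarrow> a \<odot> b \<in> arrows G"
  using composable_closed composable_iff by blast

lemma rng_rng [simp]: "a \<in> arrows G \<Longrightarrow> rng G (rng G a) = rng G a"
  and src_rng [simp]: "a \<in> arrows G \<Longrightarrow> src G (rng G a) = rng G a"
  and rng_src [simp]: "a \<in> arrows G \<Longrightarrow> rng G (src G a) = src G a"
  and src_src [simp]: "a \<in> arrows G \<Longrightarrow> src G (src G a) = src G a"
proof -
  assume a: "a \<in> arrows G"
  show 1: "src G (rng G a) = rng G a" "rng G (src G a) = src G a"
    using src_eq_rng_if_composable[OF composable_rng[OF a]]
      src_eq_rng_if_composable[OF composable_src[OF a]] by auto
  have "rng G a \<odot> rng G a = rng G a"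
    by (metis 1(1) a composable_cancel(2) composable_inv composable_rng mult_src_self rng_closed)
  moreover have "src G a \<odot> src G a = src G a"
    by (metis 1(2) a rng_mult_self src_closed)
  moreover have "composable G (rng G a) (rng G a)"
    by (metis 1(1) a composable_src rng_closed)
  moreover have "composable G (src G a) (src G a)"
    by (metis 1(2) a composable_rng src_closed)
  ultimately show "rng G (rng G a) = rng G a" "src G (src G a) = src G a"
    using 1 by (metis src_eq_rng_if_composable)+
qed

lemma mult_assoc:
  assumes "a \<in> arrows G" "b \<in> arrows G" "c \<in> arrows G" "src G a = rng G b" "src G b = rng G c"
  shows "(a \<odot> b) \<odot> c = a \<odot> (b \<odot> c)"
  using composable_assoc(3) assms composable_iff by blast

lemma rng_mult [simp]:
    "a \<in> arrows G \<Longrightarrow> b \<in> arrows G \<Longrightarrow> src G a = rng G b \<Longrightarrow> rng G (a \<odot> b) = rng G a"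
  and src_mult [simp]:
    "a \<in> arrows G \<Longrightarrow> b \<in> arrows G \<Longrightarrow> src G a = rng G b \<Longrightarrow> src G (a \<odot> b) = src G b"
proof -
  assume a: "a \<in> arrows G" "b \<in> arrows G" "src G a = rng G b"
  have "composable G (rng G a) (a \<odot> b)"
    by (rule composable_assoc(2)) (use a composable_iff in auto)
  then show "rng G (a \<odot> b) = rng G a"
    using src_eq_rng_if_composable a by fastforce
  have "composable G (a \<odot> b) (src G b)"
    by (rule composable_assoc(1)) (use a composable_iff in auto)
  then show "src G (a \<odot> b) = src G b"
    using src_eq_rng_if_composable a by fastforce
qed

lemma inv_mult_cancel [simp]:
    "a \<in> arrows G \<Longrightarrow> b \<in> arrows G \<Longrightarrow> src G a = rng G b \<Longrightarrow> ginv G a \<odot> (a \<odot> b) = b"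
  and mult_inv_cancel [simp]:
    "a \<in> arrows G \<Longrightarrow> b \<in> arrows G \<Longrightarrow> src G a = rng G b \<Longrightarrow> (a \<odot> b) \<odot> ginv G b = a"
  using composable_cancel composable_iff by blast+

lemma mult_inv_mult_cancel [simp]:
    "a \<in> arrows G \<Longrightarrow> b \<in> arrows G \<Longrightarrow> rng G a = rng G b \<Longrightarrow> a \<odot> (ginv G a \<odot> b) = b"
  and mult_mult_inv_cancel [simp]:
    "a \<in> arrows G \<Longrightarrow> b \<in> arrows G \<Longrightarrow> src G a = src G b \<Longrightarrow> (a \<odot> ginv G b) \<odot> b = a"
  using inv_mult_cancel[of "ginv G a" b] mult_inv_cancel[of a "ginv G b"] by auto

lemma mult_inv [simp]: "a \<odot> ginv G a = rng G a"
  and inv_mult_self [simp]: "ginv G a \<odot> a = src G a"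
  by (auto simp: rng_def src_def)

lemma inv_eqI:
  assumes "a \<in> arrows G" "b \<in> arrows G" "src G a = rng G b" "a \<odot> b = rng G a"
  shows "b = ginv G a"
  using inv_mult_cancel[OF assms(1-3)] assms(1,4) by (metis inv_closed mult_src_self src_inv)

lemma inv_mult:
  assumes a: "a \<in> arrows G" "b \<in> arrows G" "src G a = rng G b"
  shows "ginv G (a \<odot> b) = ginv G b \<odot> ginv G a"
proof -
  have "(a \<odot> b) \<odot> (ginv G b \<odot> ginv G a) = ((a \<odot> b) \<odot> ginv G b) \<odot> ginv G a"
    using a by (subst mult_assoc) auto
  also have "\<dots> = rng G (a \<odot> b)" using a by simp
  finally show ?thesis using a by (intro inv_eqI[symmetric]) auto
qed

lemma mem_unit_space: "x \<in> unit_space G \<longleftrightarrow> x \<in> arrows G \<and> rng G x = x"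
  unfolding unit_space_def by force

lemma unit_space_arrow: "x \<in> unit_space G \<Longrightarrow> x \<in> arrows G"
  and rng_unit [simp]: "x \<in> unit_space G \<Longrightarrow> rng G x = x"
  by (auto simp: mem_unit_space)

lemma src_unit [simp]: "x \<in> unit_space G \<Longrightarrow> src G x = x"
  by (metis mem_unit_space src_rng)

lemma inv_unit [simp]: "x \<in> unit_space G \<Longrightarrow> ginv G x = x"
  by (metis inv_eqI mem_unit_space rng_mult_self src_unit)

lemma rng_in_unit_space [simp]: "a \<in> arrows G \<Longrightarrow> rng G a \<in> unit_space G"
  and src_in_unit_space [simp]: "a \<in> arrows G \<Longrightarrow> src G a \<in> unit_space G"
  by (auto simp: mem_unit_space)

lemma mult_in_unit_spaceD:
  assumes "a \<in> arrows G" "b \<in> arrows G" "src G a = rng G b" "a \<odot> b \<in> unit_space G"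
  shows "b = ginv G a"
  using assms by (intro inv_eqI) (metis rng_mult rng_unit)+

lemma inv_mult_in_unit_space:
  assumes "a \<in> arrows G" "b \<in> arrows G" "rng G a = rng G b" "ginv G a \<odot> b \<in> unit_space G"
  shows "a = b"
  using assms by (metis inv_closed inv_inv mult_in_unit_spaceD src_inv)

lemma mult_unit [simp]: "a \<in> arrows G \<Longrightarrow> x \<in> unit_space G \<Longrightarrow> src G a = x \<Longrightarrow> a \<odot> x = a"
  and unit_mult [simp]: "a \<in> arrows G \<Longrightarrow> x \<in> unit_space G \<Longrightarrow> rng G a = x \<Longrightarrow> x \<odot> a = a"
  by auto

end

text \<open>A homomorphism is only required to preserve products. The image of
  \<open>rng G a\<close> fixes \<open>f a\<close> from the left, and cancelling \<open>f a\<close>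
  identifies it with \<open>rng H (f a)\<close>; uniqueness of inverses does the rest.\<close>

lemma groupoid_hom_inv:
  assumes "groupoid G" "groupoid H" "groupoid_hom G H f" "a \<in> arrows G"
  shows "f (ginv G a) = ginv H (f a)" "f (rng G a) = rng H (f a)" "f (src G a) = src H (f a)"
proof -
  interpret G: algebraic_groupoid G by unfold_locales fact
  interpret H: algebraic_groupoid H by unfold_locales fact
  have arr: "b \<in> arrows G \<Longrightarrow> f b \<in> arrows H" for b
    using assms(3) unfolding groupoid_hom_def by auto
  have hom: "composable H (f b) (f c)" "f (b \<odot>\<^bsub>G\<^esub> c) = f b \<odot>\<^bsub>H\<^esub> f c"
    if "composable G b c" for b c
    using assms(3) that unfolding groupoid_hom_def by auto
  note a = assms(4)
  have "f (rng G a) \<odot>\<^bsub>H\<^esub> f a = f a" "src H (f (rng G a)) = rng H (f a)"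
    using hom[OF G.composable_rng[OF a]] a H.composable_iff by auto
  then show rng: "f (rng G a) = rng H (f a)"
    by (metis G.rng_closed H.mult_inv H.mult_inv_cancel a arr)
  then have "f a \<odot>\<^bsub>H\<^esub> f (ginv G a) = rng H (f a)" "src H (f a) = rng H (f (ginv G a))"
    using hom[OF G.composable_inv[OF a]] H.composable_iff by auto
  then show inv: "f (ginv G a) = ginv H (f a)"
    using H.inv_eqI arr a by auto
  show "f (src G a) = src H (f a)"
    using hom[OF G.composable_inv'[OF a]] inv by auto
qed


section \<open>Twists\<close>

lemma one_in_ring_units [simp]: "1 \<in> ring_units"
  and mult_in_ring_units [simp]: "t \<in> ring_units \<Longrightarrow> u \<in> ring_units \<Longrightarrow> t * u \<in> ring_units"
  unfolding ring_units_def by (simp, metis CollectI CollectD mult_1 mult_dvd_mono)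

lemma mult_unit_inv [simp]: "t * unit_inv t = 1"
  and unit_inv_mult [simp]: "unit_inv t * t = 1"
  and unit_inv_in_ring_units [simp]: "unit_inv t \<in> ring_units"
  if t: "t \<in> ring_units" for t :: "'r::comm_ring_1"
proof -
  obtain u where u: "t * u = 1" using t unfolding ring_units_def by (auto elim: dvdE)
  have "v = u" if "t * v = 1" for v
    by (metis that u mult.assoc mult.commute mult_1)
  then have "unit_inv t = u" unfolding unit_inv_def using u by blast
  then show "t * unit_inv t = 1" "unit_inv t * t = 1" "unit_inv t \<in> ring_units"
    using u unfolding ring_units_def dvd_def by (auto simp: mult.commute intro: exI[of _ t])
qed

lemma ring_unitsI: "t * u = 1 \<Longrightarrow> t \<in> ring_units"
  unfolding ring_units_def dvd_def by auto

lemma unit_inv_eqI: "t * u = 1 \<Longrightarrow> unit_inv t = u"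
  by (metis mult.assoc mult.commute mult_1 mult_unit_inv ring_unitsI)

lemma unit_inv_unit_inv [simp]: "t \<in> ring_units \<Longrightarrow> unit_inv (unit_inv t) = t"
  by (rule unit_inv_eqI) simp

lemma unit_inv_one [simp]: "unit_inv 1 = 1"
  by (rule unit_inv_eqI) simp

lemma unit_mult_eq_0_iff: "t \<in> ring_units \<Longrightarrow> t * x = 0 \<longleftrightarrow> x = 0"
  by (metis mult.assoc mult_1 mult_zero_right unit_inv_mult)

section \<open>The algebra of a twist\<close>

locale twist =
  fixes \<Sigma> :: "'s tgroupoid" (structure)
    and G :: "'g tgroupoid"
    and i :: "'g \<times> 'r::comm_ring_1 \<Rightarrow> 's"
    and q :: "'s \<Rightarrow> 'g"
  assumes discrete_twist: "discrete_twist G \<Sigma> i q"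
begin

lemma etale: "etale G"
  and topological_groupoid_\<Sigma>: "topological_groupoid \<Sigma>"
  and unit_space_\<Sigma>: "unit_space \<Sigma> = i ` (unit_space G \<times> {1})"
  and hom_i: "groupoid_hom (trivial_bundle G) \<Sigma> i"
  and continuous_i: "continuous_map (gtop (trivial_bundle G :: ('g \<times> 'r) tgroupoid)) (gtop \<Sigma>) i"
  and hom_q: "groupoid_hom \<Sigma> G q"
  and continuous_q: "continuous_map (gtop \<Sigma>) (gtop G) q"
  and fibre_over_unit:
    "x \<in> unit_space G \<Longrightarrow> i ` ({x} \<times> ring_units) = {\<sigma> \<in> arrows \<Sigma>. q \<sigma> = x}"
  and inj_i: "inj_on i (unit_space G \<times> ring_units)"
  and surj_q: "q ` arrows \<Sigma> = arrows G"
  and act_commute: "\<sigma> \<in> arrows \<Sigma> \<Longrightarrow> t \<in> ring_units \<Longrightarrow>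
    i (q (rng \<Sigma> \<sigma>), t) \<odot> \<sigma> = \<sigma> \<odot> i (q (src \<Sigma> \<sigma>), t)"
  using discrete_twist unfolding discrete_twist_def by blast+

sublocale G: algebraic_groupoid G
  by unfold_locales (use etale in \<open>auto simp: etale_def topological_groupoid_def\<close>)

sublocale algebraic_groupoid \<Sigma>
  by unfold_locales (use topological_groupoid_\<Sigma> in \<open>auto simp: topological_groupoid_def\<close>)

abbreviation act :: "'r \<Rightarrow> 's \<Rightarrow> 's" where "act \<equiv> twist_act \<Sigma> i q"
abbreviation conv :: "('s \<Rightarrow> 'r) \<Rightarrow> ('s \<Rightarrow> 'r) \<Rightarrow> 's \<Rightarrow> 'r" where "conv \<equiv> twisted_conv G \<Sigma> q"

lemma q_closed [simp]: "\<sigma> \<in> arrows \<Sigma> \<Longrightarrow> q \<sigma> \<in> arrows G"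
  using surj_q by auto

lemma q_inv [simp]: "\<sigma> \<in> arrows \<Sigma> \<Longrightarrow> q (ginv \<Sigma> \<sigma>) = ginv G (q \<sigma>)"
  and q_rng [simp]: "\<sigma> \<in> arrows \<Sigma> \<Longrightarrow> q (rng \<Sigma> \<sigma>) = rng G (q \<sigma>)"
  and q_src [simp]: "\<sigma> \<in> arrows \<Sigma> \<Longrightarrow> q (src \<Sigma> \<sigma>) = src G (q \<sigma>)"
  using groupoid_hom_inv[OF groupoid G.groupoid hom_q] by auto

lemma i_closed [simp]: "x \<in> unit_space G \<Longrightarrow> t \<in> ring_units \<Longrightarrow> i (x, t) \<in> arrows \<Sigma>"
  and q_i [simp]: "x \<in> unit_space G \<Longrightarrow> t \<in> ring_units \<Longrightarrow> q (i (x, t)) = x"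
  using fibre_over_unit[of x] by auto

lemma i_one_in_unit_space [simp]: "x \<in> unit_space G \<Longrightarrow> i (x, 1) \<in> unit_space \<Sigma>"
  using unit_space_\<Sigma> by auto

lemma unit_eq_i: "x \<in> unit_space \<Sigma> \<Longrightarrow> i (q x, 1) = x"
  using unit_space_\<Sigma> by auto

lemma q_unit [simp]: "x \<in> unit_space \<Sigma> \<Longrightarrow> q x \<in> unit_space G"
  using unit_space_\<Sigma> by auto

lemma rng_eq_i: "\<sigma> \<in> arrows \<Sigma> \<Longrightarrow> rng \<Sigma> \<sigma> = i (rng G (q \<sigma>), 1)"
  and src_eq_i: "\<sigma> \<in> arrows \<Sigma> \<Longrightarrow> src \<Sigma> \<sigma> = i (src G (q \<sigma>), 1)"
  using unit_eq_i[of "rng \<Sigma> \<sigma>"] unit_eq_i[of "src \<Sigma> \<sigma>"] by auto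

lemma i_eq_iff: "x \<in> unit_space G \<Longrightarrow> t \<in> ring_units \<Longrightarrow> y \<in> unit_space G \<Longrightarrow> u \<in> ring_units \<Longrightarrow>
    i (x, t) = i (y, u) \<longleftrightarrow> x = y \<and> t = u"
  using inj_onD[OF inj_i, of "(x, t)" "(y, u)"] by auto

text \<open>Units of \<open>\<Sigma>\<close> have the form \<open>i (x, 1)\<close> and
  \<open>i\<close> is injective, so endpoints may be compared in \<open>G\<close>. As rewrite rules
  these move every composability condition from \<open>\<Sigma>\<close> to \<open>G\<close>.\<close>

lemma rng_eq_rng_iff [simp]: "\<sigma> \<in> arrows \<Sigma> \<Longrightarrow> \<tau> \<in> arrows \<Sigma> \<Longrightarrow>
    rng \<Sigma> \<sigma> = rng \<Sigma> \<tau> \<longleftrightarrow> rng G (q \<sigma>) = rng G (q \<tau>)"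
  and src_eq_rng_iff [simp]: "\<sigma> \<in> arrows \<Sigma> \<Longrightarrow> \<tau> \<in> arrows \<Sigma> \<Longrightarrow>
    src \<Sigma> \<sigma> = rng \<Sigma> \<tau> \<longleftrightarrow> src G (q \<sigma>) = rng G (q \<tau>)"
  and rng_eq_src_iff [simp]: "\<sigma> \<in> arrows \<Sigma> \<Longrightarrow> \<tau> \<in> arrows \<Sigma> \<Longrightarrow>
    rng \<Sigma> \<sigma> = src \<Sigma> \<tau> \<longleftrightarrow> rng G (q \<sigma>) = src G (q \<tau>)"
  and src_eq_src_iff [simp]: "\<sigma> \<in> arrows \<Sigma> \<Longrightarrow> \<tau> \<in> arrows \<Sigma> \<Longrightarrow>
    src \<Sigma> \<sigma> = src \<Sigma> \<tau> \<longleftrightarrow> src G (q \<sigma>) = src G (q \<tau>)"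
  by (simp_all add: rng_eq_i src_eq_i i_eq_iff)

lemma q_mult [simp]: "\<sigma> \<in> arrows \<Sigma> \<Longrightarrow> \<tau> \<in> arrows \<Sigma> \<Longrightarrow> src G (q \<sigma>) = rng G (q \<tau>) \<Longrightarrow>
    q (\<sigma> \<odot> \<tau>) = q \<sigma> \<odot>\<^bsub>G\<^esub> q \<tau>"
  using hom_q composable_iff unfolding groupoid_hom_def by simp

lemma i_mult [simp]: "x \<in> unit_space G \<Longrightarrow> t \<in> ring_units \<Longrightarrow> u \<in> ring_units \<Longrightarrow>
    i (x, t) \<odot> i (x, u) = i (x, t * u)"
  using hom_i unfolding groupoid_hom_def trivial_bundle_def by auto

lemma act_def: "\<sigma> \<in> arrows \<Sigma> \<Longrightarrow> act t \<sigma> = i (rng G (q \<sigma>), t) \<odot> \<sigma>"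
  unfolding twist_act_def by simp

lemma act_def': "\<sigma> \<in> arrows \<Sigma> \<Longrightarrow> t \<in> ring_units \<Longrightarrow> act t \<sigma> = \<sigma> \<odot> i (src G (q \<sigma>), t)"
  using act_commute[of \<sigma> t] unfolding twist_act_def by simp

lemma act_closed [simp]: "\<sigma> \<in> arrows \<Sigma> \<Longrightarrow> t \<in> ring_units \<Longrightarrow> act t \<sigma> \<in> arrows \<Sigma>"
  and q_act [simp]: "\<sigma> \<in> arrows \<Sigma> \<Longrightarrow> t \<in> ring_units \<Longrightarrow> q (act t \<sigma>) = q \<sigma>"
  by (simp_all add: act_def)

lemma rng_act [simp]: "\<sigma> \<in> arrows \<Sigma> \<Longrightarrow> t \<in> ring_units \<Longrightarrow> rng \<Sigma> (act t \<sigma>) = rng \<Sigma> \<sigma>"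
  and src_act [simp]: "\<sigma> \<in> arrows \<Sigma> \<Longrightarrow> t \<in> ring_units \<Longrightarrow> src \<Sigma> (act t \<sigma>) = src \<Sigma> \<sigma>"
  by simp_all

lemma act_one [simp]: "\<sigma> \<in> arrows \<Sigma> \<Longrightarrow> act 1 \<sigma> = \<sigma>"
  using rng_mult_self[of \<sigma>] by (simp add: act_def rng_eq_i del: rng_mult_self)

lemma act_act [simp]: "\<sigma> \<in> arrows \<Sigma> \<Longrightarrow> t \<in> ring_units \<Longrightarrow> u \<in> ring_units \<Longrightarrow>
    act t (act u \<sigma>) = act (t * u) \<sigma>"
  by (simp add: act_def mult_assoc[symmetric])

lemma act_mult_left [simp]: "\<sigma> \<in> arrows \<Sigma> \<Longrightarrow> \<tau> \<in> arrows \<Sigma> \<Longrightarrow> t \<in> ring_units \<Longrightarrow>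
    src G (q \<sigma>) = rng G (q \<tau>) \<Longrightarrow> act t \<sigma> \<odot> \<tau> = act t (\<sigma> \<odot> \<tau>)"
  by (simp add: act_def mult_assoc)

lemma act_mult_right [simp]: "\<sigma> \<in> arrows \<Sigma> \<Longrightarrow> \<tau> \<in> arrows \<Sigma> \<Longrightarrow> t \<in> ring_units \<Longrightarrow>
    src G (q \<sigma>) = rng G (q \<tau>) \<Longrightarrow> \<sigma> \<odot> act t \<tau> = act t (\<sigma> \<odot> \<tau>)"
  by (simp add: act_def' mult_assoc)

lemma inv_act [simp]: "\<sigma> \<in> arrows \<Sigma> \<Longrightarrow> t \<in> ring_units \<Longrightarrow>
    ginv \<Sigma> (act t \<sigma>) = act (unit_inv t) (ginv \<Sigma> \<sigma>)"
  by (rule inv_eqI[symmetric]) simp_all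

lemma act_eq_iff [simp]:
  assumes "\<sigma> \<in> arrows \<Sigma>" "t \<in> ring_units" "u \<in> ring_units"
  shows "act t \<sigma> = act u \<sigma> \<longleftrightarrow> t = u"
proof
  assume "act t \<sigma> = act u \<sigma>"
  then have "i (rng G (q \<sigma>), t) = i (rng G (q \<sigma>), u)"
    using assms by (metis act_def mult_inv_cancel i_closed G.rng_in_unit_space q_closed
        G.src_unit q_i src_eq_rng_iff)
  then show "t = u" using assms by (simp add: i_eq_iff)
qed simp

text \<open>The arrow \<open>\<tau> \<odot> ginv \<Sigma> \<sigma>\<close> lies over a unit, and
  (DT1) describes the fibre there as the image of the units of \<open>R\<close>.\<close>

lemma same_fibreE:
  assumes "\<sigma> \<in> arrows \<Sigma>" "\<tau> \<in> arrows \<Sigma>" "q \<sigma> = q \<tau>"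
  obtains t where "t \<in> ring_units" "\<tau> = act t \<sigma>"
proof -
  have "q (\<tau> \<odot> ginv \<Sigma> \<sigma>) = rng G (q \<sigma>)" using assms by simp
  moreover have "\<tau> \<odot> ginv \<Sigma> \<sigma> \<in> arrows \<Sigma>" using assms by simp
  ultimately have "\<tau> \<odot> ginv \<Sigma> \<sigma> \<in> i ` ({rng G (q \<sigma>)} \<times> ring_units)"
    using fibre_over_unit[of "rng G (q \<sigma>)"] assms by auto
  then obtain t where t: "t \<in> ring_units" "\<tau> \<odot> ginv \<Sigma> \<sigma> = i (rng G (q \<sigma>), t)" by auto
  have "\<tau> = (\<tau> \<odot> ginv \<Sigma> \<sigma>) \<odot> \<sigma>" using assms by simp
  then show ?thesis using that t assms by (metis act_def)
qed


section \<open>Convolution of equivariant functions\<close>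

definition equivariant :: "('s \<Rightarrow> 'r) \<Rightarrow> bool" where
  "equivariant f \<longleftrightarrow> supp f \<subseteq> arrows \<Sigma> \<and>
     (\<forall>\<sigma> \<in> arrows \<Sigma>. \<forall>t \<in> ring_units. f (act t \<sigma>) = unit_inv t * f \<sigma>)"

definition fibre_supp :: "('s \<Rightarrow> 'r) \<Rightarrow> 'g \<Rightarrow> 'g set" where
  "fibre_supp f x = {\<alpha> \<in> arrows G. rng G \<alpha> = x} \<inter> supp_G q f"

text \<open>Finite rows make the convolution sum finite, which is all that the algebraic identities
  require. They are proved for this larger class, so that topology can wait.\<close>

definition row_finite :: "('s \<Rightarrow> 'r) \<Rightarrow> bool" where
  "row_finite f \<longleftrightarrow> equivariant f \<and> (\<forall>x \<in> unit_space G. finite (fibre_supp f x))"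

lemma mem_fibre_supp: "\<alpha> \<in> fibre_supp f x \<longleftrightarrow> \<alpha> \<in> arrows G \<and> rng G \<alpha> = x \<and> \<alpha> \<in> supp_G q f"
  unfolding fibre_supp_def by auto

lemma row_finite_equivariant [simp]: "row_finite f \<Longrightarrow> equivariant f"
  and finite_row [simp]: "row_finite f \<Longrightarrow> x \<in> unit_space G \<Longrightarrow> finite (fibre_supp f x)"
  unfolding row_finite_def by auto

lemma equivariant_act:
  "equivariant f \<Longrightarrow> \<sigma> \<in> arrows \<Sigma> \<Longrightarrow> t \<in> ring_units \<Longrightarrow> f (act t \<sigma>) = unit_inv t * f \<sigma>"
  and equivariant_arrow: "equivariant f \<Longrightarrow> f \<sigma> \<noteq> 0 \<Longrightarrow> \<sigma> \<in> arrows \<Sigma>"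
  unfolding equivariant_def supp_def by auto

lemma equivariant_outside: "equivariant f \<Longrightarrow> \<sigma> \<notin> arrows \<Sigma> \<Longrightarrow> f \<sigma> = 0"
  using equivariant_arrow by blast

lemma equivariantI:
  assumes "\<And>\<sigma>. \<sigma> \<notin> arrows \<Sigma> \<Longrightarrow> f \<sigma> = 0"
    "\<And>\<sigma> t. \<sigma> \<in> arrows \<Sigma> \<Longrightarrow> t \<in> ring_units \<Longrightarrow> f (act t \<sigma>) = unit_inv t * f \<sigma>"
  shows "equivariant f"
  using assms unfolding equivariant_def supp_def by blast

lemma equivariant_fibre:
  assumes "equivariant f" "\<sigma> \<in> arrows \<Sigma>" "\<tau> \<in> arrows \<Sigma>" "q \<sigma> = q \<tau>"
  shows "f \<sigma> = 0 \<longleftrightarrow> f \<tau> = 0"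
  by (rule same_fibreE[OF assms(2-4)]) (use assms in \<open>simp add: equivariant_act unit_mult_eq_0_iff\<close>)

lemma q_in_supp_G [simp]: "equivariant f \<Longrightarrow> \<sigma> \<in> arrows \<Sigma> \<Longrightarrow> q \<sigma> \<in> supp_G q f \<longleftrightarrow> f \<sigma> \<noteq> 0"
proof
  assume f: "equivariant f" and \<sigma>: "\<sigma> \<in> arrows \<Sigma>" and "q \<sigma> \<in> supp_G q f"
  then obtain \<tau> where "f \<tau> \<noteq> 0" "q \<sigma> = q \<tau>" unfolding supp_G_def supp_def by auto
  then show "f \<sigma> \<noteq> 0" using equivariant_fibre[OF f \<sigma>, of \<tau>] equivariant_arrow[OF f] by simp
qed (auto simp: supp_G_def supp_def)

lemma supp_G_E:
  assumes "equivariant f" "\<alpha> \<in> supp_G q f"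
  obtains \<sigma> where "\<sigma> \<in> arrows \<Sigma>" "f \<sigma> \<noteq> 0" "q \<sigma> = \<alpha>"
  using assms equivariant_arrow unfolding supp_G_def supp_def by auto

lemma supp_G_arrows: "equivariant f \<Longrightarrow> supp_G q f \<subseteq> arrows G"
  by (auto elim: supp_G_E)

text \<open>The definition of the product chooses lifts by \<open>SOME\<close> over the exact
  support. Replacing a lift \<open>\<tau>\<close> by \<open>act t \<tau>\<close> multiplies the
  value of \<open>f\<close> by the inverse of \<open>t\<close> and that of \<open>g\<close> by
  \<open>t\<close>, so the terms do not change; arrows outside the support contribute zero. Hence
  any lift and any finite larger part of the row may be used.\<close>

lemma conv_eq_sum:
  assumes f: "equivariant f" and g: "equivariant g" and \<sigma>: "\<sigma> \<in> arrows \<Sigma>"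
    and F: "finite F" "fibre_supp f (rng G (q \<sigma>)) \<subseteq> F" "F \<subseteq> {\<alpha> \<in> arrows G. rng G \<alpha> = rng G (q \<sigma>)}"
    and S: "\<And>\<alpha>. \<alpha> \<in> F \<Longrightarrow> S \<alpha> \<in> arrows \<Sigma>" "\<And>\<alpha>. \<alpha> \<in> F \<Longrightarrow> q (S \<alpha>) = \<alpha>"
  shows "conv f g \<sigma> = (\<Sum>\<alpha>\<in>F. f (S \<alpha>) * g (ginv \<Sigma> (S \<alpha>) \<odot> \<sigma>))"
proof -
  let ?S = "\<lambda>\<alpha>. SOME \<tau>. \<tau> \<in> supp f \<and> q \<tau> = \<alpha>"
  have "conv f g \<sigma> = (\<Sum>\<alpha>\<in>fibre_supp f (rng G (q \<sigma>)). f (?S \<alpha>) * g (ginv \<Sigma> (?S \<alpha>) \<odot> \<sigma>))"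
    using \<sigma> unfolding twisted_conv_def fibre_supp_def by (simp add: Let_def)
  also have "\<dots> = (\<Sum>\<alpha>\<in>F. f (S \<alpha>) * g (ginv \<Sigma> (S \<alpha>) \<odot> \<sigma>))"
  proof (rule sum.mono_neutral_cong_left[OF F(1,2)], safe)
    fix \<alpha> assume \<alpha>: "\<alpha> \<in> F" "\<alpha> \<notin> fibre_supp f (rng G (q \<sigma>))"
    then have "f (S \<alpha>) = 0"
      using F(3) S[OF \<alpha>(1)] q_in_supp_G[OF f, of "S \<alpha>"] unfolding mem_fibre_supp by auto
    then show "f (S \<alpha>) * g (ginv \<Sigma> (S \<alpha>) \<odot> \<sigma>) = 0" by simp
  next
    fix \<alpha> assume \<alpha>: "\<alpha> \<in> fibre_supp f (rng G (q \<sigma>))"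
    then have "\<exists>\<tau>. \<tau> \<in> supp f \<and> q \<tau> = \<alpha>" unfolding mem_fibre_supp supp_G_def by auto
    then have s: "?S \<alpha> \<in> supp f \<and> q (?S \<alpha>) = \<alpha>" by (rule someI_ex)
    define \<tau> where "\<tau> = ?S \<alpha>"
    have \<tau>: "\<tau> \<in> arrows \<Sigma>" "q \<tau> = \<alpha>" using s f unfolding \<tau>_def equivariant_def by auto
    have \<alpha>F: "\<alpha> \<in> F" using \<alpha> F by auto
    obtain t where t: "t \<in> ring_units" "S \<alpha> = act t \<tau>"
      using same_fibreE[OF \<tau>(1), of "S \<alpha>"] S[OF \<alpha>F] \<tau> by auto
    have r: "rng G (q \<tau>) = rng G (q \<sigma>)" using \<alpha>F F(3) \<tau> by auto
    have "f (S \<alpha>) * g (ginv \<Sigma> (S \<alpha>) \<odot> \<sigma>) = (unit_inv t * t) * (f \<tau> * g (ginv \<Sigma> \<tau> \<odot> \<sigma>))"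
      using t \<tau>(1) \<sigma> f g r by (simp add: equivariant_act mult_ac del: unit_inv_mult mult_unit_inv)
    then show "f (?S \<alpha>) * g (ginv \<Sigma> (?S \<alpha>) \<odot> \<sigma>) = f (S \<alpha>) * g (ginv \<Sigma> (S \<alpha>) \<odot> \<sigma>)"
      using t(1) unfolding \<tau>_def by simp
  qed
  finally show ?thesis .
qed

lemma conv_outside [simp]: "\<sigma> \<notin> arrows \<Sigma> \<Longrightarrow> conv f g \<sigma> = 0"
  unfolding twisted_conv_def by simp

lemma conv_nonzeroE:
  assumes f: "equivariant f" and nz: "conv f g \<sigma> \<noteq> 0"
  obtains \<rho> where "\<sigma> \<in> arrows \<Sigma>" "\<rho> \<in> arrows \<Sigma>" "rng G (q \<rho>) = rng G (q \<sigma>)"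
    "f \<rho> \<noteq> 0" "g (ginv \<Sigma> \<rho> \<odot> \<sigma>) \<noteq> 0"
proof -
  have \<sigma>: "\<sigma> \<in> arrows \<Sigma>" using nz by (metis conv_outside)
  let ?S = "\<lambda>\<alpha>. SOME \<tau>. \<tau> \<in> supp f \<and> q \<tau> = \<alpha>"
  have "(\<Sum>\<alpha>\<in>fibre_supp f (rng G (q \<sigma>)). f (?S \<alpha>) * g (ginv \<Sigma> (?S \<alpha>) \<odot> \<sigma>)) \<noteq> 0"
    using \<sigma> nz unfolding twisted_conv_def fibre_supp_def by (simp add: Let_def)
  then obtain \<alpha> where \<alpha>: "\<alpha> \<in> fibre_supp f (rng G (q \<sigma>))" "f (?S \<alpha>) * g (ginv \<Sigma> (?S \<alpha>) \<odot> \<sigma>) \<noteq> 0"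
    by (rule sum.not_neutral_contains_not_neutral)
  then have "\<exists>\<tau>. \<tau> \<in> supp f \<and> q \<tau> = \<alpha>" unfolding mem_fibre_supp supp_G_def by auto
  then have "?S \<alpha> \<in> supp f \<and> q (?S \<alpha>) = \<alpha>" by (rule someI_ex)
  then show ?thesis
    using \<alpha> \<sigma> f equivariant_arrow[OF f] by (intro that[of "?S \<alpha>"]) (auto simp: mem_fibre_supp supp_def)
qed

lemma lift_exists: "\<exists>S. \<forall>\<alpha> \<in> arrows G. S \<alpha> \<in> arrows \<Sigma> \<and> q (S \<alpha>) = \<alpha>"
  by (intro bchoice ballI) (auto simp flip: surj_q)

text \<open>Products with indicators of slices, with functions on the unit space and with rows over
  a single arrow all reduce to this case of one surviving term.\<close>

lemma conv_single:
  assumes f: "row_finite f" and g: "equivariant g"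
    and \<sigma>: "\<sigma> \<in> arrows \<Sigma>" and \<tau>: "\<tau> \<in> arrows \<Sigma>" "rng G (q \<tau>) = rng G (q \<sigma>)"
    and single: "\<And>\<rho>. \<rho> \<in> arrows \<Sigma> \<Longrightarrow> rng G (q \<rho>) = rng G (q \<sigma>) \<Longrightarrow> f \<rho> \<noteq> 0 \<Longrightarrow>
      g (ginv \<Sigma> \<rho> \<odot> \<sigma>) \<noteq> 0 \<Longrightarrow> q \<rho> = q \<tau>"
  shows "conv f g \<sigma> = f \<tau> * g (ginv \<Sigma> \<tau> \<odot> \<sigma>)"
proof -
  obtain S0 where S0: "\<forall>\<alpha> \<in> arrows G. S0 \<alpha> \<in> arrows \<Sigma> \<and> q (S0 \<alpha>) = \<alpha>"
    using lift_exists by blast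
  \<comment> \<open>The lift is forced through \<open>\<tau>\<close>, so that the surviving term has
    the stated form.\<close>
  define S where "S = S0(q \<tau> := \<tau>)"
  have S: "\<alpha> \<in> arrows G \<Longrightarrow> S \<alpha> \<in> arrows \<Sigma> \<and> q (S \<alpha>) = \<alpha>" for \<alpha>
    using S0 \<tau> unfolding S_def by auto
  \<comment> \<open>\<open>f \<tau>\<close> may vanish, so \<open>q \<tau>\<close> need not lie in
    the row; the extra index then adds a zero term.\<close>
  define F where "F = insert (q \<tau>) (fibre_supp f (rng G (q \<sigma>)))"
  have F: "F \<subseteq> {\<alpha> \<in> arrows G. rng G \<alpha> = rng G (q \<sigma>)}" "finite F"
    using \<tau> f \<sigma> unfolding F_def by (auto simp: mem_fibre_supp)
  have "conv f g \<sigma> = (\<Sum>\<alpha>\<in>F. f (S \<alpha>) * g (ginv \<Sigma> (S \<alpha>) \<odot> \<sigma>))"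
    by (rule conv_eq_sum) (use F f g \<sigma> S in \<open>auto simp: F_def mem_fibre_supp\<close>)
  also have "\<dots> = (\<Sum>\<alpha>\<in>{q \<tau>}. f (S \<alpha>) * g (ginv \<Sigma> (S \<alpha>) \<odot> \<sigma>))"
  proof (rule sum.mono_neutral_right)
    show "\<forall>\<alpha>\<in>F - {q \<tau>}. f (S \<alpha>) * g (ginv \<Sigma> (S \<alpha>) \<odot> \<sigma>) = 0"
    proof
      fix \<alpha> assume \<alpha>: "\<alpha> \<in> F - {q \<tau>}"
      then have "S \<alpha> \<in> arrows \<Sigma>" "q (S \<alpha>) = \<alpha>" "rng G \<alpha> = rng G (q \<sigma>)" using F S by auto
      then show "f (S \<alpha>) * g (ginv \<Sigma> (S \<alpha>) \<odot> \<sigma>) = 0" using \<alpha> single[of "S \<alpha>"] by fastforce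
    qed
  qed (use F in \<open>auto simp: F_def\<close>)
  finally show ?thesis by (simp add: S_def)
qed

lemma equivariant_add: "equivariant f \<Longrightarrow> equivariant g \<Longrightarrow> equivariant (f + g)"
  by (rule equivariantI) (auto simp: distrib_left equivariant_act equivariant_outside)

lemma equivariant_scale: "equivariant f \<Longrightarrow> equivariant (\<lambda>\<sigma>. c * f \<sigma>)"
  by (rule equivariantI) (auto simp: mult_ac equivariant_act equivariant_outside)

lemma equivariant_zero [simp]: "equivariant 0"
  by (rule equivariantI) auto

lemma supp_G_add: "supp_G q (f + g) \<subseteq> supp_G q f \<union> supp_G q (g :: 's \<Rightarrow> 'r)"
proof -
  have "supp (f + g) \<subseteq> supp f \<union> supp g" unfolding supp_def by auto
  then show ?thesis unfolding supp_G_def by auto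
qed

lemma supp_G_scale: "supp_G q (\<lambda>\<sigma>. c * f \<sigma>) \<subseteq> supp_G q (f :: 's \<Rightarrow> 'r)"
proof -
  have "supp (\<lambda>\<sigma>. c * f \<sigma>) \<subseteq> supp f" unfolding supp_def by auto
  then show ?thesis unfolding supp_G_def by auto
qed

lemma row_finite_zero [simp]: "row_finite 0"
  by (simp add: row_finite_def fibre_supp_def supp_G_def supp_def)

lemma conv_equivariant:
  assumes f: "row_finite f" and g: "equivariant g"
  shows "equivariant (conv f g)"
  unfolding equivariant_def
proof (intro conjI ballI)
  show "supp (conv f g) \<subseteq> arrows \<Sigma>" unfolding supp_def using conv_outside by blast
  fix \<sigma> and t :: 'r assume \<sigma>: "\<sigma> \<in> arrows \<Sigma>" and t: "t \<in> ring_units"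
  obtain S where S: "\<forall>\<alpha> \<in> arrows G. S \<alpha> \<in> arrows \<Sigma> \<and> q (S \<alpha>) = \<alpha>"
    using lift_exists by blast
  let ?F = "fibre_supp f (rng G (q \<sigma>))"
  have "conv f g \<tau> = (\<Sum>\<alpha>\<in>?F. f (S \<alpha>) * g (ginv \<Sigma> (S \<alpha>) \<odot> \<tau>))" if "\<tau> \<in> {\<sigma>, act t \<sigma>}" for \<tau>
    by (rule conv_eq_sum) (use that f g \<sigma> t S in \<open>auto simp: mem_fibre_supp\<close>)
  then show "conv f g (act t \<sigma>) = unit_inv t * conv f g \<sigma>"
    using \<sigma> t S g by (auto simp: sum_distrib_left mem_fibre_supp equivariant_act mult_ac intro!: sum.cong)
qed

lemma conv_row_finite:
  assumes f: "row_finite f" and g: "row_finite g"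
  shows "row_finite (conv f g)"
  unfolding row_finite_def
proof (intro conjI ballI)
  show eq: "equivariant (conv f g)" using f g by (simp add: conv_equivariant)
  fix x assume x: "x \<in> unit_space G"
  let ?F = "\<Union>\<beta>\<in>fibre_supp f x. (\<lambda>\<gamma>. \<beta> \<odot>\<^bsub>G\<^esub> \<gamma>) ` fibre_supp g (src G \<beta>)"
  have "fibre_supp (conv f g) x \<subseteq> ?F"
  proof
    fix \<alpha> assume \<alpha>: "\<alpha> \<in> fibre_supp (conv f g) x"
    then obtain \<sigma> where \<sigma>: "\<sigma> \<in> arrows \<Sigma>" "q \<sigma> = \<alpha>" "conv f g \<sigma> \<noteq> 0" "rng G \<alpha> = x"
      unfolding mem_fibre_supp by (auto elim: supp_G_E[OF eq])
    obtain \<rho> where \<rho>: "\<rho> \<in> arrows \<Sigma>" "rng G (q \<rho>) = rng G (q \<sigma>)" "f \<rho> \<noteq> 0"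
        "g (ginv \<Sigma> \<rho> \<odot> \<sigma>) \<noteq> 0"
      using conv_nonzeroE[of f g \<sigma>] \<sigma> f by auto
    have "q \<rho> \<in> fibre_supp f x" using \<rho> \<sigma> f unfolding mem_fibre_supp by simp
    moreover have "q (ginv \<Sigma> \<rho> \<odot> \<sigma>) \<in> fibre_supp g (src G (q \<rho>))"
      using \<rho> \<sigma>(1) g unfolding mem_fibre_supp by (simp del: q_mult) simp
    moreover have "\<alpha> = q \<rho> \<odot>\<^bsub>G\<^esub> q (ginv \<Sigma> \<rho> \<odot> \<sigma>)" using \<rho> \<sigma>(1) by (simp flip: \<sigma>(2))
    ultimately show "\<alpha> \<in> ?F" by blast
  qed
  moreover have "finite ?F" using f g x by (intro finite_UN_I finite_imageI) (auto simp: mem_fibre_supp)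
  ultimately show "finite (fibre_supp (conv f g) x)" by (rule finite_subset)
qed

lemma conv_add_left:
  assumes "row_finite f" "row_finite f'" "equivariant g"
  shows "conv (f + f') g = conv f g + conv f' g"
proof
  fix \<sigma> show "conv (f + f') g \<sigma> = (conv f g + conv f' g) \<sigma>"
  proof (cases "\<sigma> \<in> arrows \<Sigma>")
    case \<sigma>: True
    obtain S where S: "\<forall>\<alpha> \<in> arrows G. S \<alpha> \<in> arrows \<Sigma> \<and> q (S \<alpha>) = \<alpha>"
      using lift_exists by blast
    let ?F = "fibre_supp f (rng G (q \<sigma>)) \<union> fibre_supp f' (rng G (q \<sigma>))"
    have "fibre_supp (f + f') (rng G (q \<sigma>)) \<subseteq> ?F" unfolding fibre_supp_def using supp_G_add by blast
    then have "conv h g \<sigma> = (\<Sum>\<alpha>\<in>?F. h (S \<alpha>) * g (ginv \<Sigma> (S \<alpha>) \<odot> \<sigma>))" if "h \<in> {f, f', f + f'}" for h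
      using that assms \<sigma> S
      by (intro conv_eq_sum)
        (auto simp: equivariant_add mem_fibre_supp)
    then show ?thesis by (simp add: sum.distrib distrib_right)
  qed simp
qed

lemma conv_add_right:
  assumes "row_finite f" "equivariant g" "equivariant g'"
  shows "conv f (g + g') = conv f g + conv f g'"
proof
  fix \<sigma> show "conv f (g + g') \<sigma> = (conv f g + conv f g') \<sigma>"
    unfolding twisted_conv_def by (simp add: Let_def sum.distrib distrib_left)
qed

lemma conv_scale_right: "conv f (\<lambda>\<sigma>. c * g \<sigma>) = (\<lambda>\<sigma>. c * conv f g \<sigma>)"
  by (rule ext) (simp add: twisted_conv_def Let_def sum_distrib_left mult_ac)

lemma conv_scale_left:
  assumes "row_finite f" "equivariant g"
  shows "conv (\<lambda>\<sigma>. c * f \<sigma>) g = (\<lambda>\<sigma>. c * conv f g \<sigma>)"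
proof
  fix \<sigma> show "conv (\<lambda>\<sigma>. c * f \<sigma>) g \<sigma> = c * conv f g \<sigma>"
  proof (cases "\<sigma> \<in> arrows \<Sigma>")
    case \<sigma>: True
    obtain S where S: "\<forall>\<alpha> \<in> arrows G. S \<alpha> \<in> arrows \<Sigma> \<and> q (S \<alpha>) = \<alpha>"
      using lift_exists by blast
    let ?F = "fibre_supp f (rng G (q \<sigma>))"
    have "fibre_supp (\<lambda>\<sigma>. c * f \<sigma>) (rng G (q \<sigma>)) \<subseteq> ?F" unfolding fibre_supp_def using supp_G_scale by blast
    then have "conv h g \<sigma> = (\<Sum>\<alpha>\<in>?F. h (S \<alpha>) * g (ginv \<Sigma> (S \<alpha>) \<odot> \<sigma>))" if "h \<in> {f, \<lambda>\<sigma>. c * f \<sigma>}" for h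
      using that assms \<sigma> S
      by (intro conv_eq_sum)
        (auto simp: equivariant_scale mem_fibre_supp)
    then show ?thesis by (simp add: sum_distrib_left mult_ac)
  qed simp
qed

lemma conv_zero_left [simp]: "conv 0 g = 0"
  by (rule ext) (simp add: twisted_conv_def supp_G_def supp_def Let_def)

lemma conv_zero_right [simp]: "conv f 0 = 0"
  by (rule ext) (simp add: twisted_conv_def Let_def)

text \<open>Both sides are double sums over a first arrow \<open>\<beta>\<close> and a partial
  product \<open>\<alpha>\<close>. After exchanging the sums, translation of \<open>\<alpha>\<close>
  by the inverse of \<open>\<beta>\<close> turns the inner sum into a value of
  \<open>conv g h\<close>.\<close>

lemma conv_assoc:
  assumes f: "row_finite f" and g: "row_finite g" and h: "row_finite h"
  shows "conv (conv f g) h = conv f (conv g h)"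
proof
  fix \<sigma> show "conv (conv f g) h \<sigma> = conv f (conv g h) \<sigma>"
  proof (cases "\<sigma> \<in> arrows \<Sigma>")
    case \<sigma>: True
    define x where "x = rng G (q \<sigma>)"
    have x: "x \<in> unit_space G" using \<sigma> unfolding x_def by simp
    obtain S where S: "\<forall>\<alpha> \<in> arrows G. S \<alpha> \<in> arrows \<Sigma> \<and> q (S \<alpha>) = \<alpha>"
      using lift_exists by blast
    define K where "K = fibre_supp f x"
    \<comment> \<open>Cancellation can make the row of \<open>conv f g\<close> smaller than the set
      of products of rows. \<open>L\<close> contains both: the row for the outer sum, and the
      products so that each translate of \<open>L\<close> covers the row of
      \<open>g\<close>.\<close>
    define L where "L = fibre_supp (conv f g) x \<union> (\<Union>\<beta>\<in>K. (\<lambda>\<gamma>. \<beta> \<odot>\<^bsub>G\<^esub> \<gamma>) ` fibre_supp g (src G \<beta>))"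
    have K: "finite K" "K \<subseteq> {\<alpha> \<in> arrows G. rng G \<alpha> = x}"
      using f x unfolding K_def by (simp, auto simp: mem_fibre_supp)
    have L: "finite L" "L \<subseteq> {\<alpha> \<in> arrows G. rng G \<alpha> = x}"
      using f g x K conv_row_finite[OF f g] unfolding L_def
      by (auto simp: mem_fibre_supp)
    have fibre_supp_L: "fibre_supp (conv f g) x \<subseteq> L" unfolding L_def by blast
    have fg: "equivariant (conv f g)" using f g by (simp add: conv_equivariant)
    have gh: "equivariant (conv g h)" using g h by (simp add: conv_equivariant)
    have "conv (conv f g) h \<sigma> = (\<Sum>\<alpha>\<in>L. conv f g (S \<alpha>) * h (ginv \<Sigma> (S \<alpha>) \<odot> \<sigma>))"
      by (rule conv_eq_sum) (use fg h \<sigma> L S in \<open>auto simp: x_def[symmetric] fibre_supp_L\<close>)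
    also have "\<dots> = (\<Sum>\<alpha>\<in>L. (\<Sum>\<beta>\<in>K. f (S \<beta>) * g (ginv \<Sigma> (S \<beta>) \<odot> S \<alpha>)) * h (ginv \<Sigma> (S \<alpha>) \<odot> \<sigma>))"
    proof (rule sum.cong[OF refl])
      fix \<alpha> assume \<alpha>: "\<alpha> \<in> L"
      have "conv f g (S \<alpha>) = (\<Sum>\<beta>\<in>K. f (S \<beta>) * g (ginv \<Sigma> (S \<beta>) \<odot> S \<alpha>))"
      proof (rule conv_eq_sum)
        have "S \<alpha> \<in> arrows \<Sigma>" "rng G (q (S \<alpha>)) = x" using \<alpha> L S by auto
        then show "S \<alpha> \<in> arrows \<Sigma>" "fibre_supp f (rng G (q (S \<alpha>))) \<subseteq> K"
          "K \<subseteq> {\<alpha>' \<in> arrows G. rng G \<alpha>' = rng G (q (S \<alpha>))}"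
          using K by (auto simp: K_def)
      qed (use f g K S in auto)
      then show "conv f g (S \<alpha>) * h (ginv \<Sigma> (S \<alpha>) \<odot> \<sigma>) =
        (\<Sum>\<beta>\<in>K. f (S \<beta>) * g (ginv \<Sigma> (S \<beta>) \<odot> S \<alpha>)) * h (ginv \<Sigma> (S \<alpha>) \<odot> \<sigma>)" by simp
    qed
    also have "\<dots> = (\<Sum>\<beta>\<in>K. f (S \<beta>) * (\<Sum>\<alpha>\<in>L. g (ginv \<Sigma> (S \<beta>) \<odot> S \<alpha>) * h (ginv \<Sigma> (S \<alpha>) \<odot> \<sigma>)))"
      by (simp add: sum_distrib_left sum_distrib_right mult_ac) (rule sum.swap)
    also have "\<dots> = (\<Sum>\<beta>\<in>K. f (S \<beta>) * conv g h (ginv \<Sigma> (S \<beta>) \<odot> \<sigma>))"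
    proof (rule sum.cong[OF refl])
      fix \<beta> assume \<beta>: "\<beta> \<in> K"
      let ?b = "S \<beta>"
      have b: "\<beta> \<in> arrows G" "rng G \<beta> = x" "?b \<in> arrows \<Sigma>" "q ?b = \<beta>" using \<beta> K S by auto
      define M where "M = (\<lambda>\<alpha>. ginv G \<beta> \<odot>\<^bsub>G\<^esub> \<alpha>) ` L"
      have M: "finite M" "M \<subseteq> {\<alpha> \<in> arrows G. rng G \<alpha> = src G \<beta>}"
        using L b unfolding M_def by auto
      have "fibre_supp g (src G \<beta>) \<subseteq> M"
      proof
        fix \<gamma> assume \<gamma>: "\<gamma> \<in> fibre_supp g (src G \<beta>)"
        then have "\<beta> \<odot>\<^bsub>G\<^esub> \<gamma> \<in> L" using \<beta> unfolding L_def by auto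
        moreover have "\<gamma> = ginv G \<beta> \<odot>\<^bsub>G\<^esub> (\<beta> \<odot>\<^bsub>G\<^esub> \<gamma>)" using \<gamma> b unfolding mem_fibre_supp by simp
        ultimately show "\<gamma> \<in> M" unfolding M_def by blast
      qed
      then have "conv g h (ginv \<Sigma> ?b \<odot> \<sigma>) =
          (\<Sum>\<gamma>\<in>M. g (ginv \<Sigma> ?b \<odot> S (\<beta> \<odot>\<^bsub>G\<^esub> \<gamma>)) *
            h (ginv \<Sigma> (ginv \<Sigma> ?b \<odot> S (\<beta> \<odot>\<^bsub>G\<^esub> \<gamma>)) \<odot> (ginv \<Sigma> ?b \<odot> \<sigma>)))"
        using g h b \<sigma> M S by (intro conv_eq_sum) (auto simp: x_def)
      also have "\<dots> = (\<Sum>\<alpha>\<in>L. g (ginv \<Sigma> ?b \<odot> S \<alpha>) * h (ginv \<Sigma> (S \<alpha>) \<odot> \<sigma>))"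
        unfolding M_def
      proof (subst sum.reindex)
        show "inj_on (\<lambda>\<alpha>. ginv G \<beta> \<odot>\<^bsub>G\<^esub> \<alpha>) L"
          using L b by (intro inj_on_inverseI[of _ "\<lambda>\<alpha>. \<beta> \<odot>\<^bsub>G\<^esub> \<alpha>"]) auto
        show "sum ((\<lambda>\<gamma>. g (ginv \<Sigma> ?b \<odot> S (\<beta> \<odot>\<^bsub>G\<^esub> \<gamma>)) *
            h (ginv \<Sigma> (ginv \<Sigma> ?b \<odot> S (\<beta> \<odot>\<^bsub>G\<^esub> \<gamma>)) \<odot> (ginv \<Sigma> ?b \<odot> \<sigma>))) \<circ> (\<lambda>\<alpha>. ginv G \<beta> \<odot>\<^bsub>G\<^esub> \<alpha>)) L =
          (\<Sum>\<alpha>\<in>L. g (ginv \<Sigma> ?b \<odot> S \<alpha>) * h (ginv \<Sigma> (S \<alpha>) \<odot> \<sigma>))"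
        proof (rule sum.cong[OF refl])
          fix \<alpha> assume \<alpha>: "\<alpha> \<in> L"
          have a: "\<alpha> \<in> arrows G" "rng G \<alpha> = x" "S \<alpha> \<in> arrows \<Sigma>" "q (S \<alpha>) = \<alpha>"
            using \<alpha> L S by auto
          have "ginv \<Sigma> (ginv \<Sigma> ?b \<odot> S \<alpha>) \<odot> (ginv \<Sigma> ?b \<odot> \<sigma>) = ginv \<Sigma> (S \<alpha>) \<odot> \<sigma>"
            using a b \<sigma> by (simp add: inv_mult mult_assoc x_def)
          then show "((\<lambda>\<gamma>. g (ginv \<Sigma> ?b \<odot> S (\<beta> \<odot>\<^bsub>G\<^esub> \<gamma>)) *
              h (ginv \<Sigma> (ginv \<Sigma> ?b \<odot> S (\<beta> \<odot>\<^bsub>G\<^esub> \<gamma>)) \<odot> (ginv \<Sigma> ?b \<odot> \<sigma>))) \<circ> (\<lambda>\<alpha>. ginv G \<beta> \<odot>\<^bsub>G\<^esub> \<alpha>)) \<alpha> =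
            g (ginv \<Sigma> ?b \<odot> S \<alpha>) * h (ginv \<Sigma> (S \<alpha>) \<odot> \<sigma>)"
            using a b by simp
        qed
      qed
      finally show "f ?b * (\<Sum>\<alpha>\<in>L. g (ginv \<Sigma> ?b \<odot> S \<alpha>) * h (ginv \<Sigma> (S \<alpha>) \<odot> \<sigma>)) =
          f ?b * conv g h (ginv \<Sigma> ?b \<odot> \<sigma>)" by simp
    qed
    also have "\<dots> = conv f (conv g h) \<sigma>"
      by (rule conv_eq_sum[symmetric]) (use f gh \<sigma> K S in \<open>auto simp: K_def x_def\<close>)
    finally show ?thesis .
  qed simp
qed

end


lemma ring_units_nonzero [simp]: "0 \<notin> (ring_units :: 'r::comm_ring_1 set)"
  unfolding ring_units_def by simp

context twist
begin

section \<open>Indicator functions of slices\<close>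

lemma equivariant_eqI:
  assumes "equivariant f" "equivariant g" "\<And>\<sigma>. \<sigma> \<in> arrows \<Sigma> \<Longrightarrow> f \<sigma> = g \<sigma>"
  shows "f = g"
proof
  show "f \<sigma> = g \<sigma>" for \<sigma>
    using assms by (cases "\<sigma> \<in> arrows \<Sigma>") (simp_all add: equivariant_outside)
qed

text \<open>The set-theoretic content of a bisection of \<open>\<Sigma>\<close>; it suffices for
  computing products. Openness and compactness are added in \<open>compact_slice\<close>.\<close>

definition slice :: "'s set \<Rightarrow> bool" where
  "slice X \<longleftrightarrow> X \<subseteq> arrows \<Sigma> \<and> inj_on (rng \<Sigma>) X \<and> inj_on (src \<Sigma>) X"

lemma slice_arrow: "slice X \<Longrightarrow> \<sigma> \<in> X \<Longrightarrow> \<sigma> \<in> arrows \<Sigma>"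
  unfolding slice_def by auto

lemma slice_rng: "slice X \<Longrightarrow> \<sigma> \<in> X \<Longrightarrow> \<tau> \<in> X \<Longrightarrow> rng G (q \<sigma>) = rng G (q \<tau>) \<Longrightarrow> \<sigma> = \<tau>"
  and slice_src: "slice X \<Longrightarrow> \<sigma> \<in> X \<Longrightarrow> \<tau> \<in> X \<Longrightarrow> src G (q \<sigma>) = src G (q \<tau>) \<Longrightarrow> \<sigma> = \<tau>"
  unfolding slice_def by (blast intro: inj_onD rng_eq_rng_iff[THEN iffD2]
      src_eq_src_iff[THEN iffD2])+

lemma slice_q: "slice X \<Longrightarrow> \<sigma> \<in> X \<Longrightarrow> \<tau> \<in> X \<Longrightarrow> q \<sigma> = q \<tau> \<Longrightarrow> \<sigma> = \<tau>"
  using slice_rng by metis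

lemma slice_subset: "slice X \<Longrightarrow> Y \<subseteq> X \<Longrightarrow> slice Y"
  unfolding slice_def by (auto intro: inj_on_subset)

lemma slice_inv:
  assumes "slice X"
  shows "slice (ginv \<Sigma> ` X)"
proof -
  note arr = slice_arrow[OF assms]
  show ?thesis
    unfolding slice_def
    by (auto simp: arr intro!: inj_onI arg_cong[of _ _ "ginv \<Sigma>"]
        intro: slice_rng[OF assms] slice_src[OF assms])
qed

lemma inv_inv_image: "slice X \<Longrightarrow> ginv \<Sigma> ` ginv \<Sigma> ` X = X"
  by (force simp: image_image slice_arrow)

text \<open>This is \<open>1\<close> on \<open>X\<close> and \<open>t\<inverse>\<close> on \<open>t \<cdot> X\<close>: the value at \<open>\<sigma>\<close> is the unit moving \<open>\<sigma>\<close> into \<open>X\<close>.\<close>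

definition ind :: "'s set \<Rightarrow> 's \<Rightarrow> 'r" where
  "ind X \<sigma> = (if \<sigma> \<in> arrows \<Sigma> \<and> (\<exists>u \<in> ring_units. act u \<sigma> \<in> X)
     then THE u. u \<in> ring_units \<and> act u \<sigma> \<in> X else 0)"

lemma ind_eq:
  assumes "slice X" "\<sigma> \<in> arrows \<Sigma>" "u \<in> ring_units" "act u \<sigma> \<in> X"
  shows "ind X \<sigma> = u"
proof -
  have "v = u" if v: "v \<in> ring_units" "act v \<sigma> \<in> X" for v
  proof -
    have "act v \<sigma> = act u \<sigma>" using assms v by (intro slice_q[OF assms(1)]) auto
    then show ?thesis using assms v by simp
  qed
  then have "(THE u. u \<in> ring_units \<and> act u \<sigma> \<in> X) = u" using assms by blast
  then show ?thesis using assms unfolding ind_def by auto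
qed

lemma ind_one: "slice X \<Longrightarrow> \<sigma> \<in> X \<Longrightarrow> ind X \<sigma> = 1"
  by (rule ind_eq) (auto simp: slice_arrow)

lemma ind_act: "slice X \<Longrightarrow> \<sigma> \<in> X \<Longrightarrow> t \<in> ring_units \<Longrightarrow> ind X (act t \<sigma>) = unit_inv t"
  by (rule ind_eq) (auto simp: slice_arrow)

lemma ind_eq_0: "\<sigma> \<notin> arrows \<Sigma> \<or> q \<sigma> \<notin> q ` X \<Longrightarrow> ind X \<sigma> = 0"
  unfolding ind_def using q_act by (auto simp: image_iff dest: q_act[symmetric])

lemma ind_cases:
  assumes "slice X" "\<sigma> \<in> arrows \<Sigma>"
  obtains t \<tau> where "t \<in> ring_units" "\<tau> \<in> X" "\<sigma> = act t \<tau>" "ind X \<sigma> = unit_inv t"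
  | "q \<sigma> \<notin> q ` X" "ind X \<sigma> = 0"
proof (cases "q \<sigma> \<in> q ` X")
  case True
  then obtain \<tau> where \<tau>: "\<tau> \<in> X" "q \<tau> = q \<sigma>" by auto
  then obtain t where "t \<in> ring_units" "\<sigma> = act t \<tau>"
    using same_fibreE[of \<tau> \<sigma>] assms slice_arrow by metis
  then show ?thesis using that(1) \<tau> assms ind_act by metis
qed (use that(2) ind_eq_0 in blast)

lemma ind_nonzero_iff:
  assumes X: "slice X" and \<sigma>: "\<sigma> \<in> arrows \<Sigma>"
  shows "ind X \<sigma> \<noteq> 0 \<longleftrightarrow> q \<sigma> \<in> q ` X"
    by (rule ind_cases[OF X \<sigma>]) (use slice_arrow[OF X] unit_inv_in_ring_units in force)+

text \<open>The value at \<open>act t \<tau>\<close> with \<open>\<tau> \<in> X\<close> is the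
  inverse of \<open>t\<close>, which is \<open>1\<close> only for \<open>t = 1\<close>. So
  \<open>ind X\<close> determines \<open>X\<close> itself and not only its image in
  \<open>G\<close>; injectivity and openness of \<open>\<Phi>\<close> rest on this.\<close>

lemma ind_eq_1_iff:
  assumes "slice X" "\<sigma> \<in> arrows \<Sigma>"
  shows "ind X \<sigma> = 1 \<longleftrightarrow> \<sigma> \<in> X"
proof
  assume 1: "ind X \<sigma> = 1"
  from assms show "\<sigma> \<in> X"
  proof (cases rule: ind_cases)
    case (1 t \<tau>)
    then have "t = 1" using \<open>ind X \<sigma> = 1\<close> unit_inv_unit_inv[of t] by simp
    then show ?thesis using 1 assms slice_arrow by simp
  qed (use 1 in simp)
qed (use assms ind_one in auto)

lemma equivariant_ind [simp]:
  assumes X: "slice X"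
  shows "equivariant (ind X)"
proof (rule equivariantI)
  fix \<sigma> and t :: 'r assume \<sigma>: "\<sigma> \<in> arrows \<Sigma>" and t: "t \<in> ring_units"
  from X \<sigma> show "ind X (act t \<sigma>) = unit_inv t * ind X \<sigma>"
  proof (cases rule: ind_cases)
    case (1 u \<tau>)
    then have "ind X (act t \<sigma>) = unit_inv (t * u)" using X t by (simp add: slice_arrow ind_act)
    also have "\<dots> = unit_inv t * unit_inv u"
      by (rule unit_inv_eqI) (use 1(1) t in \<open>simp add: mult_ac mult.left_commute[of u]
          mult.assoc[symmetric, of u "unit_inv u"]\<close>)
    finally show ?thesis using 1 by simp
  qed (use \<sigma> t ind_eq_0 in simp)
qed (simp add: ind_eq_0)

lemma supp_G_ind [simp]: "slice X \<Longrightarrow> supp_G q (ind X) = q ` X"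
  by (auto elim!: supp_G_E[rotated] simp: ind_nonzero_iff slice_arrow)

lemma row_finite_ind [simp]:
  assumes X: "slice X"
  shows "row_finite (ind X)"
  unfolding row_finite_def
proof (intro conjI ballI)
  fix x
  have "fibre_supp (ind X) x \<subseteq> {\<alpha>}" if "\<alpha> \<in> fibre_supp (ind X) x" for \<alpha>
    using that X by (auto simp: mem_fibre_supp dest: slice_rng[OF X])
  then show "finite (fibre_supp (ind X) x)" by (metis finite.simps finite_subset ex_in_conv)
qed (use X in simp)

text \<open>A slice has at most one element of a given range, so left multiplication by its
  indicator translates rows. The right-hand version does the same along sources.\<close>

lemma conv_ind_left:
  assumes X: "slice X" and g: "equivariant g" and \<tau>: "\<tau> \<in> X" and \<sigma>: "\<sigma> \<in> arrows \<Sigma>"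
    and r: "rng G (q \<tau>) = rng G (q \<sigma>)"
  shows "conv (ind X) g \<sigma> = g (ginv \<Sigma> \<tau> \<odot> \<sigma>)"
proof -
  have "conv (ind X) g \<sigma> = ind X \<tau> * g (ginv \<Sigma> \<tau> \<odot> \<sigma>)"
  proof (rule conv_single)
    fix \<rho> assume \<rho>: "\<rho> \<in> arrows \<Sigma>" "rng G (q \<rho>) = rng G (q \<sigma>)" "ind X \<rho> \<noteq> 0"
    then obtain \<tau>' where "\<tau>' \<in> X" "q \<rho> = q \<tau>'" using X ind_nonzero_iff by auto
    then show "q \<rho> = q \<tau>" using \<rho> r \<tau> X slice_rng by metis
  qed (use assms slice_arrow in auto)
  then show ?thesis using X \<tau> by (simp add: ind_one)
qed

lemma conv_ind_left_eq_0:
  assumes X: "slice X" and \<sigma>: "\<And>\<tau>. \<tau> \<in> X \<Longrightarrow> rng G (q \<tau>) \<noteq> rng G (q \<sigma>)"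
  shows "conv (ind X) g \<sigma> = 0"
proof (rule ccontr)
  assume "conv (ind X) g \<sigma> \<noteq> 0"
  then obtain \<rho> where "\<rho> \<in> arrows \<Sigma>" "rng G (q \<rho>) = rng G (q \<sigma>)" "ind X \<rho> \<noteq> 0"
    using conv_nonzeroE[of "ind X" g \<sigma>] X equivariant_ind by metis
  then show False using X \<sigma> ind_nonzero_iff by force
qed

lemma conv_ind_right:
  assumes X: "slice X" and f: "row_finite f" and \<tau>: "\<tau> \<in> X" and \<sigma>: "\<sigma> \<in> arrows \<Sigma>"
    and s: "src G (q \<tau>) = src G (q \<sigma>)"
  shows "conv f (ind X) \<sigma> = f (\<sigma> \<odot> ginv \<Sigma> \<tau>)"
proof -
  have a: "\<tau> \<in> arrows \<Sigma>" using X \<tau> slice_arrow by auto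
  let ?r = "\<sigma> \<odot> ginv \<Sigma> \<tau>"
  have "conv f (ind X) \<sigma> = f ?r * ind X (ginv \<Sigma> ?r \<odot> \<sigma>)"
  proof (rule conv_single)
    fix \<rho> assume \<rho>: "\<rho> \<in> arrows \<Sigma>" "rng G (q \<rho>) = rng G (q \<sigma>)" "ind X (ginv \<Sigma> \<rho> \<odot> \<sigma>) \<noteq> 0"
    then obtain \<tau>' where \<tau>': "\<tau>' \<in> X" "q (ginv \<Sigma> \<rho> \<odot> \<sigma>) = q \<tau>'"
      using X ind_nonzero_iff[OF X, of "ginv \<Sigma> \<rho> \<odot> \<sigma>"] \<sigma> by auto
    then have "src G (q \<tau>') = src G (q \<tau>)" using \<rho> \<sigma> s by (simp flip: \<tau>'(2))
    then have "\<tau>' = \<tau>" using slice_src[OF X \<tau>'(1) \<tau>] by simp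
    then have "q \<tau> = ginv G (q \<rho>) \<odot>\<^bsub>G\<^esub> q \<sigma>" using \<tau>' \<rho> \<sigma> by simp
    then show "q \<rho> = q ?r" using a \<sigma> \<rho> s by (simp add: G.inv_mult)
  qed (use assms a in auto)
  moreover have "ginv \<Sigma> ?r \<odot> \<sigma> = \<tau>" using a \<sigma> s by (simp add: inv_mult mult_assoc)
  ultimately show ?thesis using X \<tau> by (simp add: ind_one)
qed

lemma conv_ind_inv_ind:
  assumes X: "slice X"
  shows "conv (ind X) (conv (ind (ginv \<Sigma> ` X)) (ind X)) = ind X"
proof (rule equivariant_eqI)
  note [simp] = X slice_inv[OF X] conv_equivariant
  show "equivariant (conv (ind X) (conv (ind (ginv \<Sigma> ` X)) (ind X)))" "equivariant (ind X)"
    by simp_all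
  fix \<sigma> assume \<sigma>: "\<sigma> \<in> arrows \<Sigma>"
  show "conv (ind X) (conv (ind (ginv \<Sigma> ` X)) (ind X)) \<sigma> = ind X \<sigma>"
  proof (cases "\<exists>\<tau> \<in> X. rng G (q \<tau>) = rng G (q \<sigma>)")
    case True
    then obtain \<tau> where \<tau>: "\<tau> \<in> X" "rng G (q \<tau>) = rng G (q \<sigma>)" "\<tau> \<in> arrows \<Sigma>"
      using slice_arrow X by blast
    then have "conv (ind X) (conv (ind (ginv \<Sigma> ` X)) (ind X)) \<sigma> =
        conv (ind (ginv \<Sigma> ` X)) (ind X) (ginv \<Sigma> \<tau> \<odot> \<sigma>)"
      using \<sigma> by (intro conv_ind_left) auto
    also have "\<dots> = ind X (ginv \<Sigma> (ginv \<Sigma> \<tau>) \<odot> (ginv \<Sigma> \<tau> \<odot> \<sigma>))"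
      using \<sigma> \<tau> by (intro conv_ind_left) auto
    finally show ?thesis using \<sigma> \<tau> by simp
  next
    case False
    then show ?thesis using conv_ind_left_eq_0[OF X, of \<sigma>] ind_eq_0[of \<sigma> X] by force
  qed
qed


section \<open>Functions on the unit space\<close>

text \<open>The part of membership in \<open>B\<close> that does not involve the topology.\<close>

definition diagonal :: "('s \<Rightarrow> 'r) \<Rightarrow> bool" where
  "diagonal b \<longleftrightarrow> row_finite b \<and> (\<forall>\<sigma>. b \<sigma> \<noteq> 0 \<longrightarrow> q \<sigma> \<in> unit_space G)"

lemma diagonal_row_finite [simp]: "diagonal b \<Longrightarrow> row_finite b"
  and diagonalD: "diagonal b \<Longrightarrow> b \<sigma> \<noteq> 0 \<Longrightarrow> q \<sigma> \<in> unit_space G"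
  unfolding diagonal_def by auto

lemma conv_diagonal_left:
  assumes b: "diagonal b" and f: "equivariant f" and \<sigma>: "\<sigma> \<in> arrows \<Sigma>"
  shows "conv b f \<sigma> = b (rng \<Sigma> \<sigma>) * f \<sigma>"
proof -
  have "conv b f \<sigma> = b (rng \<Sigma> \<sigma>) * f (ginv \<Sigma> (rng \<Sigma> \<sigma>) \<odot> \<sigma>)"
  proof (rule conv_single)
    fix \<rho> assume "\<rho> \<in> arrows \<Sigma>" "rng G (q \<rho>) = rng G (q \<sigma>)" "b \<rho> \<noteq> 0"
    then show "q \<rho> = q (rng \<Sigma> \<sigma>)" using diagonalD[OF b, of \<rho>] \<sigma> by simp
  qed (use assms in auto)
  then show ?thesis using \<sigma> by simp
qed

lemma conv_diagonal_right:
  assumes b: "diagonal b" and f: "row_finite f" and \<sigma>: "\<sigma> \<in> arrows \<Sigma>"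
  shows "conv f b \<sigma> = f \<sigma> * b (src \<Sigma> \<sigma>)"
proof -
  have "conv f b \<sigma> = f \<sigma> * b (ginv \<Sigma> \<sigma> \<odot> \<sigma>)"
  proof (rule conv_single)
    fix \<rho> assume \<rho>: "\<rho> \<in> arrows \<Sigma>" "rng G (q \<rho>) = rng G (q \<sigma>)" "b (ginv \<Sigma> \<rho> \<odot> \<sigma>) \<noteq> 0"
    then show "q \<rho> = q \<sigma>"
      using diagonalD[OF b \<rho>(3)] \<sigma> G.inv_mult_in_unit_space[of "q \<rho>" "q \<sigma>"] by simp
  qed (use assms in auto)
  then show ?thesis by simp
qed

text \<open>Every arrow over a unit of \<open>G\<close> is a translate of a unit of
  \<open>\<Sigma>\<close>, so equivariance determines the function from its values on
  \<open>unit_space \<Sigma>\<close>.\<close>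

lemma diagonal_eqI:
  assumes b: "diagonal b" "diagonal b'" and eq: "\<And>x. x \<in> unit_space \<Sigma> \<Longrightarrow> b x = b' x"
  shows "b = b'"
proof (rule equivariant_eqI)
  fix \<sigma> assume \<sigma>: "\<sigma> \<in> arrows \<Sigma>"
  show "b \<sigma> = b' \<sigma>"
  proof (cases "q \<sigma> \<in> unit_space G")
    case True
    define x where "x = i (q \<sigma>, 1)"
    have x: "x \<in> unit_space \<Sigma>" "x \<in> arrows \<Sigma>" "q x = q \<sigma>" using True unfolding x_def by auto
    then obtain t where "t \<in> ring_units" "\<sigma> = act t x" using same_fibreE \<sigma> by metis
    then show ?thesis using x b eq by (simp add: equivariant_act)
  next
    case False
    then show ?thesis using diagonalD b by metis
  qed
qed (use b in auto)

definition unit_lift :: "'g set \<Rightarrow> 's set" where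
  "unit_lift K = (\<lambda>x. i (x, 1)) ` K"

text \<open>On the units of \<open>\<Sigma>\<close> this is the ordinary indicator of
  \<open>K\<close>. For compact open \<open>K\<close> these will turn out to be the idempotents of
  \<open>B\<close>.\<close>

abbreviation chi :: "'g set \<Rightarrow> 's \<Rightarrow> 'r" where
  "chi K \<equiv> ind (unit_lift K)"

lemma slice_unit_lift [simp]: "K \<subseteq> unit_space G \<Longrightarrow> slice (unit_lift K)"
  unfolding slice_def unit_lift_def using unit_space_arrow
  by (auto simp: subset_iff inj_on_def rng_unit src_unit)

lemma q_unit_lift: "K \<subseteq> unit_space G \<Longrightarrow> q ` unit_lift K = K"
  unfolding unit_lift_def by (auto simp: image_image subset_iff image_iff)

lemma diagonal_ind:
  assumes "slice X" "q ` X \<subseteq> unit_space G"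
  shows "diagonal (ind X)"
  using assms row_finite_ind unfolding diagonal_def by (blast intro: ind_eq_0)

lemma diagonal_chi [simp]: "K \<subseteq> unit_space G \<Longrightarrow> diagonal (chi K)"
  by (rule diagonal_ind) (auto simp: q_unit_lift)

lemma chi_unit:
  assumes K: "K \<subseteq> unit_space G" and x: "x \<in> unit_space \<Sigma>"
  shows "chi K x = (if q x \<in> K then 1 else 0)"
proof (cases "q x \<in> K")
  case True
  then have "x \<in> unit_lift K" using unit_eq_i[OF x] unfolding unit_lift_def by (metis imageI)
  then show ?thesis using True K by (simp add: ind_one)
qed (use K ind_eq_0 in \<open>simp add: q_unit_lift\<close>)

lemma conv_chi_left:
  "K \<subseteq> unit_space G \<Longrightarrow> equivariant f \<Longrightarrow> \<sigma> \<in> arrows \<Sigma> \<Longrightarrow>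
    conv (chi K) f \<sigma> = (if rng G (q \<sigma>) \<in> K then f \<sigma> else 0)"
  by (simp add: conv_diagonal_left chi_unit)

lemma conv_chi_right:
  "K \<subseteq> unit_space G \<Longrightarrow> row_finite f \<Longrightarrow> \<sigma> \<in> arrows \<Sigma> \<Longrightarrow>
    conv f (chi K) \<sigma> = (if src G (q \<sigma>) \<in> K then f \<sigma> else 0)"
  by (simp add: conv_diagonal_right chi_unit)

text \<open>If the product is nonzero at \<open>\<sigma>\<close>, there is
  \<open>\<tau> \<in> X\<close> for which \<open>\<tau> \<odot> \<sigma>\<close> lies over an arrow
  of the image of \<open>X\<close>. It has the range of \<open>\<tau>\<close>, so the slice property
  puts it over \<open>q \<tau>\<close>, and cancelling shows that \<open>q \<sigma>\<close> is a
  unit. This is the normaliser condition for indicators of slices.\<close>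

lemma diagonal_conj_ind:
  assumes X: "slice X" and b: "diagonal b"
  shows "diagonal (conv (ind (ginv \<Sigma> ` X)) (conv b (ind X)))"
  unfolding diagonal_def
proof (intro conjI allI impI)
  note [simp] = X b slice_inv[OF X] conv_row_finite
  show "row_finite (conv (ind (ginv \<Sigma> ` X)) (conv b (ind X)))" by simp
  fix \<sigma> assume nz: "conv (ind (ginv \<Sigma> ` X)) (conv b (ind X)) \<sigma> \<noteq> 0"
  then have \<sigma>: "\<sigma> \<in> arrows \<Sigma>" by (metis conv_outside)
  obtain \<tau> where \<tau>: "\<tau> \<in> X" "rng G (q (ginv \<Sigma> \<tau>)) = rng G (q \<sigma>)"
    using conv_ind_left_eq_0[of "ginv \<Sigma> ` X" \<sigma>] nz by (metis X image_iff slice_inv)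
  have a: "\<tau> \<in> arrows \<Sigma>" by (rule slice_arrow) fact+
  have "conv (ind (ginv \<Sigma> ` X)) (conv b (ind X)) \<sigma> = conv b (ind X) (ginv \<Sigma> (ginv \<Sigma> \<tau>) \<odot> \<sigma>)"
    using \<tau> \<sigma> by (intro conv_ind_left) auto
  also have "\<dots> = b (rng \<Sigma> (\<tau> \<odot> \<sigma>)) * ind X (\<tau> \<odot> \<sigma>)"
    using \<tau> \<sigma> a by (subst conv_diagonal_left) auto
  finally have "ind X (\<tau> \<odot> \<sigma>) \<noteq> 0" using nz by auto
  moreover have \<tau>\<sigma>: "\<tau> \<odot> \<sigma> \<in> arrows \<Sigma>" using \<tau> \<sigma> a by simp
  ultimately obtain \<rho> where \<rho>: "\<rho> \<in> X" "q (\<tau> \<odot> \<sigma>) = q \<rho>" using ind_nonzero_iff[OF X] by auto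
  have "rng G (q \<rho>) = rng G (q \<tau>)" using \<tau> \<sigma> a by (simp flip: \<rho>(2))
  then have "\<rho> = \<tau>" using slice_rng X \<rho> \<tau> by metis
  then have "q \<tau> \<odot>\<^bsub>G\<^esub> q \<sigma> = q \<tau>" using \<rho> \<tau> \<sigma> a by simp
  then have "q \<sigma> = src G (q \<tau>)"
    using G.inv_mult_cancel[of "q \<tau>" "q \<sigma>"] \<tau> \<sigma> a by simp
  then show "q \<sigma> \<in> unit_space G" using a by simp
qed

end


section \<open>Topological groupoids\<close>

lemma continuous_map_gmult:
  assumes H: "topological_groupoid H"
    and f: "continuous_map X (gtop H) f" and g: "continuous_map X (gtop H) g"
    and c: "\<And>x. x \<in> topspace X \<Longrightarrow> composable H (f x) (g x)"
  shows "continuous_map X (gtop H) (\<lambda>x. f x \<odot>\<^bsub>H\<^esub> g x)"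
proof -
  have "continuous_map X (subtopology (prod_topology (gtop H) (gtop H)) {(a, b). composable H a b})
      (\<lambda>x. (f x, g x))"
    using f g c by (auto simp: continuous_map_in_subtopology continuous_map_paired)
  moreover have "continuous_map
       (subtopology (prod_topology (gtop H) (gtop H)) {(a, b). composable H a b})
       (gtop H) (\<lambda>(a, b). a \<odot>\<^bsub>H\<^esub> b)"
    using H unfolding topological_groupoid_def by blast
  ultimately show ?thesis
    using continuous_map_compose[of X _ "\<lambda>x. (f x, g x)"] by (fastforce simp: o_def)
qed

lemma continuous_map_ginv: "topological_groupoid H \<Longrightarrow> continuous_map (gtop H) (gtop H) (ginv H)"
  unfolding topological_groupoid_def by blast

lemma continuous_map_rng: "topological_groupoid H \<Longrightarrow> continuous_map (gtop H) (gtop H) (rng H)"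
  and continuous_map_src: "topological_groupoid H \<Longrightarrow> continuous_map (gtop H) (gtop H) (src H)"
proof -
  assume H: "topological_groupoid H"
  interpret algebraic_groupoid H
    by unfold_locales (use H in \<open>auto simp: topological_groupoid_def\<close>)
  show "continuous_map (gtop H) (gtop H) (rng H)" "continuous_map (gtop H) (gtop H) (src H)"
    unfolding rng_def[abs_def] src_def[abs_def]
    by (rule continuous_map_gmult[OF H];
        simp add: continuous_map_ginv[OF H] composable_inv composable_inv')+
qed

lemma open_ginv_image:
  assumes H: "topological_groupoid H" and U: "openin (gtop H) U"
  shows "openin (gtop H) (ginv H ` U)"
proof -
  interpret algebraic_groupoid H
    by unfold_locales (use H in \<open>auto simp: topological_groupoid_def\<close>)
  have "ginv H ` U = {a \<in> arrows H. ginv H a \<in> U}"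
    using openin_subset[OF U] by (force simp: image_iff)
  then show ?thesis
    using openin_continuous_map_preimage[OF continuous_map_ginv[OF H] U] by simp
qed

text \<open>The source map is the range map after inversion, which is a homeomorphism. So openness
  of the range map yields the source half as well.\<close>

lemma open_bisectionI:
  assumes H: "topological_groupoid H" and U: "openin (gtop H) U"
    and inj: "inj_on (rng H) U" "inj_on (src H) U"
    and opn: "\<And>V. openin (gtop H) V \<Longrightarrow> openin (unit_top H) (rng H ` V)"
  shows "open_bisection H U"
proof -
  interpret algebraic_groupoid H
    by unfold_locales (use H in \<open>auto simp: topological_groupoid_def\<close>)
  have src_image: "src H ` V = rng H ` ginv H ` V" if "V \<subseteq> arrows H" for V
    using that by (force simp: image_image intro!: image_cong)
  have opn': "openin (unit_top H) (src H ` V)" if "openin (gtop H) V" for V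
    using opn[OF open_ginv_image[OF H that]] src_image[OF openin_subset[OF that]] by simp
  have hom: "homeomorphic_map (subtopology (gtop H) U) (subtopology (unit_top H) (f ` U)) f"
    if f: "continuous_map (gtop H) (gtop H) f" "inj_on f U" "f ` U \<subseteq> unit_space H"
      and o: "\<And>V. openin (gtop H) V \<Longrightarrow> openin (unit_top H) (f ` V)" for f
  proof (rule bijective_open_imp_homeomorphic_map)
    have UA: "U \<subseteq> arrows H" using U openin_subset by blast
    have fU: "f ` U \<subseteq> arrows H" using f(3) unit_space_arrow by blast
    show "continuous_map (subtopology (gtop H) U) (subtopology (unit_top H) (f ` U)) f"
      using f UA by (auto simp: unit_top_def continuous_map_in_subtopology image_subset_iff
          intro: continuous_map_from_subtopology)
    show "open_map (subtopology (gtop H) U) (subtopology (unit_top H) (f ` U)) f"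
      unfolding open_map_def
    proof (intro allI impI)
      fix V assume "openin (subtopology (gtop H) U) V"
      then have V: "openin (gtop H) V" "V \<subseteq> U" using U by (auto simp: openin_open_subtopology)
      then show "openin (subtopology (unit_top H) (f ` U)) (f ` V)"
        using o[OF U] o by (auto simp: openin_open_subtopology)
    qed
    show "f ` topspace (subtopology (gtop H) U) = topspace (subtopology (unit_top H) (f ` U))"
      using UA f(3) fU by (auto simp: unit_top_def)
    show "inj_on f (topspace (subtopology (gtop H) U))" using f(2) UA by (simp add: inj_on_def)
  qed
  have UA: "U \<subseteq> arrows H" using U openin_subset by blast
  have "homeomorphic_map (subtopology (gtop H) U) (subtopology (unit_top H) (rng H ` U)) (rng H)"
    by (rule hom[OF continuous_map_rng[OF H] inj(1) _ opn]) (use UA in auto)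
  moreover
  have "homeomorphic_map (subtopology (gtop H) U) (subtopology (unit_top H) (src H ` U)) (src H)"
    by (rule hom[OF continuous_map_src[OF H] inj(2) _ opn']) (use UA in auto)
  ultimately show ?thesis
    unfolding open_bisection_def using U opn[OF U] opn'[OF U] by blast
qed

lemma open_bisection_inj:
  assumes "open_bisection H U"
  shows "inj_on (rng H) U" "inj_on (src H) U"
proof -
  have U: "U \<subseteq> arrows H" using assms openin_subset unfolding open_bisection_def by blast
  have "inj_on (rng H) (topspace (subtopology (gtop H) U))"
    "inj_on (src H) (topspace (subtopology (gtop H) U))"
    using assms homeomorphic_imp_injective_map unfolding open_bisection_def by blast+
  then show "inj_on (rng H) U" "inj_on (src H) U" using U by (auto simp: Int_absorb1)
qed

lemma compact_open_bisection_inj: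
  assumes "compact_open_bisection H K"
  shows "openin (gtop H) K" "compactin (gtop H) K" "inj_on (rng H) K" "inj_on (src H) K"
  using assms open_bisection_inj inj_on_subset
  unfolding compact_open_bisection_def bisection_def by metis+

section \<open>Ample Hausdorff groupoids\<close>

locale ample_groupoid =
  fixes G :: "'g tgroupoid" (structure)
  assumes ample: "ample G" and Hausdorff: "Hausdorff_space (gtop G)"
begin

lemma topological_groupoid: "topological_groupoid G"
  using ample unfolding ample_def etale_def by blast

sublocale algebraic_groupoid G
  by unfold_locales (use topological_groupoid in \<open>auto simp: topological_groupoid_def\<close>)

lemmas continuous_rng = continuous_map_rng[OF topological_groupoid]
lemmas continuous_src = continuous_map_src[OF topological_groupoid]

lemma compact_open_bisectionE:
  assumes "openin (gtop G) U" "a \<in> U"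
  obtains K where "compact_open_bisection G K" "a \<in> K" "K \<subseteq> U"
  using assms ample unfolding ample_def by blast

text \<open>Let \<open>K\<close> be a bisection around a unit. If \<open>a\<close> and
  \<open>rng G a\<close> both lie in \<open>K\<close>, they have the same range, so injectivity of
  the range map on \<open>K\<close> gives \<open>a = rng G a\<close>.\<close>

lemma openin_unit_space: "openin (gtop G) (unit_space G)"
proof (subst openin_subopen, intro ballI)
  fix x assume x: "x \<in> unit_space G"
  then obtain K where K: "compact_open_bisection G K" "x \<in> K" "K \<subseteq> arrows G"
    using compact_open_bisectionE[of "arrows G" x] unit_space_arrow by blast
  note K' = compact_open_bisection_inj[OF K(1)]
  let ?V = "{a \<in> K. rng G a \<in> K}"
  have "openin (gtop G) ?V"
    using openin_continuous_map_preimage_gen[OF continuous_rng K'(1) K'(1)] .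
  moreover have "?V \<subseteq> unit_space G"
  proof
    fix a assume a: "a \<in> ?V"
    then have "rng G (rng G a) = rng G a" using K by auto
    then have "rng G a = a" using a inj_onD[OF K'(3)] by blast
    then show "a \<in> unit_space G" using a K mem_unit_space by auto
  qed
  ultimately show "\<exists>T. openin (gtop G) T \<and> x \<in> T \<and> T \<subseteq> unit_space G" using x K by auto
qed

text \<open>The units are the equaliser of the range map and the identity, which is closed because
  \<open>G\<close> is Hausdorff.\<close>

lemma closedin_unit_space: "closedin (gtop G) (unit_space G)"
proof -
  have "closedin (gtop G) {a \<in> arrows G. rng G a = id a}"
    by (rule closedin_continuous_maps_eq[OF Hausdorff continuous_rng]) simp
  moreover have "{a \<in> arrows G. rng G a = id a} = unit_space G" by (auto simp: mem_unit_space)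
  ultimately show ?thesis by metis
qed

lemma openin_unit_top_iff: "openin (unit_top G) U \<longleftrightarrow> openin (gtop G) U \<and> U \<subseteq> unit_space G"
  unfolding unit_top_def by (simp add: openin_open_subtopology openin_unit_space)

lemma openin_rng_image:
  assumes U: "openin (gtop G) U"
  shows "openin (unit_top G) (rng G ` U)"
proof (subst openin_subopen, intro ballI)
  fix x assume "x \<in> rng G ` U"
  then obtain a where a: "a \<in> U" "x = rng G a" by auto
  then obtain K where K: "compact_open_bisection G K" "a \<in> K" "K \<subseteq> U"
    using compact_open_bisectionE U by metis
  then obtain V where V: "open_bisection G V" "K \<subseteq> V" "openin (gtop G) K"
    unfolding compact_open_bisection_def bisection_def by auto
  then have "openin (gtop G) V" "openin (unit_top G) (rng G ` V)"
    and h: "homeomorphic_map (subtopology (gtop G) V) (subtopology (unit_top G) (rng G ` V)) (rng G)"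
    unfolding open_bisection_def by auto
  moreover have "openin (subtopology (unit_top G) (rng G ` V)) (rng G ` K)"
    using homeomorphic_imp_open_map[OF h] V \<open>openin (gtop G) V\<close>
    unfolding open_map_def by (auto simp: openin_open_subtopology)
  ultimately have "openin (unit_top G) (rng G ` K)" by (auto dest: openin_trans_full)
  then show "\<exists>T. openin (unit_top G) T \<and> x \<in> T \<and> T \<subseteq> rng G ` U" using a K by blast
qed

lemma open_bisection_iff:
  "open_bisection G U \<longleftrightarrow> openin (gtop G) U \<and> inj_on (rng G) U \<and> inj_on (src G) U"
proof
  assume "open_bisection G U"
  then show "openin (gtop G) U \<and> inj_on (rng G) U \<and> inj_on (src G) U"
    using open_bisection_inj unfolding open_bisection_def by blast
qed (use open_bisectionI[OF topological_groupoid] openin_rng_image in blast)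

lemma compact_closed: "compactin (gtop G) K \<Longrightarrow> closedin (gtop G) K"
  using compactin_imp_closedin Hausdorff by blast

lemma openin_diff_compact:
  "openin (gtop G) U \<Longrightarrow> compactin (gtop G) K \<Longrightarrow> openin (gtop G) (U - K)"
  by (simp add: compact_closed openin_diff)

lemma compact_open_rng_image:
  assumes "openin (gtop G) U" "compactin (gtop G) U"
  shows "openin (gtop G) (rng G ` U)" "compactin (gtop G) (rng G ` U)"
  using openin_rng_image[OF assms(1)] image_compactin[OF assms(2) continuous_rng]
  by (simp_all add: openin_unit_top_iff)

lemma unit_neighbourhoodE:
  assumes "openin (gtop G) U" "x \<in> U" "x \<in> unit_space G"
  obtains K where "openin (gtop G) K" "compactin (gtop G) K" "K \<subseteq> unit_space G" "x \<in> K" "K \<subseteq> U"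
proof -
  have "openin (gtop G) (U \<inter> unit_space G)" using assms openin_unit_space by blast
  then obtain K where K: "compact_open_bisection G K" "x \<in> K" "K \<subseteq> U \<inter> unit_space G"
    using compact_open_bisectionE[of "U \<inter> unit_space G" x] assms by blast
  then show ?thesis using that compact_open_bisection_inj(1,2)[OF K(1)] by blast
qed

text \<open>Finitely many bisections cover the compact set, and each contains at most one arrow of
  the given range.\<close>

lemma finite_fibre_compact:
  assumes C: "compactin (gtop G) C"
  shows "finite {a \<in> C. rng G a = x}"
proof -
  let ?F = "{a \<in> C. rng G a = x}"
  have CA: "C \<subseteq> arrows G" using C compactin_subset_topspace by blast
  obtain \<F> where \<F>: "finite \<F>" "\<F> \<subseteq> {K. compact_open_bisection G K}" "C \<subseteq> \<Union>\<F>"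
  proof -
    have "C \<subseteq> \<Union>{K. compact_open_bisection G K}"
      using CA compact_open_bisectionE[of "arrows G"] by blast
    then show ?thesis
      using compactinD[OF C, of "{K. compact_open_bisection G K}"] compact_open_bisection_inj(1) that
      by blast
  qed
  have "finite (K \<inter> ?F)" if "K \<in> \<F>" for K
  proof -
    have "inj_on (rng G) K" using that \<F> compact_open_bisection_inj(3) by blast
    then have "inj_on (rng G) (K \<inter> ?F)" by (rule inj_on_subset) auto
    then show ?thesis by (rule inj_on_finite[where B = "{x}"]) auto
  qed
  then have "finite (\<Union>K\<in>\<F>. K \<inter> ?F)" using \<F>(1) by blast
  moreover have "?F \<subseteq> (\<Union>K\<in>\<F>. K \<inter> ?F)" using \<F>(3) by blast
  ultimately show ?thesis by (rule finite_subset[rotated])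
qed

text \<open>Composability is equality of two continuous maps into a Hausdorff space, so the
  composable pairs in a compact product form a compact set; multiplication is continuous on
  it.\<close>

lemma compactin_mult:
  assumes C: "compactin (gtop G) C" "compactin (gtop G) C'"
  shows "compactin (gtop G) {a \<odot> b | a b. a \<in> C \<and> b \<in> C' \<and> src G a = rng G b}"
proof -
  let ?P = "prod_topology (gtop G) (gtop G)"
  let ?M = "{(a, b). composable G a b}"
  have CA: "C \<subseteq> arrows G" "C' \<subseteq> arrows G" using C compactin_subset_topspace by blast+
  have "closedin ?P {p \<in> topspace ?P. src G (fst p) = rng G (snd p)}"
    using continuous_map_compose[OF continuous_map_fst continuous_src]
      continuous_map_compose[OF continuous_map_snd continuous_rng]
    by (intro closedin_continuous_maps_eq[OF Hausdorff]) (auto simp: o_def)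
  moreover have "compactin ?P (C \<times> C')" using C by (simp add: compactin_Times)
  ultimately have "compactin ?P ({p \<in> topspace ?P. src G (fst p) = rng G (snd p)} \<inter> C \<times> C')"
    by (rule closed_Int_compactin)
  moreover have "{p \<in> topspace ?P. src G (fst p) = rng G (snd p)} \<inter> C \<times> C' = ?M \<inter> C \<times> C'"
    using CA by (auto simp: composable_iff)
  ultimately have "compactin (subtopology ?P ?M) (?M \<inter> C \<times> C')"
    by (simp add: compactin_subtopology)
  then have "compactin (gtop G) ((\<lambda>(a, b). a \<odot> b) ` (?M \<inter> C \<times> C'))"
    using topological_groupoid unfolding topological_groupoid_def by (blast intro: image_compactin)
  moreover have "(\<lambda>(a, b). a \<odot> b) ` (?M \<inter> C \<times> C') =
      {a \<odot> b | a b. a \<in> C \<and> b \<in> C' \<and> src G a = rng G b}"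
    using CA by (auto simp: composable_iff)
  ultimately show ?thesis by simp
qed

end

locale ample_twist = twist \<Sigma> G i q
  for \<Sigma> :: "'s tgroupoid" (structure) and G :: "'g tgroupoid"
    and i :: "'g \<times> 'r::comm_ring_1 \<Rightarrow> 's" and q :: "'s \<Rightarrow> 'g" +
  assumes ample_G: "ample G" and Hausdorff_G: "Hausdorff_space (gtop G)"
begin

sublocale G: ample_groupoid G
  by unfold_locales (fact ample_G Hausdorff_G)+


section \<open>Compact open slices\<close>

lemmas continuous_rng = continuous_map_rng[OF topological_groupoid_\<Sigma>]

lemma openin_q_preimage: "openin (gtop G) U \<Longrightarrow> openin (gtop \<Sigma>) {\<sigma> \<in> arrows \<Sigma>. q \<sigma> \<in> U}"
  by (rule openin_continuous_map_preimage[OF continuous_q])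

lemma continuous_i_unit: "t \<in> ring_units \<Longrightarrow> continuous_map (unit_top G) (gtop \<Sigma>) (\<lambda>x. i (x, t))"
  using continuous_i continuous_map_compose[of "unit_top G"
      "prod_topology (unit_top G) (discrete_topology ring_units)" "\<lambda>x. (x, t)" "gtop \<Sigma>" i]
  by (simp add: trivial_bundle_def continuous_map_paired o_def)

lemma continuous_act: "t \<in> ring_units \<Longrightarrow> continuous_map (gtop \<Sigma>) (gtop \<Sigma>) (act t)"
  unfolding twist_act_def[abs_def]
proof (rule continuous_map_gmult[OF topological_groupoid_\<Sigma>])
  assume t: "t \<in> ring_units"
  have "continuous_map (gtop \<Sigma>) (unit_top G) (\<lambda>\<sigma>. q (rng \<Sigma> \<sigma>))"
    using continuous_map_compose[OF continuous_rng continuous_q]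
    by (auto simp: unit_top_def continuous_map_in_subtopology o_def)
  from continuous_map_compose[OF this continuous_i_unit[OF t]]
  show "continuous_map (gtop \<Sigma>) (gtop \<Sigma>) (\<lambda>\<sigma>. i (q (rng \<Sigma> \<sigma>), t))" by (simp add: o_def)
qed (auto simp: composable_iff)

lemma openin_act_image:
  assumes W: "openin (gtop \<Sigma>) W" and t: "t \<in> ring_units"
  shows "openin (gtop \<Sigma>) (act t ` W)"
proof -
  have "act t ` W = {\<sigma> \<in> arrows \<Sigma>. act (unit_inv t) \<sigma> \<in> W}"
  proof (intro equalityI subsetI)
    fix \<sigma> assume "\<sigma> \<in> {\<sigma> \<in> arrows \<Sigma>. act (unit_inv t) \<sigma> \<in> W}"
    then have "\<sigma> = act t (act (unit_inv t) \<sigma>)" "act (unit_inv t) \<sigma> \<in> W" using t by auto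
    then show "\<sigma> \<in> act t ` W" by blast
  qed (use openin_subset[OF W] t in auto)
  then show ?thesis
    using openin_continuous_map_preimage[OF continuous_act[of "unit_inv t"] W] t by simp
qed

text \<open>This repackages (DT2): the local section is absorbed into the chart
  \<open>h\<close>.\<close>

lemma trivialisation:
  assumes "\<alpha> \<in> arrows G"
  obtains D h where "openin (gtop G) D" "\<alpha> \<in> D"
    "\<And>\<beta> t. \<beta> \<in> D \<Longrightarrow> t \<in> ring_units \<Longrightarrow> h (\<beta>, t) \<in> arrows \<Sigma> \<and> q (h (\<beta>, t)) = \<beta>"
    "homeomorphic_map
       (prod_topology (subtopology (gtop G) D) (discrete_topology (ring_units :: 'r set)))
       (subtopology (gtop \<Sigma>) {\<sigma> \<in> arrows \<Sigma>. q \<sigma> \<in> D}) h"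
proof -
  have "\<forall>\<alpha> \<in> arrows G. \<exists>D P. open_bisection G D \<and> \<alpha> \<in> D \<and>
        continuous_map (subtopology (gtop G) D) (gtop \<Sigma>) P \<and>
        (\<forall>\<beta> \<in> D. q (P \<beta>) = \<beta>) \<and>
        homeomorphic_map
          (prod_topology (subtopology (gtop G) D) (discrete_topology (ring_units :: 'r set)))
          (subtopology (gtop \<Sigma>) {\<sigma> \<in> arrows \<Sigma>. q \<sigma> \<in> D})
          (\<lambda>(\<beta>, t). i (rng G \<beta>, t) \<odot> P \<beta>)"
    using discrete_twist unfolding discrete_twist_def by (elim conjE)
  then obtain D P where D: "open_bisection G D" "\<alpha> \<in> D"
    and P: "continuous_map (subtopology (gtop G) D) (gtop \<Sigma>) P" "\<forall>\<beta> \<in> D. q (P \<beta>) = \<beta>"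
    and h: "homeomorphic_map
          (prod_topology (subtopology (gtop G) D) (discrete_topology (ring_units :: 'r set)))
          (subtopology (gtop \<Sigma>) {\<sigma> \<in> arrows \<Sigma>. q \<sigma> \<in> D})
          (\<lambda>(\<beta>, t). i (rng G \<beta>, t) \<odot> P \<beta>)"
    using assms by blast
  have oD: "openin (gtop G) D" using D unfolding open_bisection_def by auto
  have "P \<beta> \<in> arrows \<Sigma>" if "\<beta> \<in> D" for \<beta>
    using P(1) that openin_subset[OF oD] by (auto simp: continuous_map_def Pi_iff)
  then have "i (rng G \<beta>, t) \<odot> P \<beta> \<in> arrows \<Sigma> \<and> q (i (rng G \<beta>, t) \<odot> P \<beta>) = \<beta>"
    if "\<beta> \<in> D" "t \<in> ring_units" for \<beta> t
    using that P(2) act_def[of "P \<beta>" t] act_closed[of "P \<beta>" t] q_act[of "P \<beta>" t] by auto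
  then show ?thesis
    by (intro that[of D "\<lambda>(\<beta>, t). i (rng G \<beta>, t) \<odot> P \<beta>"]) (use oD D h in simp_all)
qed

definition compact_slice :: "'s set \<Rightarrow> bool" where
  "compact_slice X \<longleftrightarrow> slice X \<and> openin (gtop \<Sigma>) X \<and> compactin (gtop \<Sigma>) X"

lemma compact_sliceD [simp]: "compact_slice X \<Longrightarrow> slice X"
  and compact_slice_open: "compact_slice X \<Longrightarrow> openin (gtop \<Sigma>) X"
  and compact_slice_compact: "compact_slice X \<Longrightarrow> compactin (gtop \<Sigma>) X"
  unfolding compact_slice_def by auto

text \<open>In a chart the units of \<open>R\<close> carry the discrete topology, so a compact open
  bisection \<open>K\<close> of \<open>G\<close> times a single unit \<open>t\<close> is compact and
  open. Its image has constant second coordinate and projects bijectively to \<open>K\<close>, so it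
  is a slice.\<close>

lemma compact_slice_neighbourhood:
  assumes W: "openin (gtop \<Sigma>) W" "\<sigma> \<in> W"
  obtains X where "compact_slice X" "\<sigma> \<in> X" "X \<subseteq> W" "openin (gtop G) (q ` X)"
proof -
  have \<sigma>: "\<sigma> \<in> arrows \<Sigma>" using W openin_subset by blast
  obtain D h where D: "openin (gtop G) D" "q \<sigma> \<in> D"
    and qh: "\<And>\<beta> t. \<beta> \<in> D \<Longrightarrow> t \<in> ring_units \<Longrightarrow> h (\<beta>, t) \<in> arrows \<Sigma> \<and> q (h (\<beta>, t)) = \<beta>"
    and h: "homeomorphic_map
       (prod_topology (subtopology (gtop G) D) (discrete_topology (ring_units :: 'r set)))
       (subtopology (gtop \<Sigma>) {\<sigma> \<in> arrows \<Sigma>. q \<sigma> \<in> D}) h"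
      (is "homeomorphic_map ?P ?S h")
    by (rule trivialisation[of "q \<sigma>"]) (use \<sigma> in simp, blast)
  have DA: "D \<subseteq> arrows G" using D openin_subset by blast
  have top: "topspace ?P = D \<times> ring_units" "topspace ?S = {\<sigma> \<in> arrows \<Sigma>. q \<sigma> \<in> D}"
    using DA by auto
  obtain \<beta> t where \<beta>t: "\<beta> \<in> D" "t \<in> ring_units" "h (\<beta>, t) = \<sigma>"
  proof -
    have "\<sigma> \<in> h ` topspace ?P" using homeomorphic_imp_surjective_map[OF h] \<sigma> D(2) top by simp
    then show ?thesis using that unfolding top by auto
  qed
  then have \<beta>: "\<beta> = q \<sigma>" using qh by auto
  have oS: "openin (gtop \<Sigma>) {\<sigma> \<in> arrows \<Sigma>. q \<sigma> \<in> D}" using D openin_q_preimage by blast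
  have "openin ?S (W \<inter> {\<sigma> \<in> arrows \<Sigma>. q \<sigma> \<in> D})"
    using openin_Int[OF W(1) oS] oS by (simp add: openin_open_subtopology)
  then have "openin ?P {p \<in> topspace ?P. h p \<in> W \<inter> {\<sigma> \<in> arrows \<Sigma>. q \<sigma> \<in> D}}"
    using homeomorphic_imp_continuous_map[OF h] openin_continuous_map_preimage by blast
  moreover have "(\<beta>, t) \<in> {p \<in> topspace ?P. h p \<in> W \<inter> {\<sigma> \<in> arrows \<Sigma>. q \<sigma> \<in> D}}"
    unfolding top using \<beta>t W \<sigma> D by auto
  ultimately obtain U V where UV: "openin (subtopology (gtop G) D) U" "\<beta> \<in> U" "t \<in> V"
    "U \<times> V \<subseteq> {p \<in> topspace ?P. h p \<in> W \<inter> {\<sigma> \<in> arrows \<Sigma>. q \<sigma> \<in> D}}"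
    unfolding openin_prod_topology_alt by meson
  have U: "openin (gtop G) U" "U \<subseteq> D" using UV(1) D by (auto simp: openin_open_subtopology)
  obtain K where K: "compact_open_bisection G K" "\<beta> \<in> K" "K \<subseteq> U"
    using G.compact_open_bisectionE U UV by metis
  note K' = compact_open_bisection_inj[OF K(1)]
  have KD: "K \<subseteq> D" using K U by auto
  define X where "X = h ` (K \<times> {t})"
  have Kt: "openin ?P (K \<times> {t})" "compactin ?P (K \<times> {t})"
    using K' KD D \<beta>t
    by (auto simp: openin_prod_Times_iff openin_open_subtopology compactin_Times compactin_subtopology)
  have qX: "q ` X = K" using qh KD \<beta>t unfolding X_def by (force simp: image_image)
  show ?thesis
  proof (rule that)
    have "openin ?S X" using homeomorphic_imp_open_map[OF h] Kt(1) unfolding open_map_def X_def by blast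
    then have "openin (gtop \<Sigma>) X" using oS openin_trans_full by blast
    moreover have "compactin ?S X"
      unfolding X_def using image_compactin[OF Kt(2) homeomorphic_imp_continuous_map[OF h]] .
    then have "compactin (gtop \<Sigma>) X" by (simp add: compactin_subtopology)
    moreover have "slice X"
      unfolding slice_def X_def inj_on_def
      using qh KD \<beta>t(2) K'(3,4) by (auto simp: subset_iff inj_on_def)
    ultimately show "compact_slice X" unfolding compact_slice_def by auto
    show "\<sigma> \<in> X" unfolding X_def using \<beta>t K by auto
    show "X \<subseteq> W" unfolding X_def using UV K by auto
    show "openin (gtop G) (q ` X)" using qX K' by simp
  qed
qed

lemma openin_q_image:
  assumes W: "openin (gtop \<Sigma>) W"
  shows "openin (gtop G) (q ` W)"
proof (subst openin_subopen, intro ballI)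
  fix \<alpha> assume "\<alpha> \<in> q ` W"
  then obtain \<sigma> where \<sigma>: "\<sigma> \<in> W" "\<alpha> = q \<sigma>" by auto
  obtain X where "\<sigma> \<in> X" "X \<subseteq> W" "openin (gtop G) (q ` X)"
    using compact_slice_neighbourhood W \<sigma> by metis
  then show "\<exists>T. openin (gtop G) T \<and> \<alpha> \<in> T \<and> T \<subseteq> q ` W" using \<sigma> by blast
qed

lemma compact_slice_q_image:
  assumes "compact_slice X"
  shows "openin (gtop G) (q ` X)" "compactin (gtop G) (q ` X)"
  using openin_q_image compact_slice_open image_compactin[OF compact_slice_compact continuous_q] assms
  by blast+

text \<open>The homeomorphism of unit spaces alone does not make units open in
  \<open>\<Sigma>\<close>. A slice through \<open>i (x, 1)\<close> meets each fibre of
  \<open>q\<close> at most once, so over the open set of points \<open>y\<close> with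
  \<open>i (y, 1)\<close> in the slice it consists of units only.\<close>

lemma openin_unit_lift:
  assumes N: "openin (unit_top G) N"
  shows "openin (gtop \<Sigma>) (unit_lift N)"
proof (subst openin_subopen, intro ballI)
  fix \<sigma> assume "\<sigma> \<in> unit_lift N"
  then obtain x where x: "x \<in> N" "\<sigma> = i (x, 1)" unfolding unit_lift_def by auto
  have NG: "N \<subseteq> unit_space G" "openin (gtop G) N" using N G.openin_unit_top_iff by auto
  have \<sigma>: "\<sigma> \<in> arrows \<Sigma>" using x NG by auto
  obtain X where X: "compact_slice X" "\<sigma> \<in> X" "X \<subseteq> arrows \<Sigma>"
    using compact_slice_neighbourhood[OF openin_topspace \<sigma>] by metis
  let ?N = "{y \<in> N. i (y, 1) \<in> X}"
  have "openin (unit_top G) ?N"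
    using openin_continuous_map_preimage_gen[OF continuous_i_unit N compact_slice_open[OF X(1)]] by simp
  then have "openin (gtop \<Sigma>) (X \<inter> {\<sigma> \<in> arrows \<Sigma>. q \<sigma> \<in> ?N})"
    using compact_slice_open[OF X(1)] openin_q_preimage G.openin_unit_top_iff by blast
  moreover have "X \<inter> {\<sigma> \<in> arrows \<Sigma>. q \<sigma> \<in> ?N} \<subseteq> unit_lift N"
  proof
    fix \<tau> assume \<tau>: "\<tau> \<in> X \<inter> {\<sigma> \<in> arrows \<Sigma>. q \<sigma> \<in> ?N}"
    then have "i (q \<tau>, 1) = \<tau>"
      using slice_q[of X "i (q \<tau>, 1)" \<tau>] X(1) NG by (simp add: subset_iff)
    then show "\<tau> \<in> unit_lift N" using \<tau> unfolding unit_lift_def by (auto intro: image_eqI[of _ _ "q \<tau>"])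
  qed
  moreover have "\<sigma> \<in> X \<inter> {\<sigma> \<in> arrows \<Sigma>. q \<sigma> \<in> ?N}" using x X \<sigma> NG by auto
  ultimately show "\<exists>T. openin (gtop \<Sigma>) T \<and> \<sigma> \<in> T \<and> T \<subseteq> unit_lift N" by blast
qed

lemma compact_slice_unit_lift:
  assumes "openin (gtop G) K" "compactin (gtop G) K" "K \<subseteq> unit_space G"
  shows "compact_slice (unit_lift K)"
proof -
  have "compactin (unit_top G) K" using assms by (simp add: unit_top_def compactin_subtopology)
  then have "compactin (gtop \<Sigma>) (unit_lift K)"
    unfolding unit_lift_def by (rule image_compactin[OF _ continuous_i_unit]) simp
  then show ?thesis
    unfolding compact_slice_def using assms openin_unit_lift G.openin_unit_top_iff by simp
qed

lemma unit_lift_unit_space: "unit_lift (unit_space G) = unit_space \<Sigma>"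
  unfolding unit_lift_def using unit_space_\<Sigma> by force

lemma openin_unit_space_\<Sigma>: "openin (gtop \<Sigma>) (unit_space \<Sigma>)"
  using openin_unit_lift[of "unit_space G"] G.openin_unit_top_iff G.openin_unit_space
  by (simp add: unit_lift_unit_space)

lemma rng_image_eq: "W \<subseteq> arrows \<Sigma> \<Longrightarrow> rng \<Sigma> ` W = unit_lift (rng G ` q ` W)"
  unfolding unit_lift_def image_image by (intro image_cong) (auto intro: rng_eq_i)

lemma openin_rng_image:
  assumes W: "openin (gtop \<Sigma>) W"
  shows "openin (unit_top \<Sigma>) (rng \<Sigma> ` W)"
proof -
  have WA: "W \<subseteq> arrows \<Sigma>" using W openin_subset by blast
  have "openin (gtop \<Sigma>) (rng \<Sigma> ` W)"
    using openin_unit_lift[OF G.openin_rng_image[OF openin_q_image[OF W]]] rng_image_eq[OF WA] by simp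
  then show ?thesis
    unfolding unit_top_def using openin_unit_space_\<Sigma> WA by (auto simp: openin_open_subtopology)
qed

lemma compact_slice_iff: "compact_open_bisection \<Sigma> X \<longleftrightarrow> compact_slice X"
proof
  assume "compact_open_bisection \<Sigma> X"
  from compact_open_bisection_inj[OF this] show "compact_slice X"
    unfolding compact_slice_def slice_def using openin_subset by blast
next
  assume X: "compact_slice X"
  then have "open_bisection \<Sigma> X"
    using openin_rng_image unfolding compact_slice_def slice_def
    by (intro open_bisectionI[OF topological_groupoid_\<Sigma>]) auto
  then show "compact_open_bisection \<Sigma> X"
    unfolding compact_open_bisection_def bisection_def
    using X compact_slice_compact compact_slice_open by blast
qed

lemma compact_slice_inv:
  assumes X: "compact_slice X"
  shows "compact_slice (ginv \<Sigma> ` X)"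
  unfolding compact_slice_def
proof (intro conjI)
  show "openin (gtop \<Sigma>) (ginv \<Sigma> ` X)"
    using open_ginv_image[OF topological_groupoid_\<Sigma>] compact_slice_open X by simp
  show "compactin (gtop \<Sigma>) (ginv \<Sigma> ` X)"
    by (rule image_compactin[OF _ continuous_map_ginv[OF topological_groupoid_\<Sigma>]])
      (simp add: X compact_slice_compact)
qed (use X slice_inv in simp)

lemma compact_slice_Int_clopen:
  assumes X: "compact_slice X" and U: "openin (gtop \<Sigma>) U" "closedin (gtop \<Sigma>) U"
  shows "compact_slice (X \<inter> U)"
  unfolding compact_slice_def
  using slice_subset[of X "X \<inter> U"] X U compact_slice_open[OF X] compact_slice_compact[OF X]
  by (auto intro: compact_Int_closedin)

end


lemma module_fun_scale: "module (\<lambda>(t::'r::comm_ring_1) (f::'s \<Rightarrow> 'r) \<sigma>. t * f \<sigma>)"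
  by unfold_locales (auto simp: fun_eq_iff distrib_left distrib_right mult_ac)

context ample_twist
begin

section \<open>The twisted Steinberg algebra\<close>

sublocale M: module "\<lambda>(t::'r) (f::'s \<Rightarrow> 'r) \<sigma>. t * f \<sigma>"
  by (rule module_fun_scale)

abbreviation "AA \<equiv> steinberg_carrier G \<Sigma> i q"
abbreviation "BB \<equiv> steinberg_diagonal G \<Sigma> i q"
abbreviation "Alg \<equiv> steinberg_algebra G \<Sigma> i q"

lemma Alg_simps [simp]:
  "acarrier Alg = AA" "amult Alg = conv" "ascale Alg = (\<lambda>t f \<sigma>. t * f \<sigma>)"
  unfolding steinberg_algebra_def by auto

text \<open>Compactness of the support need not be checked directly; an enclosing compact set is
  enough. By equivariance the complement of the support in \<open>G\<close> is the image of the zero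
  set, which is open, and \<open>q\<close> is an open map; so the support is closed in
  \<open>C\<close>.\<close>

lemma AA_I:
  assumes f: "equivariant f"
    and lc: "\<And>\<sigma>. \<sigma> \<in> arrows \<Sigma> \<Longrightarrow> \<exists>W. openin (gtop \<Sigma>) W \<and> \<sigma> \<in> W \<and> (\<forall>\<tau> \<in> W. f \<tau> = f \<sigma>)"
    and C: "compactin (gtop G) C" "supp_G q f \<subseteq> C"
  shows "f \<in> AA"
proof -
  have "openin (gtop \<Sigma>) {\<sigma> \<in> arrows \<Sigma>. f \<sigma> = 0}"
  proof (subst openin_subopen, intro ballI)
    fix \<sigma> assume \<sigma>: "\<sigma> \<in> {\<sigma> \<in> arrows \<Sigma>. f \<sigma> = 0}"
    then obtain W where W: "openin (gtop \<Sigma>) W" "\<sigma> \<in> W" "\<forall>\<tau> \<in> W. f \<tau> = f \<sigma>" using lc[of \<sigma>] by auto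
    have "W \<subseteq> {\<sigma> \<in> arrows \<Sigma>. f \<sigma> = 0}"
    proof
      fix \<tau> assume \<tau>: "\<tau> \<in> W"
      then have "f \<tau> = f \<sigma>" using W(3) by blast
      then show "\<tau> \<in> {\<sigma> \<in> arrows \<Sigma>. f \<sigma> = 0}" using openin_subset[OF W(1)] \<sigma> \<tau> by auto
    qed
    then show "\<exists>T. openin (gtop \<Sigma>) T \<and> \<sigma> \<in> T \<and> T \<subseteq> {\<sigma> \<in> arrows \<Sigma>. f \<sigma> = 0}"
      using W(1,2) by (intro exI[of _ W] conjI)
  qed
  then have "openin (gtop G) (q ` {\<sigma> \<in> arrows \<Sigma>. f \<sigma> = 0})" by (rule openin_q_image)
  moreover have "q ` {\<sigma> \<in> arrows \<Sigma>. f \<sigma> = 0} = arrows G - supp_G q f"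
  proof (intro equalityI subsetI)
    fix \<alpha> assume \<alpha>: "\<alpha> \<in> arrows G - supp_G q f"
    then obtain \<sigma> where \<sigma>: "\<sigma> \<in> arrows \<Sigma>" "\<alpha> = q \<sigma>" using surj_q by blast
    then have "f \<sigma> = 0" using \<alpha> f by auto
    then show "\<alpha> \<in> q ` {\<sigma> \<in> arrows \<Sigma>. f \<sigma> = 0}" using \<sigma> by auto
  qed (use f in auto)
  ultimately have "closedin (gtop G) (supp_G q f)"
    using supp_G_arrows[OF f] by (simp add: closedin_def)
  then have "compactin (gtop G) (supp_G q f)" using closed_compactin C by blast
  moreover have "\<forall>\<sigma>\<in>arrows \<Sigma>. \<exists>W. openin (gtop \<Sigma>) W \<and> \<sigma> \<in> W \<and> (\<forall>\<tau> \<in> W. f \<tau> = f \<sigma>)"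
    using lc by simp
  ultimately show ?thesis
    using f unfolding steinberg_carrier_def equivariant_def by simp
qed

lemma AA_D:
  assumes "f \<in> AA"
  shows "equivariant f"
    and "\<sigma> \<in> arrows \<Sigma> \<Longrightarrow> \<exists>W. openin (gtop \<Sigma>) W \<and> \<sigma> \<in> W \<and> (\<forall>\<tau> \<in> W. f \<tau> = f \<sigma>)"
    and "compactin (gtop G) (supp_G q f)"
  using assms unfolding steinberg_carrier_def equivariant_def by simp_all

lemma openin_AA_preimage:
  assumes "f \<in> AA"
  shows "openin (gtop \<Sigma>) {\<sigma> \<in> arrows \<Sigma>. f \<sigma> \<in> S}"
proof (subst openin_subopen, intro ballI)
  fix \<sigma> assume \<sigma>: "\<sigma> \<in> {\<sigma> \<in> arrows \<Sigma>. f \<sigma> \<in> S}"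
  then obtain W where W: "openin (gtop \<Sigma>) W" "\<sigma> \<in> W" "\<forall>\<tau> \<in> W. f \<tau> = f \<sigma>"
    using AA_D(2)[OF assms, of \<sigma>] by auto
  have "W \<subseteq> {\<sigma> \<in> arrows \<Sigma>. f \<sigma> \<in> S}"
  proof
    fix \<tau> assume \<tau>: "\<tau> \<in> W"
    then have "f \<tau> = f \<sigma>" using W(3) by blast
    then show "\<tau> \<in> {\<sigma> \<in> arrows \<Sigma>. f \<sigma> \<in> S}" using openin_subset[OF W(1)] \<sigma> \<tau> by auto
  qed
  then show "\<exists>T. openin (gtop \<Sigma>) T \<and> \<sigma> \<in> T \<and> T \<subseteq> {\<sigma> \<in> arrows \<Sigma>. f \<sigma> \<in> S}"
    using W(1,2) by (intro exI[of _ W] conjI)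
qed

lemma closedin_AA_preimage:
  assumes "f \<in> AA"
  shows "closedin (gtop \<Sigma>) {\<sigma> \<in> arrows \<Sigma>. f \<sigma> \<in> S}"
proof -
  have "arrows \<Sigma> - {\<sigma> \<in> arrows \<Sigma>. f \<sigma> \<in> S} = {\<sigma> \<in> arrows \<Sigma>. f \<sigma> \<in> - S}" by auto
  then show ?thesis using openin_AA_preimage[OF assms, of "- S"] by (simp add: closedin_def)
qed

lemma compact_supp_G: "f \<in> AA \<Longrightarrow> compactin (gtop G) (supp_G q f)"
  by (rule AA_D)

lemma openin_supp_G:
  assumes "f \<in> AA"
  shows "openin (gtop G) (supp_G q f)"
proof -
  have "supp_G q f = q ` {\<sigma> \<in> arrows \<Sigma>. f \<sigma> \<in> - {0}}"
    using equivariant_arrow[OF AA_D(1)[OF assms]] unfolding supp_G_def supp_def by auto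
  then show ?thesis using openin_q_image[OF openin_AA_preimage[OF assms, of "- {0}"]] by simp
qed

lemma AA_row_finite [simp]: "f \<in> AA \<Longrightarrow> row_finite f"
  unfolding row_finite_def
proof (intro conjI ballI)
  fix x assume f: "f \<in> AA"
  have "fibre_supp f x = {\<alpha> \<in> supp_G q f. rng G \<alpha> = x}"
    using supp_G_arrows[OF AA_D(1)[OF f]] by (auto simp: mem_fibre_supp)
  then show "finite (fibre_supp f x)" using G.finite_fibre_compact AA_D(3)[OF f] by simp
qed (rule AA_D)

lemma AA_equivariant [simp]: "f \<in> AA \<Longrightarrow> equivariant f"
  by simp

lemma AA_zero [simp]: "0 \<in> AA"
  by (rule AA_I[where C = "{}"]) (auto simp: supp_G_def supp_def)

lemma AA_scale [simp]: "f \<in> AA \<Longrightarrow> (\<lambda>\<sigma>. c * f \<sigma>) \<in> AA"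
proof (rule AA_I)
  fix \<sigma> assume "f \<in> AA" "\<sigma> \<in> arrows \<Sigma>"
  from AA_D(2)[OF this]
  show "\<exists>W. openin (gtop \<Sigma>) W \<and> \<sigma> \<in> W \<and> (\<forall>\<tau> \<in> W. c * f \<tau> = c * f \<sigma>)" by metis
next
  assume f: "f \<in> AA"
  then show "compactin (gtop G) (supp_G q f)" by (rule AA_D)
  show "supp_G q (\<lambda>\<sigma>. c * f \<sigma>) \<subseteq> supp_G q f" by (rule supp_G_scale)
qed (simp add: equivariant_scale AA_D)

lemma AA_add [simp]:
  assumes f: "f \<in> AA" and g: "g \<in> AA"
  shows "f + g \<in> AA"
proof (rule AA_I)
  fix \<sigma> assume \<sigma>: "\<sigma> \<in> arrows \<Sigma>"
  obtain V W where "openin (gtop \<Sigma>) V" "\<sigma> \<in> V" "\<forall>\<tau> \<in> V. f \<tau> = f \<sigma>"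
    "openin (gtop \<Sigma>) W" "\<sigma> \<in> W" "\<forall>\<tau> \<in> W. g \<tau> = g \<sigma>"
    using AA_D(2)[OF f \<sigma>] AA_D(2)[OF g \<sigma>] by auto
  then show "\<exists>W. openin (gtop \<Sigma>) W \<and> \<sigma> \<in> W \<and> (\<forall>\<tau> \<in> W. (f + g) \<tau> = (f + g) \<sigma>)"
    unfolding plus_fun_def by (intro exI[of _ "V \<inter> W"] conjI ballI) (blast, blast, metis IntD1 IntD2)
next
  show "compactin (gtop G) (supp_G q f \<union> supp_G q g)" using f g by (intro compactin_Un AA_D)
qed (use f g supp_G_add in \<open>auto simp: equivariant_add\<close>)

lemma AA_diff [simp]: "f \<in> AA \<Longrightarrow> g \<in> AA \<Longrightarrow> f - g \<in> AA"
  using AA_add[of f "\<lambda>\<sigma>. - 1 * g \<sigma>"] AA_scale[of g "- 1"] by (simp add: fun_diff_def plus_fun_def)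

lemma AA_ind [simp]:
  assumes X: "compact_slice X"
  shows "ind X \<in> AA"
proof (rule AA_I)
  fix \<sigma> assume \<sigma>: "\<sigma> \<in> arrows \<Sigma>"
  from compact_sliceD[OF X] \<sigma>
  show "\<exists>W. openin (gtop \<Sigma>) W \<and> \<sigma> \<in> W \<and> (\<forall>\<tau> \<in> W. ind X \<tau> = ind X \<sigma>)"
  proof (cases rule: ind_cases)
    case (1 t \<tau>)
    then show ?thesis
      using openin_act_image[OF compact_slice_open[OF X] 1(1)] X ind_act
      by (intro exI[of _ "act t ` X"]) auto
  next
    case 2
    have "openin (gtop \<Sigma>) {\<sigma> \<in> arrows \<Sigma>. q \<sigma> \<in> arrows G - q ` X}"
      using compact_slice_q_image[OF X] by (intro openin_q_preimage G.openin_diff_compact) auto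
    moreover have "ind X \<tau> = 0" if "\<tau> \<in> {\<sigma> \<in> arrows \<Sigma>. q \<sigma> \<in> arrows G - q ` X}" for \<tau>
      using that by (intro ind_eq_0) auto
    ultimately show ?thesis
      using 2 \<sigma> by (intro exI[of _ "{\<sigma> \<in> arrows \<Sigma>. q \<sigma> \<in> arrows G - q ` X}"]) simp
  qed
next
  show "compactin (gtop G) (q ` X)" using compact_slice_q_image[OF X] by auto
qed (use X in auto)

lemma AA_restrict:
  assumes f: "f \<in> AA" and U: "openin (gtop G) U" "closedin (gtop G) U"
  shows "(\<lambda>\<sigma>. if q \<sigma> \<in> U then f \<sigma> else 0) \<in> AA" (is "?g \<in> AA")
proof (rule AA_I)
  show "equivariant ?g"
    using f by (intro equivariantI) (auto simp: equivariant_act equivariant_outside)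
  show "compactin (gtop G) (supp_G q f)" using f by (rule AA_D)
  show "supp_G q ?g \<subseteq> supp_G q f" unfolding supp_G_def supp_def by auto
  fix \<sigma> assume \<sigma>: "\<sigma> \<in> arrows \<Sigma>"
  obtain W where W: "openin (gtop \<Sigma>) W" "\<sigma> \<in> W" "\<forall>\<tau> \<in> W. f \<tau> = f \<sigma>"
    using AA_D(2)[OF f \<sigma>] by auto
  let ?V = "if q \<sigma> \<in> U then U else arrows G - U"
  have "openin (gtop G) ?V" using U by (auto simp: openin_closedin_eq)
  then have o: "openin (gtop \<Sigma>) (W \<inter> {\<sigma> \<in> arrows \<Sigma>. q \<sigma> \<in> ?V})"
    using W(1) openin_q_preimage by blast
  have c: "?g \<tau> = ?g \<sigma>" if "\<tau> \<in> W \<inter> {\<sigma> \<in> arrows \<Sigma>. q \<sigma> \<in> ?V}" for \<tau>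
  proof -
    have "f \<tau> = f \<sigma>" using W(3) that by blast
    then show ?thesis using that by (auto split: if_splits)
  qed
  have "\<sigma> \<in> W \<inter> {\<sigma> \<in> arrows \<Sigma>. q \<sigma> \<in> ?V}" using W(2) \<sigma> by auto
  with o c show "\<exists>W. openin (gtop \<Sigma>) W \<and> \<sigma> \<in> W \<and> (\<forall>\<tau> \<in> W. ?g \<tau> = ?g \<sigma>)"
    by (intro exI[of _ "W \<inter> {\<sigma> \<in> arrows \<Sigma>. q \<sigma> \<in> ?V}"] conjI ballI)
qed

text \<open>The induction subtracts from \<open>f\<close> its part over one slice at a time.\<close>

lemma AA_decompose_finite:
  assumes "finite \<X>" "f \<in> AA" "supp_G q f \<subseteq> N"
    "\<And>X. X \<in> \<X> \<Longrightarrow> compact_slice X \<and> X \<subseteq> W \<and> (\<exists>c. f ` X \<subseteq> {0, c})"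
    "supp_G q f \<subseteq> (\<Union>X\<in>\<X>. q ` X)"
  shows "f \<in> M.span {ind X | X. compact_slice X \<and> X \<subseteq> W \<and> q ` X \<subseteq> N}"
  using assms
proof (induction \<X> arbitrary: f rule: finite_induct)
  case empty
  have "f \<sigma> = 0" if "\<sigma> \<in> arrows \<Sigma>" for \<sigma>
    using q_in_supp_G[OF AA_equivariant[OF empty(1)] that] empty(4) by auto
  then have "f = 0" by (intro equivariant_eqI) (use empty(1) in simp_all)
  then show ?case by (simp only: M.span_zero)
next
  case (insert X \<X>)
  note f = \<open>f \<in> AA\<close>
  obtain c where X: "compact_slice X" "X \<subseteq> W" and c: "f ` X \<subseteq> {0, c}"
    using insert.prems(3)[of X] by auto
  let ?Z = "{\<sigma> \<in> arrows \<Sigma>. f \<sigma> \<in> - {0}}"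
  \<comment> \<open>Local constancy makes the zero set of \<open>f\<close> clopen, so cutting it out
    leaves a compact slice. On it \<open>f\<close> equals \<open>c\<close> exactly, and subtraction
    removes \<open>f\<close> over its image and changes nothing elsewhere; the other slices keep at
    most one nonzero value.\<close>
  define Y where "Y = X \<inter> ?Z"
  have Y: "compact_slice Y" "Y \<subseteq> W"
    unfolding Y_def using X compact_slice_Int_clopen[OF X(1) openin_AA_preimage[OF f]
        closedin_AA_preimage[OF f]] by blast+
  have YN: "q ` Y \<subseteq> N" using f insert.prems(2) unfolding Y_def by (auto simp: subset_iff)
  define g where "g = f + (\<lambda>\<sigma>. (- c) * ind Y \<sigma>)"
  have g: "g \<in> AA" unfolding g_def using f Y by (intro AA_add AA_scale AA_ind)
  have g_eq: "g \<sigma> = (if q \<sigma> \<in> q ` Y then 0 else f \<sigma>)" if "\<sigma> \<in> arrows \<Sigma>" for \<sigma>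
    using compact_sliceD[OF Y(1)] that
  proof (cases rule: ind_cases)
    case (1 t \<tau>)
    have \<tau>: "\<tau> \<in> arrows \<Sigma>" using 1 unfolding Y_def by auto
    have "f \<tau> = c" using 1 c unfolding Y_def by auto
    then have "f \<sigma> = unit_inv t * c" using 1 f \<tau> by (simp add: equivariant_act)
    moreover have "q \<sigma> \<in> q ` Y" using 1 \<tau> by auto
    ultimately show ?thesis using 1 unfolding g_def by (simp add: mult_ac)
  qed (auto simp: g_def)
  have gf: "g \<sigma> \<noteq> 0 \<Longrightarrow> f \<sigma> \<noteq> 0" for \<sigma>
    using g_eq[of \<sigma>] equivariant_arrow[of g \<sigma>] g by (auto split: if_splits)
  have "g \<in> M.span {ind X | X. compact_slice X \<and> X \<subseteq> W \<and> q ` X \<subseteq> N}"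
  proof (rule insert.IH[OF g])
    show "supp_G q g \<subseteq> N" using gf insert.prems(2) unfolding supp_G_def supp_def by blast
    show "compact_slice X' \<and> X' \<subseteq> W \<and> (\<exists>c. g ` X' \<subseteq> {0, c})" if X': "X' \<in> \<X>" for X'
    proof -
      obtain d where d: "compact_slice X'" "X' \<subseteq> W" "f ` X' \<subseteq> {0, d}"
        using insert.prems(3)[of X'] X' by auto
      then have "g ` X' \<subseteq> {0, d}" using g_eq slice_arrow[OF compact_sliceD[OF d(1)]] by auto
      then show ?thesis using d by blast
    qed
    show "supp_G q g \<subseteq> (\<Union>X\<in>\<X>. q ` X)"
    proof
      fix \<alpha> assume "\<alpha> \<in> supp_G q g"
      then obtain \<sigma> where \<sigma>: "\<sigma> \<in> arrows \<Sigma>" "g \<sigma> \<noteq> 0" "q \<sigma> = \<alpha>" using g by (auto elim: supp_G_E[rotated])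
      then have nz: "f \<sigma> \<noteq> 0" "q \<sigma> \<notin> q ` Y" using g_eq gf by auto
      have "\<alpha> \<in> supp_G q f" using \<sigma> f nz by auto
      then have "\<alpha> \<in> (\<Union>X\<in>insert X \<X>. q ` X)" using insert.prems(4) by (rule subsetD[rotated])
      moreover have "\<alpha> \<notin> q ` X"
      proof
        assume "\<alpha> \<in> q ` X"
        then obtain \<tau> where \<tau>: "\<tau> \<in> X" "q \<tau> = q \<sigma>" using \<sigma> by auto
        then have "\<tau> \<in> arrows \<Sigma>" using slice_arrow[OF compact_sliceD[OF X(1)]] by simp
        then have "\<tau> \<in> Y" using equivariant_fibre[of f \<tau> \<sigma>] f nz \<tau> \<sigma> unfolding Y_def by auto
        then show False using nz \<tau> by (metis imageI)
      qed
      ultimately show "\<alpha> \<in> (\<Union>X\<in>\<X>. q ` X)" by simp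
    qed
  qed
  moreover have "ind Y \<in> M.span {ind X | X. compact_slice X \<and> X \<subseteq> W \<and> q ` X \<subseteq> N}"
    using Y YN by (intro M.span_base) blast
  ultimately have "g + (\<lambda>\<sigma>. c * ind Y \<sigma>) \<in> M.span {ind X | X. compact_slice X \<and> X \<subseteq> W \<and> q ` X \<subseteq> N}"
    by (intro M.span_add M.span_scale)
  moreover have "f = g + (\<lambda>\<sigma>. c * ind Y \<sigma>)" unfolding g_def by (auto simp: fun_eq_iff)
  ultimately show ?case by metis
qed

text \<open>Around each arrow of \<open>W\<close> there is a slice inside \<open>W\<close> on which
  \<open>f\<close> is constant, and finitely many images cover the compact support. The freedom in
  \<open>W\<close> is used twice: off the unit space for conditional expectations, and inside it for
  spanning \<open>B\<close>.\<close>

lemma AA_decompose: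
  assumes f: "f \<in> AA" and W: "openin (gtop \<Sigma>) W"
    and meet: "\<And>\<alpha>. \<alpha> \<in> supp_G q f \<Longrightarrow> \<exists>\<sigma> \<in> W. q \<sigma> = \<alpha>"
  shows "f \<in> M.span {ind X | X. compact_slice X \<and> X \<subseteq> W \<and> q ` X \<subseteq> supp_G q f}"
proof -
  let ?\<X> = "{X. compact_slice X \<and> X \<subseteq> W \<and> (\<exists>c. f ` X \<subseteq> {0, c})}"
  have "supp_G q f \<subseteq> \<Union>((\<lambda>X. q ` X) ` ?\<X>)"
  proof
    fix \<alpha> assume "\<alpha> \<in> supp_G q f"
    then obtain \<sigma> where \<sigma>: "\<sigma> \<in> W" "q \<sigma> = \<alpha>" using meet by blast
    let ?V = "W \<inter> {\<tau> \<in> arrows \<Sigma>. f \<tau> \<in> {f \<sigma>}}"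
    have "openin (gtop \<Sigma>) ?V" using W openin_AA_preimage[OF f] by blast
    moreover have "\<sigma> \<in> ?V" using \<sigma> openin_subset[OF W] by auto
    ultimately obtain X where "compact_slice X" "\<sigma> \<in> X" "X \<subseteq> ?V" by (rule compact_slice_neighbourhood)
    then show "\<alpha> \<in> \<Union>((\<lambda>X. q ` X) ` ?\<X>)" using \<sigma>
      by (intro UnionI[of "q ` X"] imageI CollectI conjI exI[of _ "f \<sigma>"]) auto
  qed
  moreover have "openin (gtop G) U" if "U \<in> (\<lambda>X. q ` X) ` ?\<X>" for U
    using that compact_slice_q_image by blast
  ultimately obtain \<F> where \<F>: "finite \<F>" "\<F> \<subseteq> (\<lambda>X. q ` X) ` ?\<X>" "supp_G q f \<subseteq> \<Union>\<F>"
    using compactinD[OF AA_D(3)[OF f]] by meson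
  then obtain \<Y> where \<Y>: "\<Y> \<subseteq> ?\<X>" "finite \<Y>" "\<F> = (\<lambda>X. q ` X) ` \<Y>"
    using finite_subset_image[OF \<F>(1,2)] by blast
  show ?thesis
  proof (rule AA_decompose_finite[OF \<Y>(2) f order_refl])
    show "supp_G q f \<subseteq> (\<Union>X\<in>\<Y>. q ` X)" using \<F>(3) \<Y>(3) by simp
  qed (use \<Y>(1) in blast)
qed

text \<open>The difficulty is local constancy. Where the range meets that of \<open>X\<close>, the
  product is \<open>g\<close> composed with translation by the unique element of \<open>X\<close> of
  the same range, and this translation depends continuously on the arrow. Elsewhere the product
  vanishes on an open set.\<close>

lemma AA_conv_ind:
  assumes X: "compact_slice X" and g: "g \<in> AA"
  shows "conv (ind X) g \<in> AA"
proof (rule AA_I)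
  note sX = compact_sliceD[OF X]
  have XA: "X \<subseteq> arrows \<Sigma>" using sX slice_arrow by blast
  show "equivariant (conv (ind X) g)" using X g by (simp add: conv_equivariant)
  show "compactin (gtop G) {a \<odot>\<^bsub>G\<^esub> b | a b. a \<in> q ` X \<and> b \<in> supp_G q g \<and> src G a = rng G b}"
    using compact_slice_q_image[OF X] AA_D(3)[OF g] by (intro G.compactin_mult)
  show "supp_G q (conv (ind X) g) \<subseteq> {a \<odot>\<^bsub>G\<^esub> b | a b. a \<in> q ` X \<and> b \<in> supp_G q g \<and> src G a = rng G b}"
  proof
    fix \<alpha> assume "\<alpha> \<in> supp_G q (conv (ind X) g)"
    then obtain \<sigma> where \<sigma>: "conv (ind X) g \<sigma> \<noteq> 0" "q \<sigma> = \<alpha>" unfolding supp_G_def supp_def by auto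
    then obtain \<rho> where \<rho>: "\<sigma> \<in> arrows \<Sigma>" "\<rho> \<in> arrows \<Sigma>" "rng G (q \<rho>) = rng G (q \<sigma>)" "ind X \<rho> \<noteq> 0"
      "g (ginv \<Sigma> \<rho> \<odot> \<sigma>) \<noteq> 0" using conv_nonzeroE equivariant_ind[OF sX] by metis
    have "q \<rho> \<in> q ` X" using \<rho> ind_nonzero_iff[OF sX] by blast
    moreover have "q (ginv \<Sigma> \<rho> \<odot> \<sigma>) \<in> supp_G q g" using \<rho> g by (subst q_in_supp_G) auto
    moreover have "\<alpha> = q \<rho> \<odot>\<^bsub>G\<^esub> q (ginv \<Sigma> \<rho> \<odot> \<sigma>)" using \<rho> by (simp flip: \<sigma>(2))
    moreover have "src G (q \<rho>) = rng G (q (ginv \<Sigma> \<rho> \<odot> \<sigma>))" using \<rho> by simp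
    ultimately show "\<alpha> \<in> {a \<odot>\<^bsub>G\<^esub> b | a b. a \<in> q ` X \<and> b \<in> supp_G q g \<and> src G a = rng G b}" by blast
  qed
  fix \<sigma> assume \<sigma>: "\<sigma> \<in> arrows \<Sigma>"
  define K where "K = rng G ` q ` X"
  have K: "openin (gtop G) K" "compactin (gtop G) K"
    unfolding K_def using G.compact_open_rng_image compact_slice_q_image[OF X] by blast+
  have rq: "continuous_map (gtop \<Sigma>) (gtop G) (\<lambda>\<sigma>. rng G (q \<sigma>))"
    using continuous_map_compose[OF continuous_q G.continuous_rng] by (simp add: o_def)
  show "\<exists>W. openin (gtop \<Sigma>) W \<and> \<sigma> \<in> W \<and> (\<forall>\<tau> \<in> W. conv (ind X) g \<tau> = conv (ind X) g \<sigma>)"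
  proof (cases "rng G (q \<sigma>) \<in> K")
    case False
    let ?W = "{\<sigma> \<in> arrows \<Sigma>. rng G (q \<sigma>) \<in> arrows G - K}"
    have "openin (gtop \<Sigma>) ?W"
      using K by (intro openin_continuous_map_preimage[OF rq] G.openin_diff_compact) auto
    moreover have "conv (ind X) g \<tau> = 0" if "\<tau> \<in> ?W" for \<tau>
    proof (rule conv_ind_left_eq_0[OF sX])
      fix \<tau>' assume "\<tau>' \<in> X"
      then have "rng G (q \<tau>') \<in> K" unfolding K_def by blast
      then show "rng G (q \<tau>') \<noteq> rng G (q \<tau>)" using that by auto
    qed
    ultimately show ?thesis using False \<sigma> by (intro exI[of _ ?W]) auto
  next
    case True
    let ?\<psi> = "\<lambda>\<sigma>. rng G (q \<sigma>)"
    have oX: "openin (gtop \<Sigma>) X" using X compact_slice_open by auto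
    \<comment> \<open>The inverse \<open>\<phi>\<close> of this homeomorphism picks the element of
      \<open>X\<close> with a given range, continuously in the range.\<close>
    have "homeomorphic_map (subtopology (gtop \<Sigma>) X) (subtopology (gtop G) K) ?\<psi>"
    proof (rule bijective_open_imp_homeomorphic_map)
      show "continuous_map (subtopology (gtop \<Sigma>) X) (subtopology (gtop G) K) ?\<psi>"
        using rq by (auto simp: continuous_map_in_subtopology K_def intro: continuous_map_from_subtopology)
      show "open_map (subtopology (gtop \<Sigma>) X) (subtopology (gtop G) K) ?\<psi>"
        unfolding open_map_def
      proof (intro allI impI)
        fix V assume "openin (subtopology (gtop \<Sigma>) X) V"
        then have V: "openin (gtop \<Sigma>) V" "V \<subseteq> X" using oX by (auto simp: openin_open_subtopology)
        then have "openin (gtop G) (rng G ` q ` V)"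
          using G.openin_rng_image[OF openin_q_image] G.openin_unit_top_iff by blast
        then show "openin (subtopology (gtop G) K) (?\<psi> ` V)"
          using V K by (auto simp: openin_open_subtopology image_image K_def)
      qed
      show "?\<psi> ` topspace (subtopology (gtop \<Sigma>) X) = topspace (subtopology (gtop G) K)"
        using XA openin_subset[OF K(1)] by (auto simp: K_def)
      show "inj_on ?\<psi> (topspace (subtopology (gtop \<Sigma>) X))"
        by (intro inj_onI) (auto intro: slice_rng[OF sX])
    qed
    then obtain \<phi> where "homeomorphic_maps (subtopology (gtop \<Sigma>) X) (subtopology (gtop G) K) ?\<psi> \<phi>"
      unfolding homeomorphic_map_maps by blast
    then have \<phi>: "continuous_map (subtopology (gtop G) K) (subtopology (gtop \<Sigma>) X) \<phi>"
      "\<And>y. y \<in> K \<Longrightarrow> ?\<psi> (\<phi> y) = y" "\<And>y. y \<in> K \<Longrightarrow> \<phi> y \<in> X"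
      using openin_subset[OF K(1)] unfolding homeomorphic_maps_def continuous_map_def
      by (auto simp: Pi_iff subset_iff)
    define U where "U = {\<sigma> \<in> arrows \<Sigma>. rng G (q \<sigma>) \<in> K}"
    have U: "openin (gtop \<Sigma>) U" unfolding U_def using rq K openin_continuous_map_preimage by blast
    have UA: "U \<subseteq> arrows \<Sigma>" unfolding U_def by auto
    have "continuous_map (subtopology (gtop \<Sigma>) U) (subtopology (gtop G) K) ?\<psi>"
      using rq UA by (auto simp: continuous_map_in_subtopology U_def intro: continuous_map_from_subtopology)
    then have "continuous_map (subtopology (gtop \<Sigma>) U) (gtop \<Sigma>) (\<lambda>\<sigma>. \<phi> (?\<psi> \<sigma>))"
      using \<phi>(1) continuous_map_compose continuous_map_in_subtopology by (fastforce simp: o_def)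
    then have "continuous_map (subtopology (gtop \<Sigma>) U) (gtop \<Sigma>) (\<lambda>\<sigma>. ginv \<Sigma> (\<phi> (?\<psi> \<sigma>)))"
      using continuous_map_compose[OF _ continuous_map_ginv[OF topological_groupoid_\<Sigma>]]
      by (fastforce simp: o_def)
    then have T: "continuous_map (subtopology (gtop \<Sigma>) U) (gtop \<Sigma>) (\<lambda>\<sigma>. ginv \<Sigma> (\<phi> (?\<psi> \<sigma>)) \<odot> \<sigma>)"
    proof (rule continuous_map_gmult[OF topological_groupoid_\<Sigma>])
      fix \<sigma> assume "\<sigma> \<in> topspace (subtopology (gtop \<Sigma>) U)"
      then have "\<sigma> \<in> arrows \<Sigma>" "?\<psi> \<sigma> \<in> K" unfolding U_def by auto
      then show "composable \<Sigma> (ginv \<Sigma> (\<phi> (?\<psi> \<sigma>))) \<sigma>"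
        using \<phi> XA by (auto simp: composable_iff subset_iff)
    qed (simp add: continuous_map_from_subtopology)
    have val: "conv (ind X) g \<tau> = g (ginv \<Sigma> (\<phi> (?\<psi> \<tau>)) \<odot> \<tau>)" if "\<tau> \<in> U" for \<tau>
      using that \<phi> g unfolding U_def by (intro conv_ind_left[OF sX]) auto
    let ?a = "ginv \<Sigma> (\<phi> (?\<psi> \<sigma>)) \<odot> \<sigma>"
    let ?W = "{\<tau> \<in> topspace (subtopology (gtop \<Sigma>) U). ginv \<Sigma> (\<phi> (?\<psi> \<tau>)) \<odot> \<tau> \<in> {\<rho> \<in> arrows \<Sigma>. g \<rho> \<in> {g ?a}}}"
    have "openin (subtopology (gtop \<Sigma>) U) ?W"
      by (rule openin_continuous_map_preimage[OF T openin_AA_preimage[OF g]])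
    then have "openin (gtop \<Sigma>) ?W" using U openin_trans_full by blast
    moreover have \<sigma>U: "\<sigma> \<in> U" using \<sigma> True unfolding U_def by auto
    moreover have "?a \<in> arrows \<Sigma>"
      using \<sigma> True \<phi> XA by (auto simp: subset_iff)
    ultimately show ?thesis using val UA by (intro exI[of _ ?W]) auto
  qed
qed

lemma AA_span: "AA = M.span {ind X | X. compact_slice X}"
proof
  show "AA \<subseteq> M.span {ind X | X. compact_slice X}"
  proof
    fix f assume f: "f \<in> AA"
    have "\<exists>\<sigma>\<in>arrows \<Sigma>. q \<sigma> = \<alpha>" if "\<alpha> \<in> supp_G q f" for \<alpha>
      using that f by (auto elim: supp_G_E[rotated])
    then have "f \<in> M.span {ind X | X. compact_slice X \<and> X \<subseteq> arrows \<Sigma> \<and> q ` X \<subseteq> supp_G q f}"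
      by (intro AA_decompose f) auto
    then show "f \<in> M.span {ind X | X. compact_slice X}"
      using M.span_mono[of "{ind X | X. compact_slice X \<and> X \<subseteq> arrows \<Sigma> \<and> q ` X \<subseteq> supp_G q f}"
          "{ind X | X. compact_slice X}"] by blast
  qed
  have "M.subspace AA" unfolding M.subspace_def by simp
  then show "M.span {ind X | X. compact_slice X} \<subseteq> AA" by (intro M.span_minimal) auto
qed

lemma AA_conv [simp]:
  assumes f: "f \<in> AA" and g: "g \<in> AA"
  shows "conv f g \<in> AA"
proof -
  have "f \<in> M.span {ind X | X. compact_slice X}" using f AA_span by simp
  \<comment> \<open>Membership of \<open>f\<close> is carried along because additivity in the left
    factor is available for functions with finite rows.\<close>
  then have "f \<in> AA \<and> conv f g \<in> AA"
  proof (induction rule: M.span_induct_alt)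
    case (step c x y)
    then obtain X where X: "x = ind X" "compact_slice X" by auto
    have "conv ((\<lambda>\<sigma>. c * x \<sigma>) + y) g = (\<lambda>\<sigma>. c * conv x g \<sigma>) + conv y g"
      using step X g by (simp add: conv_add_left conv_scale_left)
    moreover have "(\<lambda>\<sigma>. c * conv x g \<sigma>) + conv y g \<in> AA" "(\<lambda>\<sigma>. c * x \<sigma>) + y \<in> AA"
      using step X AA_conv_ind[OF _ g] by (auto intro!: AA_add AA_scale simp del: plus_fun_apply)
    ultimately show ?case by metis
  qed (use AA_zero conv_zero_left in metis)
  then show ?thesis ..
qed

section \<open>The diagonal subalgebra\<close>

lemma mem_BB: "f \<in> BB \<longleftrightarrow> f \<in> AA \<and> diagonal f"
proof -
  have "supp f \<subseteq> {\<sigma> \<in> arrows \<Sigma>. q \<sigma> \<in> unit_space G} \<longleftrightarrow> (\<forall>\<sigma>. f \<sigma> \<noteq> 0 \<longrightarrow> q \<sigma> \<in> unit_space G)"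
    if "f \<in> AA" using equivariant_arrow[of f] that unfolding supp_def by auto
  then show ?thesis unfolding steinberg_diagonal_def diagonal_def by auto
qed

lemma BB_AA [simp]: "f \<in> BB \<Longrightarrow> f \<in> AA"
  and BB_diagonal [simp]: "f \<in> BB \<Longrightarrow> diagonal f"
  and BB_I: "f \<in> AA \<Longrightarrow> diagonal f \<Longrightarrow> f \<in> BB"
  by (auto simp: mem_BB)

lemma diagonal_conv: "diagonal b \<Longrightarrow> diagonal b' \<Longrightarrow> diagonal (conv b b')"
  unfolding diagonal_def
  using conv_diagonal_left[of b b'] conv_row_finite[of b b'] conv_outside[of _ b b']
  by (metis diagonal_def mult_zero_right row_finite_equivariant)

lemma BB_conv [simp]: "b \<in> BB \<Longrightarrow> b' \<in> BB \<Longrightarrow> conv b b' \<in> BB"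
  by (rule BB_I) (simp_all add: diagonal_conv)

lemma conv_diagonal_unit:
  "diagonal b \<Longrightarrow> diagonal b' \<Longrightarrow> x \<in> unit_space \<Sigma> \<Longrightarrow> conv b b' x = b x * b' x"
  using conv_diagonal_left[of b b' x] unit_space_arrow by simp

lemma diagonal_commute: "diagonal b \<Longrightarrow> diagonal b' \<Longrightarrow> conv b b' = conv b' b"
  by (rule diagonal_eqI) (simp_all add: diagonal_conv conv_diagonal_unit mult.commute)

lemma BB_subspace: "M.subspace BB"
  unfolding M.subspace_def
proof (intro conjI ballI allI)
  show "0 \<in> BB" by (rule BB_I) (auto simp: diagonal_def)
  show "f + g \<in> BB" if "f \<in> BB" "g \<in> BB" for f g
  proof (rule BB_I)
    show "diagonal (f + g)"
      unfolding diagonal_def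
    proof (intro conjI allI impI)
      fix \<sigma> assume "(f + g) \<sigma> \<noteq> 0"
      then have "f \<sigma> \<noteq> 0 \<or> g \<sigma> \<noteq> 0" by auto
      then show "q \<sigma> \<in> unit_space G" using that diagonalD[of f \<sigma>] diagonalD[of g \<sigma>] by auto
    qed (rule AA_row_finite[OF AA_add[OF BB_AA[OF that(1)] BB_AA[OF that(2)]]])
  qed (use that in simp)
  show "(\<lambda>\<sigma>. c * f \<sigma>) \<in> BB" if "f \<in> BB" for c f
  proof (rule BB_I)
    have "q \<sigma> \<in> unit_space G" if "c * f \<sigma> \<noteq> 0" for \<sigma>
      by (rule diagonalD[of f \<sigma>]) (use that \<open>f \<in> BB\<close> in auto)
    then show "diagonal (\<lambda>\<sigma>. c * f \<sigma>)"
      unfolding diagonal_def using AA_row_finite[OF AA_scale[OF BB_AA[OF that]]] by simp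
  qed (use that in simp)
qed

lemma r_algebra_Alg: "r_algebra Alg"
proof -
  have "M.subspace AA" by (subst AA_span) (rule M.subspace_span)
  then show ?thesis
    unfolding r_algebra_def
    using M.module_axioms by (simp add: conv_assoc conv_add_left conv_add_right conv_scale_left conv_scale_right)
qed

lemma comm_subalgebra_BB: "comm_subalgebra Alg BB"
  unfolding comm_subalgebra_def using BB_subspace by (simp add: subset_iff diagonal_commute)

lemma chi_BB:
  assumes "openin (gtop G) K" "compactin (gtop G) K" "K \<subseteq> unit_space G"
  shows "chi K \<in> BB"
  using AA_ind[OF compact_slice_unit_lift[OF assms]] diagonal_chi[OF assms(3)] by (rule BB_I)

end

locale indecomposable_twist = ample_twist \<Sigma> G i q
  for \<Sigma> :: "'s tgroupoid" (structure) and G :: "'g tgroupoid"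
    and i :: "'g \<times> 'r::comm_ring_1 \<Rightarrow> 's" and q :: "'s \<Rightarrow> 'g" +
  assumes idempotent_trivial: "\<And>e :: 'r. e * e = e \<Longrightarrow> e = 0 \<or> e = 1"


context ample_groupoid
begin

lemma src_image_eq: "U \<subseteq> arrows G \<Longrightarrow> src G ` U = rng G ` ginv G ` U"
  unfolding image_image by (intro image_cong) (auto simp: subset_iff)

lemma compact_open_src_image:
  assumes "openin (gtop G) U" "compactin (gtop G) U"
  shows "openin (gtop G) (src G ` U)" "compactin (gtop G) (src G ` U)"
  using compact_open_rng_image[OF open_ginv_image[OF topological_groupoid assms(1)]
      image_compactin[OF assms(2) continuous_map_ginv[OF topological_groupoid]]]
    src_image_eq[OF openin_subset[OF assms(1)]] by simp_all

end

context indecomposable_twist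
begin

section \<open>Normalisers\<close>

definition compact_open_units :: "'g set \<Rightarrow> bool" where
  "compact_open_units K \<longleftrightarrow> openin (gtop G) K \<and> compactin (gtop G) K \<and> K \<subseteq> unit_space G"

lemma compact_open_units_subset [simp]: "compact_open_units K \<Longrightarrow> K \<subseteq> unit_space G"
  unfolding compact_open_units_def by simp

lemma compact_open_units_Un [simp]:
  "compact_open_units K \<Longrightarrow> compact_open_units L \<Longrightarrow> compact_open_units (K \<union> L)"
  unfolding compact_open_units_def by (auto intro: compactin_Un)

lemma compact_open_units_rng [simp]: "f \<in> AA \<Longrightarrow> compact_open_units (rng G ` supp_G q f)"
  and compact_open_units_src [simp]: "f \<in> AA \<Longrightarrow> compact_open_units (src G ` supp_G q f)"
proof -
  assume f: "f \<in> AA"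
  have "supp_G q f \<subseteq> arrows G" using supp_G_arrows f by simp
  then show "compact_open_units (rng G ` supp_G q f)" "compact_open_units (src G ` supp_G q f)"
    unfolding compact_open_units_def
    using G.compact_open_rng_image[OF openin_supp_G[OF f] compact_supp_G[OF f]]
      G.compact_open_src_image[OF openin_supp_G[OF f] compact_supp_G[OF f]] by auto
qed

lemma chi_in_BB [simp]: "compact_open_units K \<Longrightarrow> chi K \<in> BB"
  using chi_BB unfolding compact_open_units_def by simp

lemma compact_slice_chi: "compact_open_units K \<Longrightarrow> compact_slice (unit_lift K)"
  using compact_slice_unit_lift unfolding compact_open_units_def by simp

lemma in_rng_image_supp_G: "f \<in> AA \<Longrightarrow> \<sigma> \<in> arrows \<Sigma> \<Longrightarrow> f \<sigma> \<noteq> 0 \<Longrightarrow> rng G (q \<sigma>) \<in> rng G ` supp_G q f"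
  and in_src_image_supp_G: "f \<in> AA \<Longrightarrow> \<sigma> \<in> arrows \<Sigma> \<Longrightarrow> f \<sigma> \<noteq> 0 \<Longrightarrow> src G (q \<sigma>) \<in> src G ` supp_G q f"
  by simp_all

lemma rng_image_supp_G_E:
  assumes "f \<in> AA" "x \<in> rng G ` supp_G q f"
  obtains \<sigma> where "\<sigma> \<in> arrows \<Sigma>" "f \<sigma> \<noteq> 0" "rng G (q \<sigma>) = x"
  using assms by (auto elim: supp_G_E[rotated])

lemma chi_mult_eq:
  assumes f: "f \<in> AA" and K: "K \<subseteq> unit_space G" "rng G ` supp_G q f \<subseteq> K"
  shows "conv (chi K) f = f"
proof (rule equivariant_eqI)
  show "equivariant (conv (chi K) f)" using f K by (simp add: conv_equivariant)
  fix \<sigma> assume \<sigma>: "\<sigma> \<in> arrows \<Sigma>"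
  have "f \<sigma> \<noteq> 0 \<Longrightarrow> rng G (q \<sigma>) \<in> K"
    using in_rng_image_supp_G[OF f \<sigma>] K(2) by blast
  then show "conv (chi K) f \<sigma> = f \<sigma>" using f K(1) \<sigma> by (auto simp: conv_chi_left)
qed (use f in simp)

lemma mult_chi_eq:
  assumes f: "f \<in> AA" and K: "K \<subseteq> unit_space G" "src G ` supp_G q f \<subseteq> K"
  shows "conv f (chi K) = f"
proof (rule equivariant_eqI)
  show "equivariant (conv f (chi K))" using f K by (simp add: conv_equivariant)
  fix \<sigma> assume \<sigma>: "\<sigma> \<in> arrows \<Sigma>"
  have "f \<sigma> \<noteq> 0 \<Longrightarrow> src G (q \<sigma>) \<in> K"
    using in_src_image_supp_G[OF f \<sigma>] K(2) by blast
  then show "conv f (chi K) \<sigma> = f \<sigma>" using f K(1) \<sigma> by (auto simp: conv_chi_right)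
qed (use f in simp)

section \<open>Local units and the idempotents of the diagonal\<close>

lemma finite_local_unit:
  assumes "finite F" "F \<subseteq> AA"
  shows "\<exists>K. compact_open_units K \<and> (\<forall>f \<in> F. conv (chi K) f = f \<and> conv f (chi K) = f)"
proof -
  define K where "K = (\<Union>f\<in>F. rng G ` supp_G q f \<union> src G ` supp_G q f)"
  have co: "compact_open_units (rng G ` supp_G q f \<union> src G ` supp_G q f)" if "f \<in> F" for f
    using assms that by (intro compact_open_units_Un) auto
  then have K: "compact_open_units K"
    unfolding K_def compact_open_units_def
    using assms(1) by (auto intro!: openin_Union compactin_Union)
  moreover have "conv (chi K) f = f \<and> conv f (chi K) = f" if "f \<in> F" for f
    using assms that K by (intro conjI chi_mult_eq mult_chi_eq) (auto simp: K_def)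
  ultimately show ?thesis by blast
qed

text \<open>At a unit the product in \<open>B\<close> is the product in \<open>R\<close>, so the
  value is an idempotent of \<open>R\<close>. Here indecomposability of \<open>R\<close>
  enters.\<close>

lemma idempotent_values:
  assumes "b \<in> BB" "conv b b = b" "x \<in> unit_space \<Sigma>"
  shows "b x = 0 \<or> b x = 1"
  using conv_diagonal_unit[of b b x] assms by (intro idempotent_trivial) simp

lemma idempotent_eq_chi:
  assumes b: "b \<in> BB" "conv b b = b"
  shows "b = chi (rng G ` supp_G q b)"
proof (rule diagonal_eqI)
  have K: "compact_open_units (rng G ` supp_G q b)" using b by simp
  then show "diagonal (chi (rng G ` supp_G q b))" by simp
  fix x assume x: "x \<in> unit_space \<Sigma>"
  have xa: "x \<in> arrows \<Sigma>" using x unit_space_arrow by simp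
  show "b x = chi (rng G ` supp_G q b) x"
  proof (cases "b x = 0")
    case True
    have "q x \<notin> rng G ` supp_G q b"
    proof
      assume "q x \<in> rng G ` supp_G q b"
      then obtain \<sigma> where \<sigma>: "\<sigma> \<in> arrows \<Sigma>" "b \<sigma> \<noteq> 0" "rng G (q \<sigma>) = q x"
        using rng_image_supp_G_E b by (metis BB_AA)
      then have "q \<sigma> = q x" using diagonalD[of b \<sigma>] b by simp
      then show False using equivariant_fibre[of b \<sigma> x] \<sigma> True b xa by simp
    qed
    then show ?thesis using True x K by (simp add: chi_unit)
  next
    case False
    then have "q x \<in> rng G ` supp_G q b" using in_rng_image_supp_G[of b x] b xa x by simp
    then show ?thesis using False idempotent_values[OF b x] x K by (simp add: chi_unit)
  qed
qed (use b in simp)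

lemma idempotents_iff: "e \<in> idempotents Alg BB \<longleftrightarrow> (\<exists>K. compact_open_units K \<and> e = chi K)"
proof
  assume "e \<in> idempotents Alg BB"
  then have "e \<in> BB" "conv e e = e" unfolding idempotents_def by auto
  then show "\<exists>K. compact_open_units K \<and> e = chi K" 
    using idempotent_eq_chi[of e] compact_open_units_rng[of e] BB_AA[of e] by metis
next
  assume "\<exists>K. compact_open_units K \<and> e = chi K"
  then obtain K where K: "compact_open_units K" "e = chi K" by auto
  have "conv e e = e"
    using K by (intro diagonal_eqI) (auto simp: diagonal_conv conv_diagonal_unit chi_unit)
  then show "e \<in> idempotents Alg BB" unfolding idempotents_def using K by simp
qed

section \<open>Inverses of normalisers\<close>

abbreviation "NN \<equiv> normalisers Alg BB"
abbreviation "ninv \<equiv> normaliser_inverse Alg BB"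
abbreviation dag where "dag \<equiv> dagger Alg BB"

lemma ninv_iff: "ninv n k \<longleftrightarrow> k \<in> AA \<and> conv (conv k n) k = k \<and> conv (conv n k) n = n \<and>
    (\<forall>b \<in> BB. conv (conv k b) n \<in> BB \<and> conv (conv n b) k \<in> BB)"
  unfolding normaliser_inverse_def by simp

lemma NN_AA [simp]: "n \<in> NN \<Longrightarrow> n \<in> AA"
  unfolding normalisers_def by simp

lemma NN_I: "n \<in> AA \<Longrightarrow> ninv n k \<Longrightarrow> n \<in> NN"
  unfolding normalisers_def by auto

lemma ninv_sym: "n \<in> AA \<Longrightarrow> ninv n k \<Longrightarrow> ninv k n"
  unfolding ninv_iff by blast

text \<open>\<open>B\<close> has no unit to insert between \<open>n\<close> and \<open>k\<close>. An
  indicator that acts as the identity on both takes its place in the normaliser condition.\<close>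

lemma ninv_conv_BB:
  assumes n: "n \<in> AA" and k: "ninv n k"
  shows "conv n k \<in> BB" "conv k n \<in> BB"
proof -
  obtain K where K: "compact_open_units K" "\<forall>f\<in>{n, k}. conv f (chi K) = f"
    using finite_local_unit[of "{n, k}"] n k unfolding ninv_iff by auto
  have "conv (conv n (chi K)) k \<in> BB" "conv (conv k (chi K)) n \<in> BB"
    using k K(1) chi_in_BB unfolding ninv_iff by blast+
  then show "conv n k \<in> BB" "conv k n \<in> BB" using K(2) by simp_all
qed

text \<open>The uniqueness argument of inverse semigroups: the products \<open>conv k n\<close>,
  \<open>conv k' n\<close> commute, and so do \<open>conv n k\<close>, \<open>conv n k'\<close>,
  because all four lie in the commutative \<open>B\<close>.\<close>

lemma ninv_unique:
  assumes n: "n \<in> AA" and k: "ninv n k" and k': "ninv n k'"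
  shows "k = k'"
proof -
  have A: "k \<in> AA" "k' \<in> AA" using k k' unfolding ninv_iff by auto
  note R [simp] = n A
  have c: "conv (conv a b) d = conv a (conv b d)" if "a \<in> AA" "b \<in> AA" "d \<in> AA" for a b d
    using that by (simp add: conv_assoc)
  have knk: "conv k (conv n k) = k" "conv n (conv k n) = n" "conv k' (conv n k') = k'" "conv n (conv k' n) = n"
    using k k' c unfolding ninv_iff by auto
  note B = ninv_conv_BB[OF n k] ninv_conv_BB[OF n k']
  have "k = conv k (conv (conv n (conv k' n)) k)" using knk by simp
  also have "\<dots> = conv (conv (conv k n) (conv k' n)) k" by (simp add: c)
  also have "\<dots> = conv (conv (conv k' n) (conv k n)) k"
    using diagonal_commute[of "conv k n" "conv k' n"] B by simp
  also have "\<dots> = conv k' (conv (conv n (conv k n)) k)" by (simp add: c)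
  also have "\<dots> = conv k' (conv (conv n (conv k' n)) k)" using knk by simp
  also have "\<dots> = conv k' (conv (conv n k') (conv n k))" by (simp add: c)
  also have "\<dots> = conv k' (conv (conv n k) (conv n k'))"
    using diagonal_commute[of "conv n k'" "conv n k"] B by simp
  also have "\<dots> = conv k' (conv (conv n (conv k n)) k')" by (simp add: c)
  also have "\<dots> = k'" using knk by simp
  finally show ?thesis .
qed

lemma dag_eq: "n \<in> AA \<Longrightarrow> ninv n k \<Longrightarrow> dag n = k"
  unfolding dagger_def using ninv_unique by blast

lemma ninv_dag: "n \<in> NN \<Longrightarrow> ninv n (dag n)"
  unfolding normalisers_def using dag_eq by auto

lemma dag_NN: "n \<in> NN \<Longrightarrow> dag n \<in> NN"
  using NN_I[OF _ ninv_sym[OF NN_AA ninv_dag]] ninv_dag ninv_iff by blast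

lemma ninv_conv_idempotent:
  assumes n: "n \<in> AA" and k: "ninv n k"
  shows "conv (conv n k) (conv n k) = conv n k"
  using k n unfolding ninv_iff by (metis AA_row_finite conv_assoc AA_conv)

text \<open>The product is an idempotent of \<open>B\<close>, so only its set of units must be
  found. A nonzero row of \<open>conv n k\<close> needs a nonzero row of \<open>n\<close>, and the
  identity \<open>conv (conv n k) n = n\<close> gives the converse.\<close>

lemma ninv_conv_eq_chi:
  assumes n: "n \<in> AA" and k: "ninv n k"
  shows "conv n k = chi (rng G ` supp_G q n)"
proof -
  have kA: "k \<in> AA" using k ninv_iff by simp
  have nkA: "conv n k \<in> BB" using ninv_conv_BB n k by blast
  have "rng G ` supp_G q (conv n k) = rng G ` supp_G q n"
  proof (intro equalityI subsetI)
    fix x assume "x \<in> rng G ` supp_G q (conv n k)"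
    then obtain \<sigma> where "\<sigma> \<in> arrows \<Sigma>" "conv n k \<sigma> \<noteq> 0" "rng G (q \<sigma>) = x"
      using rng_image_supp_G_E[OF BB_AA[OF nkA]] by metis
    moreover have "equivariant n" using n by simp
    ultimately obtain \<rho> where "\<rho> \<in> arrows \<Sigma>" "rng G (q \<rho>) = x" "n \<rho> \<noteq> 0"
      using conv_nonzeroE[of n k \<sigma>] by metis
    then show "x \<in> rng G ` supp_G q n" using in_rng_image_supp_G[OF n] by blast
  next
    fix x assume "x \<in> rng G ` supp_G q n"
    then obtain \<sigma> where \<sigma>: "\<sigma> \<in> arrows \<Sigma>" "n \<sigma> \<noteq> 0" "rng G (q \<sigma>) = x"
      using rng_image_supp_G_E[OF n] by metis
    have "n \<sigma> = conv (conv n k) n \<sigma>" using k ninv_iff by simp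
    also have "\<dots> = conv n k (rng \<Sigma> \<sigma>) * n \<sigma>" using nkA n \<sigma> by (simp add: conv_diagonal_left)
    finally have "conv n k (rng \<Sigma> \<sigma>) \<noteq> 0" using \<sigma> by auto
    then show "x \<in> rng G ` supp_G q (conv n k)"
      using in_rng_image_supp_G[OF BB_AA[OF nkA], of "rng \<Sigma> \<sigma>"] \<sigma>(1) by (simp flip: \<sigma>(3))
  qed
  then show ?thesis using idempotent_eq_chi[OF nkA ninv_conv_idempotent[OF n k]] by simp
qed

lemma ind_NN [simp]:
  assumes X: "compact_slice X"
  shows "ind X \<in> NN"
proof (rule NN_I)
  let ?X' = "ginv \<Sigma> ` X"
  have X': "compact_slice ?X'" using X compact_slice_inv by simp
  have XX: "ginv \<Sigma> ` ?X' = X" using X inv_inv_image by simp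
  show "ninv (ind X) (ind ?X')"
    unfolding ninv_iff
  proof (intro conjI ballI)
    show "conv (conv (ind ?X') (ind X)) (ind ?X') = ind ?X'"
      "conv (conv (ind X) (ind ?X')) (ind X) = ind X"
      using conv_ind_inv_ind[of ?X'] conv_ind_inv_ind[of X] X X' by (simp_all add: conv_assoc XX)
    fix b assume b: "b \<in> BB"
    show "conv (conv (ind ?X') b) (ind X) \<in> BB" "conv (conv (ind X) b) (ind ?X') \<in> BB"
      using diagonal_conj_ind[of X b] diagonal_conj_ind[of ?X' b] X X' b
      by (auto intro!: BB_I simp: conv_assoc XX)
  qed (use X' in simp)
qed (use X in simp)

text \<open>The inverse is the product of the inverses in reverse order. The middle factors
  \<open>conv m ?l\<close> and \<open>conv ?k n\<close> are elements of \<open>B\<close>, and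
  commuting them gives both identities.\<close>

lemma conv_NN [simp]:
  assumes n: "n \<in> NN" and m: "m \<in> NN"
  shows "conv n m \<in> NN"
proof (rule NN_I)
  let ?k = "dag n" and ?l = "dag m"
  have A [simp]: "n \<in> AA" "m \<in> AA" "?k \<in> AA" "?l \<in> AA" using n m dag_NN by simp_all
  note k = ninv_dag[OF n] and l = ninv_dag[OF m]
  have c: "conv (conv a b) d = conv a (conv b d)" if "a \<in> AA" "b \<in> AA" "d \<in> AA" for a b d
    using that by (simp add: conv_assoc)
  have e: "conv ?k (conv n ?k) = ?k" "conv n (conv ?k n) = n" "conv ?l (conv m ?l) = ?l" "conv m (conv ?l m) = m"
    using k l c unfolding ninv_iff by auto
  have comm: "conv (conv m ?l) (conv ?k n) = conv (conv ?k n) (conv m ?l)"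
    using ninv_conv_BB[OF _ k] ninv_conv_BB[OF _ l] by (intro diagonal_commute) auto
  show "ninv (conv n m) (conv ?l ?k)"
    unfolding ninv_iff
  proof (intro conjI ballI)
    have "conv (conv (conv ?l ?k) (conv n m)) (conv ?l ?k) = conv ?l (conv (conv (conv ?k n) (conv m ?l)) ?k)"
      by (simp add: c)
    also have "\<dots> = conv ?l (conv (conv (conv m ?l) (conv ?k n)) ?k)" by (simp add: comm)
    also have "\<dots> = conv (conv ?l (conv m ?l)) (conv ?k (conv n ?k))" by (simp add: c)
    finally show "conv (conv (conv ?l ?k) (conv n m)) (conv ?l ?k) = conv ?l ?k" by (simp add: e)
    have "conv (conv (conv n m) (conv ?l ?k)) (conv n m) = conv n (conv (conv (conv m ?l) (conv ?k n)) m)"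
      by (simp add: c)
    also have "\<dots> = conv n (conv (conv (conv ?k n) (conv m ?l)) m)" by (simp add: comm)
    also have "\<dots> = conv (conv n (conv ?k n)) (conv m (conv ?l m))" by (simp add: c)
    finally show "conv (conv (conv n m) (conv ?l ?k)) (conv n m) = conv n m" by (simp add: e)
    fix b assume b: "b \<in> BB"
    have "conv (conv ?k b) n \<in> BB" "conv (conv m b) ?l \<in> BB" using k l b unfolding ninv_iff by blast+
    then have "conv (conv ?l (conv (conv ?k b) n)) m \<in> BB" "conv (conv n (conv (conv m b) ?l)) ?k \<in> BB"
      using k l unfolding ninv_iff by blast+
    then show "conv (conv (conv ?l ?k) b) (conv n m) \<in> BB" "conv (conv (conv n m) b) (conv ?l ?k) \<in> BB"
      using b by (simp_all add: c)
  qed simp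
qed (use n m in simp)

lemma chi_NN [simp]: "compact_open_units K \<Longrightarrow> chi K \<in> NN"
  using compact_slice_chi by simp


section \<open>Ultrafilters of normalisers\<close>

definition row_eq :: "'g \<Rightarrow> ('s \<Rightarrow> 'r) \<Rightarrow> ('s \<Rightarrow> 'r) \<Rightarrow> bool" where
  "row_eq x f g \<longleftrightarrow> (\<forall>\<sigma> \<in> arrows \<Sigma>. rng G (q \<sigma>) = x \<longrightarrow> f \<sigma> = g \<sigma>)"

lemma row_eqD: "row_eq x f g \<Longrightarrow> \<sigma> \<in> arrows \<Sigma> \<Longrightarrow> rng G (q \<sigma>) = x \<Longrightarrow> f \<sigma> = g \<sigma>"
  unfolding row_eq_def by blast

lemma row_eq_refl [simp]: "row_eq x f f"
  and row_eq_sym: "row_eq x f g \<Longrightarrow> row_eq x g f"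
  and row_eq_trans: "row_eq x f g \<Longrightarrow> row_eq x g h \<Longrightarrow> row_eq x f h"
  unfolding row_eq_def by auto

abbreviation Rg :: "('s \<Rightarrow> 'r) \<Rightarrow> 'g set" where
  "Rg f \<equiv> rng G ` supp_G q f"

lemma mem_Rg_iff: "f \<in> AA \<Longrightarrow> x \<in> Rg f \<longleftrightarrow> \<not> row_eq x f 0"
  unfolding row_eq_def by (auto elim!: supp_G_E[rotated] intro: in_rng_image_supp_G)

lemma row_eq_mem_Rg: "f \<in> AA \<Longrightarrow> g \<in> AA \<Longrightarrow> row_eq x f g \<Longrightarrow> x \<in> Rg f \<Longrightarrow> x \<in> Rg g"
  using mem_Rg_iff row_eq_trans by blast

text \<open>Stated through the difference, which lies in \<open>AA\<close>, disagreement becomes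
  membership in a compact open set of units. Both agreement and disagreement of rows are therefore
  open conditions.\<close>

lemma row_eq_iff_diff: "f \<in> AA \<Longrightarrow> g \<in> AA \<Longrightarrow> row_eq x f g \<longleftrightarrow> x \<notin> Rg (f - g)"
  by (simp only: mem_Rg_iff[OF AA_diff]) (simp add: row_eq_def)

lemma Rg_unit_space: "f \<in> AA \<Longrightarrow> Rg f \<subseteq> unit_space G"
  using compact_open_units_rng compact_open_units_subset by blast

lemma unit_neighbourhood:
  assumes "openin (gtop G) U" "x \<in> U" "x \<in> unit_space G"
  obtains K where "compact_open_units K" "x \<in> K" "K \<subseteq> U"
  using G.unit_neighbourhoodE[OF assms] unfolding compact_open_units_def by metis

lemma row_eq_near:
  assumes "f \<in> AA" "g \<in> AA" "x \<in> unit_space G" "row_eq x f g"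
  obtains K where "compact_open_units K" "x \<in> K" "\<And>y. y \<in> K \<Longrightarrow> row_eq y f g"
proof -
  have "openin (gtop G) (arrows G - Rg (f - g))"
    using compact_open_units_rng[of "f - g"] assms
    by (intro G.openin_diff_compact) (auto simp: compact_open_units_def)
  moreover have "x \<in> arrows G - Rg (f - g)" using assms row_eq_iff_diff G.unit_space_arrow by simp
  ultimately obtain K where "compact_open_units K" "x \<in> K" "K \<subseteq> arrows G - Rg (f - g)"
    using unit_neighbourhood assms(3) by metis
  then show ?thesis using that assms row_eq_iff_diff by blast
qed

lemma not_row_eq_near:
  assumes "f \<in> AA" "g \<in> AA" "\<not> row_eq x f g"
  obtains K where "compact_open_units K" "x \<in> K" "\<And>y. y \<in> K \<Longrightarrow> \<not> row_eq y f g"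
  using that[of "Rg (f - g)"] assms row_eq_iff_diff compact_open_units_rng[OF AA_diff] by blast

lemma row_eq_chi:
  "compact_open_units K \<Longrightarrow> f \<in> AA \<Longrightarrow> x \<in> K \<Longrightarrow> row_eq x (conv (chi K) f) f"
  unfolding row_eq_def by (simp add: conv_chi_left)

lemma Rg_chi: "compact_open_units K \<Longrightarrow> f \<in> AA \<Longrightarrow> Rg (conv (chi K) f) \<subseteq> K"
proof
  fix x assume K: "compact_open_units K" and f: "f \<in> AA" and "x \<in> Rg (conv (chi K) f)"
  then obtain \<sigma> where "\<sigma> \<in> arrows \<Sigma>" "conv (chi K) f \<sigma> \<noteq> 0" "rng G (q \<sigma>) = x"
    using rng_image_supp_G_E[of "conv (chi K) f" x] by (metis AA_conv BB_AA chi_in_BB)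
  then show "x \<in> K" using K f by (auto simp: conv_chi_left split: if_splits)
qed

text \<open>The idempotent \<open>conv n (dag n)\<close> is the indicator of \<open>Rg n\<close>,
  and multiplying \<open>m\<close> by it keeps exactly the rows of \<open>m\<close> over
  \<open>Rg n\<close>.\<close>

lemma nle_iff:
  assumes n: "n \<in> NN" and m: "m \<in> AA"
  shows "nle Alg BB n m \<longleftrightarrow> (\<forall>x \<in> Rg n. row_eq x n m)"
proof -
  have K: "Rg n \<subseteq> unit_space G" using n Rg_unit_space by simp
  have "nle Alg BB n m \<longleftrightarrow> n = conv (chi (Rg n)) m"
    unfolding nle_def using ninv_conv_eq_chi[OF _ ninv_dag[OF n]] n by simp
  also have "\<dots> \<longleftrightarrow> (\<forall>\<sigma> \<in> arrows \<Sigma>. n \<sigma> = conv (chi (Rg n)) m \<sigma>)"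
    using equivariant_eqI[of n "conv (chi (Rg n)) m"] n m K by (auto simp: conv_equivariant)
  also have "\<dots> \<longleftrightarrow> (\<forall>\<sigma> \<in> arrows \<Sigma>. n \<sigma> = (if rng G (q \<sigma>) \<in> Rg n then m \<sigma> else 0))"
    using K m by (intro ball_cong refl) (simp only: conv_chi_left AA_equivariant)
  also have "\<dots> \<longleftrightarrow> (\<forall>x \<in> Rg n. row_eq x n m)"
  proof
    assume r: "\<forall>x \<in> Rg n. row_eq x n m"
    show "\<forall>\<sigma> \<in> arrows \<Sigma>. n \<sigma> = (if rng G (q \<sigma>) \<in> Rg n then m \<sigma> else 0)"
    proof
      fix \<sigma> assume \<sigma>: "\<sigma> \<in> arrows \<Sigma>"
      show "n \<sigma> = (if rng G (q \<sigma>) \<in> Rg n then m \<sigma> else 0)"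
        using row_eqD[OF bspec[OF r] \<sigma>] in_rng_image_supp_G[OF NN_AA[OF n] \<sigma>] by auto
    qed
  qed (simp add: row_eq_def)
  finally show ?thesis .
qed

definition germ_filter :: "('s \<Rightarrow> 'r) \<Rightarrow> 'g \<Rightarrow> ('s \<Rightarrow> 'r) set" where
  "germ_filter n x = {m \<in> NN. row_eq x n m}"

lemma nonzero_Rg: "n \<in> AA \<Longrightarrow> n \<noteq> 0 \<Longrightarrow> \<exists>x. x \<in> Rg n"
proof (rule ccontr)
  assume n: "n \<in> AA" "n \<noteq> 0" "\<nexists>x. x \<in> Rg n"
  have "n = 0"
  proof (rule equivariant_eqI)
    fix \<sigma> assume "\<sigma> \<in> arrows \<Sigma>"
    then show "n \<sigma> = 0 \<sigma>" using in_rng_image_supp_G[OF n(1)] n(3) by (auto simp only: zero_fun_def)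
  qed (use n(1) in \<open>simp_all only: AA_equivariant equivariant_zero\<close>)
  then show False using n(2) by contradiction
qed

lemma zero_not_Rg: "x \<notin> Rg 0"
  by (simp add: mem_Rg_iff)

lemma restrict_in_germ_filter:
  "n \<in> NN \<Longrightarrow> compact_open_units K \<Longrightarrow> x \<in> K \<Longrightarrow> conv (chi K) n \<in> germ_filter n x"
  unfolding germ_filter_def using row_eq_sym row_eq_chi by simp

text \<open>Common lower bounds come from restricting to a neighbourhood of \<open>x\<close> where
  the two rows agree. Maximality comes from the dual fact that disagreement of rows at
  \<open>x\<close> persists on a neighbourhood.\<close>

lemma germ_filter_ultrafilter:
  assumes n: "n \<in> NN" and x: "x \<in> Rg n"
  shows "normaliser_ultrafilter Alg BB (germ_filter n x)"
  unfolding normaliser_ultrafilter_def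
proof (intro conjI allI impI)
  let ?F = "germ_filter n x"
  have xu: "x \<in> unit_space G" using Rg_unit_space[OF NN_AA[OF n]] x by blast
  have F: "m \<in> NN" "row_eq x n m" "x \<in> Rg m" if "m \<in> ?F" for m
    using that row_eq_mem_Rg[of n m x] n x unfolding germ_filter_def by auto
  show "normaliser_filter Alg BB ?F"
    unfolding normaliser_filter_def
  proof (intro conjI ballI)
    show "?F \<subseteq> NN - {0}" using F zero_not_Rg by blast
    show "?F = up_closure Alg BB ?F"
    proof (intro equalityI subsetI)
      fix m assume m: "m \<in> ?F"
      then have "nle Alg BB m m" using F(1) by (simp add: nle_iff)
      then show "m \<in> up_closure Alg BB ?F" using m F(1) unfolding up_closure_def by blast
    next
      fix m assume "m \<in> up_closure Alg BB ?F"
      then obtain k where k: "m \<in> NN" "k \<in> ?F" "nle Alg BB k m" unfolding up_closure_def by blast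
      then have "row_eq x k m"
        using nle_iff[OF F(1)[OF k(2)] NN_AA[OF k(1)]] F(3)[OF k(2)] by blast
      then show "m \<in> ?F" using k F(2)[OF k(2)] row_eq_trans unfolding germ_filter_def by blast
    qed
    fix m m' assume m: "m \<in> ?F" and m': "m' \<in> ?F"
    have "row_eq x m m'" using F(2)[OF m] F(2)[OF m'] row_eq_sym row_eq_trans by blast
    then obtain K where K: "compact_open_units K" "x \<in> K" "\<And>y. y \<in> K \<Longrightarrow> row_eq y m m'"
      using row_eq_near[OF NN_AA[OF F(1)[OF m]] NN_AA[OF F(1)[OF m']] xu] by metis
    let ?k = "conv (chi K) m"
    have kN: "?k \<in> NN" using K F m by simp
    have rk: "row_eq y ?k m" "row_eq y m m'" if "y \<in> Rg ?k" for y
      using that Rg_chi[OF K(1) NN_AA[OF F(1)[OF m]]] row_eq_chi[OF K(1) NN_AA[OF F(1)[OF m]]] K(3)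
      by blast+
    have "nle Alg BB ?k m" "nle Alg BB ?k m'"
      using nle_iff[OF kN] rk row_eq_trans F(1)[OF m] F(1)[OF m'] by (meson NN_AA)+
    moreover have "?k \<in> ?F"
      using restrict_in_germ_filter[OF F(1)[OF m] K(1,2)] F(2)[OF m] row_eq_trans
      unfolding germ_filter_def by blast
    ultimately show "\<exists>k\<in>?F. nle Alg BB k m \<and> nle Alg BB k m'" by blast
  qed
  show "?F \<noteq> {}" using n unfolding germ_filter_def by auto
  fix V assume "normaliser_filter Alg BB V \<and> ?F \<subseteq> V"
  then have V: "V \<subseteq> NN - {0}" "\<And>m m'. m \<in> V \<Longrightarrow> m' \<in> V \<Longrightarrow> \<exists>k\<in>V. nle Alg BB k m \<and> nle Alg BB k m'" "?F \<subseteq> V"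
    unfolding normaliser_filter_def by blast+
  have "m \<in> ?F" if m: "m \<in> V" for m
  proof (rule ccontr)
    assume "m \<notin> ?F"
    then have mN: "m \<in> NN" and ne: "\<not> row_eq x n m" using V(1) m unfolding germ_filter_def by blast+
    obtain K where K: "compact_open_units K" "x \<in> K" "\<And>y. y \<in> K \<Longrightarrow> \<not> row_eq y n m"
      using not_row_eq_near[OF NN_AA[OF n] NN_AA[OF mN] ne] by metis
    \<comment> \<open>The restriction to the region of disagreement stays in the filter. A nonzero
      common lower bound of it and \<open>m\<close> would make \<open>n\<close> and \<open>m\<close>
      agree at some point of \<open>K\<close>.\<close>
    let ?w = "conv (chi K) n"
    have wN: "?w \<in> NN" "?w \<in> V" using restrict_in_germ_filter[OF n K(1,2)] V(3) n K by auto
    obtain k where k: "k \<in> V" "nle Alg BB k ?w" "nle Alg BB k m" using V(2)[OF wN(2) m] by blast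
    have kN: "k \<in> NN" "k \<noteq> 0" using k V(1) by auto
    obtain y where y: "y \<in> Rg k" using nonzero_Rg[OF NN_AA[OF kN(1)] kN(2)] by blast
    have r: "row_eq y k ?w" "row_eq y k m" using k y nle_iff[OF kN(1)] wN mN by auto
    then have "y \<in> Rg ?w" using row_eq_mem_Rg[of k ?w y] y kN wN by simp
    then have "y \<in> K" using Rg_chi[OF K(1) NN_AA[OF n]] by blast
    then have "row_eq y n m"
      using row_eq_chi[OF K(1) NN_AA[OF n]] r row_eq_sym row_eq_trans by blast
    then show False using K(3) \<open>y \<in> K\<close> by blast
  qed
  then show "V = ?F" using V(3) by blast
qed

text \<open>A restriction of \<open>n\<close> to a neighbourhood of \<open>x\<close> that misses
  \<open>x'\<close> belongs to the first filter and has zero row at \<open>x'\<close>, so it cannot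
  belong to the second.\<close>

lemma germ_filter_base_eq:
  assumes n: "n \<in> NN" "x \<in> Rg n" and n': "n' \<in> NN" "x' \<in> Rg n'"
    and eq: "germ_filter n x = germ_filter n' x'"
  shows "x = x'"
proof (rule ccontr)
  assume ne: "x \<noteq> x'"
  have u: "x \<in> unit_space G" "x' \<in> unit_space G"
    using Rg_unit_space n n' NN_AA by blast+
  have "compactin (gtop G) {x'}" using u G.unit_space_arrow by simp
  then have "openin (gtop G) (arrows G - {x'})" by (intro G.openin_diff_compact) auto
  then obtain K where K: "compact_open_units K" "x \<in> K" "K \<subseteq> arrows G - {x'}"
    using unit_neighbourhood[of "arrows G - {x'}" x] u ne G.unit_space_arrow by blast
  have "conv (chi K) n \<in> germ_filter n' x'" using restrict_in_germ_filter[OF n(1) K(1,2)] eq by simp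
  then have "row_eq x' n' (conv (chi K) n)" unfolding germ_filter_def by simp
  then have "x' \<in> Rg (conv (chi K) n)" using row_eq_mem_Rg[of n'] n' n K by simp
  then have "x' \<in> K" using Rg_chi[OF K(1) NN_AA[OF n(1)]] by blast
  then show False using K(3) by blast
qed

section \<open>The map \<open>Phi\<close> in terms of rows\<close>

lemma tilde_one_eq:
  assumes X: "compact_slice X"
  shows "tilde_one G \<Sigma> i q X = ind X"
  unfolding tilde_one_def
proof (rule the_equality)
  note sX = compact_sliceD[OF X]
  show "ind X \<in> AA \<and> supp (ind X) \<subseteq> {act t \<sigma> |t \<sigma>. t \<in> ring_units \<and> \<sigma> \<in> X} \<and> (\<forall>\<sigma>\<in>X. ind X \<sigma> = 1)"
  proof (intro conjI ballI subsetI)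
    fix \<sigma> assume "\<sigma> \<in> supp (ind X)"
    then have nz: "ind X \<sigma> \<noteq> 0" by (simp add: supp_def)
    then have "\<sigma> \<in> arrows \<Sigma>" using equivariant_arrow equivariant_ind sX by blast
    with sX show "\<sigma> \<in> {act t \<sigma> |t \<sigma>. t \<in> ring_units \<and> \<sigma> \<in> X}"
      by (cases rule: ind_cases) (use nz in auto)
  qed (use X sX ind_one in auto)
  fix f assume f: "f \<in> AA \<and> supp f \<subseteq> {act t \<sigma> |t \<sigma>. t \<in> ring_units \<and> \<sigma> \<in> X} \<and> (\<forall>\<sigma>\<in>X. f \<sigma> = 1)"
  show "f = ind X"
  proof (rule equivariant_eqI)
    fix \<sigma> assume \<sigma>: "\<sigma> \<in> arrows \<Sigma>"
    from sX \<sigma> show "f \<sigma> = ind X \<sigma>"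
    proof (cases rule: ind_cases)
      case (1 t \<tau>)
      then show ?thesis using f slice_arrow[OF sX, of \<tau>] by (simp add: equivariant_act)
    next
      case 2
      then have "\<sigma> \<notin> {act t \<sigma> |t \<sigma>. t \<in> ring_units \<and> \<sigma> \<in> X}" using slice_arrow[OF sX] by auto
      then have "\<sigma> \<notin> supp f" using f by blast
      then show ?thesis using 2 by (simp add: supp_def)
    qed
  qed (use f X in auto)
qed

lemma unit_ultrafilter_iff:
  assumes \<sigma>: "\<sigma> \<in> arrows \<Sigma>"
  shows "e \<in> unit_ultrafilter G \<Sigma> i q (src \<Sigma> \<sigma>) \<longleftrightarrow>
    (\<exists>K. compact_open_units K \<and> e = chi K \<and> src G (q \<sigma>) \<in> K)"
  unfolding unit_ultrafilter_def using \<sigma> by (auto simp: idempotents_iff chi_unit split: if_splits)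

text \<open>The elements of \<open>\<Phi>(\<sigma>)\<close> are the normalisers whose row at \<open>r(\<sigma>)\<close> is the point mass at
  \<open>\<sigma>\<close>. This description does not mention a slice.\<close>

definition point_filter :: "'s \<Rightarrow> ('s \<Rightarrow> 'r) set" where
  "point_filter \<sigma> = {m \<in> NN. m \<sigma> = 1 \<and>
     (\<forall>\<tau> \<in> arrows \<Sigma>. rng G (q \<tau>) = rng G (q \<sigma>) \<longrightarrow> q \<tau> \<noteq> q \<sigma> \<longrightarrow> m \<tau> = 0)}"

lemma point_filter_eq_germ_filter:
  assumes X: "compact_slice X" and \<sigma>: "\<sigma> \<in> X"
  shows "point_filter \<sigma> = germ_filter (ind X) (rng G (q \<sigma>))"
proof -
  note sX = compact_sliceD[OF X]
  have a: "\<sigma> \<in> arrows \<Sigma>" using slice_arrow[OF sX \<sigma>] .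
  have "row_eq (rng G (q \<sigma>)) (ind X) m \<longleftrightarrow> m \<sigma> = 1 \<and>
     (\<forall>\<tau> \<in> arrows \<Sigma>. rng G (q \<tau>) = rng G (q \<sigma>) \<longrightarrow> q \<tau> \<noteq> q \<sigma> \<longrightarrow> m \<tau> = 0)" (is "?L \<longleftrightarrow> ?R")
    if m: "m \<in> AA" for m
  proof
    assume L: ?L
    show ?R
    proof (intro conjI ballI impI)
      show "m \<sigma> = 1" using row_eqD[OF L a] ind_one[OF sX \<sigma>] by simp
      fix \<tau> assume \<tau>: "\<tau> \<in> arrows \<Sigma>" "rng G (q \<tau>) = rng G (q \<sigma>)" "q \<tau> \<noteq> q \<sigma>"
      have "q \<tau> \<notin> q ` X" using slice_rng[OF sX _ \<sigma>] \<tau> by fastforce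
      then have "ind X \<tau> = 0" using ind_eq_0 by blast
      then show "m \<tau> = 0" using row_eqD[OF L \<tau>(1,2)] by simp
    qed
  next
    assume R: ?R
    show ?L
      unfolding row_eq_def
    proof (intro ballI impI)
      fix \<tau> assume \<tau>: "\<tau> \<in> arrows \<Sigma>" "rng G (q \<tau>) = rng G (q \<sigma>)"
      show "ind X \<tau> = m \<tau>"
      proof (cases "q \<tau> = q \<sigma>")
        case True
        then obtain t where "t \<in> ring_units" "\<tau> = act t \<sigma>" using same_fibreE[OF a \<tau>(1)] by metis
        then show ?thesis using R m a by (simp add: ind_act[OF sX \<sigma>] equivariant_act)
      next
        case False
        then have "q \<tau> \<notin> q ` X" using slice_rng[OF sX _ \<sigma>] \<tau> by fastforce
        then have "ind X \<tau> = 0" using ind_eq_0 by blast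
        then show ?thesis using R \<tau> False by simp
      qed
    qed
  qed
  then show ?thesis unfolding point_filter_def germ_filter_def by auto
qed

text \<open>The definition of \<open>\<Phi>\<close> cuts the slice down near the source of
  \<open>\<sigma>\<close>, whereas the order compares rows, that is, ranges. On a slice ranges and
  sources determine each other, so the two ways of shrinking are interchangeable.\<close>

lemma Phi_via_eq:
  assumes X: "compact_slice X" and \<sigma>: "\<sigma> \<in> X"
  shows "Phi_via G \<Sigma> i q X \<sigma> = germ_filter (ind X) (rng G (q \<sigma>))"
proof (intro equalityI subsetI)
  note sX = compact_sliceD[OF X]
  have a: "\<sigma> \<in> arrows \<Sigma>" using slice_arrow[OF sX \<sigma>] .
  let ?x = "rng G (q \<sigma>)"
  have mem: "m \<in> Phi_via G \<Sigma> i q X \<sigma> \<longleftrightarrow> m \<in> NN \<and>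
    (\<exists>K. compact_open_units K \<and> src G (q \<sigma>) \<in> K \<and> nle Alg BB (conv (ind X) (chi K)) m)" for m
    unfolding Phi_via_def up_closure_def tilde_one_eq[OF X] by (auto simp: unit_ultrafilter_iff[OF a])
  have wN: "conv (ind X) (chi K) \<in> NN" if "compact_open_units K" for K
    using X that by simp
  have w: "conv (ind X) (chi K) \<tau> = (if src G (q \<tau>) \<in> K then ind X \<tau> else 0)"
    if "compact_open_units K" "\<tau> \<in> arrows \<Sigma>" for K \<tau>
    using that X by (simp add: conv_chi_right)
  {
    fix m assume "m \<in> Phi_via G \<Sigma> i q X \<sigma>"
    then obtain K where K: "m \<in> NN" "compact_open_units K" "src G (q \<sigma>) \<in> K"
      "nle Alg BB (conv (ind X) (chi K)) m" using mem by blast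
    have "row_eq ?x (ind X) (conv (ind X) (chi K))"
      unfolding row_eq_def
    proof (intro ballI impI)
      fix \<tau> assume \<tau>: "\<tau> \<in> arrows \<Sigma>" "rng G (q \<tau>) = ?x"
      have "ind X \<tau> \<noteq> 0 \<Longrightarrow> q \<tau> = q \<sigma>"
        using ind_nonzero_iff[OF sX \<tau>(1)] slice_rng[OF sX _ \<sigma>] \<tau>(2) by force
      then show "ind X \<tau> = conv (ind X) (chi K) \<tau>"
        using w[OF K(2) \<tau>(1)] K(3) by (cases "ind X \<tau> = 0") auto
    qed
    moreover have "row_eq ?x (conv (ind X) (chi K)) m"
    proof -
      have "conv (ind X) (chi K) \<sigma> \<noteq> 0" using w[OF K(2) a] K(3) ind_one[OF sX \<sigma>] by simp
      then have "?x \<in> Rg (conv (ind X) (chi K))"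
        using in_rng_image_supp_G[OF NN_AA[OF wN[OF K(2)]] a] by simp
      then show ?thesis using K(4) nle_iff[OF wN[OF K(2)] NN_AA[OF K(1)]] by blast
    qed
    ultimately show "m \<in> germ_filter (ind X) ?x"
      using K(1) row_eq_trans unfolding germ_filter_def by blast
  next
    fix m assume "m \<in> germ_filter (ind X) ?x"
    then have m: "m \<in> NN" "row_eq ?x (ind X) m" unfolding germ_filter_def by auto
    obtain K where K: "compact_open_units K" "?x \<in> K" "\<And>y. y \<in> K \<Longrightarrow> row_eq y (ind X) m"
      using row_eq_near[OF AA_ind[OF X] NN_AA[OF m(1)] G.rng_in_unit_space[OF q_closed[OF a]] m(2)]
      by metis
    define f where "f = conv (chi K) (ind X)"
    have f: "f \<in> AA" unfolding f_def using K X by simp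
    have f_eq: "f \<tau> = (if rng G (q \<tau>) \<in> K then ind X \<tau> else 0)" if "\<tau> \<in> arrows \<Sigma>" for \<tau>
      using K X that unfolding f_def by (simp add: conv_chi_left)
    \<comment> \<open>These are the sources of the arrows in the image of \<open>X\<close> with
      range in \<open>K\<close>. As the source set of the support of an element of
      \<open>AA\<close>, \<open>L\<close> is compact and open, and restricting \<open>ind X\<close>
      to sources in \<open>L\<close> leaves only ranges in \<open>K\<close>.\<close>
    define L where "L = src G ` supp_G q f"
    have L: "compact_open_units L" unfolding L_def using f by simp
    have "f \<sigma> \<noteq> 0" using f_eq[OF a] K ind_one[OF sX \<sigma>] by simp
    then have \<sigma>L: "src G (q \<sigma>) \<in> L" unfolding L_def using in_src_image_supp_G[OF f a] by simp
    have same: "q \<tau> = q \<rho> \<and> rng G (q \<tau>) \<in> K"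
      if h: "\<tau> \<in> arrows \<Sigma>" "\<rho> \<in> arrows \<Sigma>" "ind X \<tau> \<noteq> 0" "f \<rho> \<noteq> 0" "src G (q \<tau>) = src G (q \<rho>)" for \<tau> \<rho>
    proof -
      have "ind X \<rho> \<noteq> 0" "rng G (q \<rho>) \<in> K" using f_eq[OF h(2)] h(4) by (auto split: if_splits)
      then obtain \<tau>' \<rho>' where "\<tau>' \<in> X" "\<rho>' \<in> X" "q \<tau> = q \<tau>'" "q \<rho> = q \<rho>'"
        using ind_nonzero_iff[OF sX] h(1-3) by auto
      then show ?thesis using slice_src[OF sX] h(5) \<open>rng G (q \<rho>) \<in> K\<close> by metis
    qed
    have "nle Alg BB (conv (ind X) (chi L)) m"
      unfolding nle_iff[OF wN[OF L] NN_AA[OF m(1)]]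
    proof
      fix y assume "y \<in> Rg (conv (ind X) (chi L))"
      then obtain \<tau> where \<tau>: "\<tau> \<in> arrows \<Sigma>" "conv (ind X) (chi L) \<tau> \<noteq> 0" "rng G (q \<tau>) = y"
        using rng_image_supp_G_E[OF NN_AA[OF wN[OF L]]] by metis
      then have \<tau>': "ind X \<tau> \<noteq> 0" "src G (q \<tau>) \<in> L" using w[OF L \<tau>(1)] by (auto split: if_splits)
      then obtain \<rho> where "\<rho> \<in> arrows \<Sigma>" "f \<rho> \<noteq> 0" "src G (q \<tau>) = src G (q \<rho>)"
        unfolding L_def using f by (auto elim: supp_G_E[rotated])
      then have yK: "y \<in> K" using same \<tau> \<tau>' by blast
      have "row_eq y (conv (ind X) (chi L)) (ind X)"
        unfolding row_eq_def
      proof (intro ballI impI)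
        fix \<rho> assume \<rho>: "\<rho> \<in> arrows \<Sigma>" "rng G (q \<rho>) = y"
        have "src G (q \<rho>) \<in> L" if nz: "ind X \<rho> \<noteq> 0"
        proof -
          have "f \<rho> \<noteq> 0" using f_eq[OF \<rho>(1)] \<rho>(2) yK nz by simp
          then show ?thesis unfolding L_def using in_src_image_supp_G[OF f \<rho>(1)] by simp
        qed
        then show "conv (ind X) (chi L) \<rho> = ind X \<rho>" using w[OF L \<rho>(1)] by auto
      qed
      then show "row_eq y (conv (ind X) (chi L)) m" using K(3)[OF yK] row_eq_trans by blast
    qed
    then show "m \<in> Phi_via G \<Sigma> i q X \<sigma>" using mem m(1) L \<sigma>L by blast
  }
qed

lemma slice_through:
  assumes "\<sigma> \<in> arrows \<Sigma>"
  obtains X where "compact_slice X" "\<sigma> \<in> X"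
  using compact_slice_neighbourhood[OF openin_topspace assms] by metis

lemma Phi_eq:
  assumes \<sigma>: "\<sigma> \<in> arrows \<Sigma>"
  shows "Phi G \<Sigma> i q \<sigma> = point_filter \<sigma>"
proof -
  have "\<exists>X. compact_open_bisection \<Sigma> X \<and> \<sigma> \<in> X"
    using slice_through[OF \<sigma>] compact_slice_iff by metis
  from someI_ex[OF this] show ?thesis
    unfolding Phi_def compact_slice_iff using Phi_via_eq point_filter_eq_germ_filter by metis
qed

lemma Rg_ind: "compact_slice X \<Longrightarrow> \<sigma> \<in> X \<Longrightarrow> rng G (q \<sigma>) \<in> Rg (ind X)"
  by simp

lemma point_filter_ultrafilter:
  assumes "\<sigma> \<in> arrows \<Sigma>"
  shows "normaliser_ultrafilter Alg BB (point_filter \<sigma>)"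
  using slice_through[OF assms] point_filter_eq_germ_filter germ_filter_ultrafilter ind_NN Rg_ind
  by metis

end


context indecomposable_twist
begin

section \<open>The local bisection hypothesis and quasi-Cartan pairs\<close>

abbreviation "LBH \<equiv> local_bisection_hypothesis G \<Sigma> i q"

text \<open>Supports in \<open>G\<close> are always open, so being a bisection reduces to the two
  injectivity conditions.\<close>

lemma LBH_iff:
  "LBH \<longleftrightarrow> (\<forall>n \<in> NN. inj_on (rng G) (supp_G q n) \<and> inj_on (src G) (supp_G q n))"
  unfolding local_bisection_hypothesis_def
proof (intro ball_cong refl)
  fix n assume n: "n \<in> NN"
  show "bisection G (supp_G q n) \<longleftrightarrow> inj_on (rng G) (supp_G q n) \<and> inj_on (src G) (supp_G q n)"
  proof
    assume "bisection G (supp_G q n)"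
    then show "inj_on (rng G) (supp_G q n) \<and> inj_on (src G) (supp_G q n)"
      unfolding bisection_def using open_bisection_inj inj_on_subset by metis
  next
    assume "inj_on (rng G) (supp_G q n) \<and> inj_on (src G) (supp_G q n)"
    then have "open_bisection G (supp_G q n)"
      using openin_supp_G[OF NN_AA[OF n]] G.open_bisection_iff by simp
    then show "bisection G (supp_G q n)" unfolding bisection_def by blast
  qed
qed

lemma supp_G_inj_iff:
  assumes n: "n \<in> AA"
  shows "inj_on f (supp_G q n) \<longleftrightarrow> (\<forall>\<sigma> \<in> arrows \<Sigma>. \<forall>\<tau> \<in> arrows \<Sigma>.
    n \<sigma> \<noteq> 0 \<longrightarrow> n \<tau> \<noteq> 0 \<longrightarrow> f (q \<sigma>) = f (q \<tau>) \<longrightarrow> q \<sigma> = q \<tau>)"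
proof
  assume inj: "inj_on f (supp_G q n)"
  show "\<forall>\<sigma> \<in> arrows \<Sigma>. \<forall>\<tau> \<in> arrows \<Sigma>.
    n \<sigma> \<noteq> 0 \<longrightarrow> n \<tau> \<noteq> 0 \<longrightarrow> f (q \<sigma>) = f (q \<tau>) \<longrightarrow> q \<sigma> = q \<tau>"
    using inj_onD[OF inj] n by simp
next
  assume h: "\<forall>\<sigma> \<in> arrows \<Sigma>. \<forall>\<tau> \<in> arrows \<Sigma>.
    n \<sigma> \<noteq> 0 \<longrightarrow> n \<tau> \<noteq> 0 \<longrightarrow> f (q \<sigma>) = f (q \<tau>) \<longrightarrow> q \<sigma> = q \<tau>"
  show "inj_on f (supp_G q n)"
  proof (rule inj_onI)
    fix \<alpha> \<beta> assume \<alpha>\<beta>: "\<alpha> \<in> supp_G q n" "\<beta> \<in> supp_G q n" "f \<alpha> = f \<beta>"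
    obtain \<sigma> \<tau> where "\<sigma> \<in> arrows \<Sigma>" "n \<sigma> \<noteq> 0" "q \<sigma> = \<alpha>" "\<tau> \<in> arrows \<Sigma>" "n \<tau> \<noteq> 0" "q \<tau> = \<beta>"
      using supp_G_E[OF AA_equivariant[OF n] \<alpha>\<beta>(1)] supp_G_E[OF AA_equivariant[OF n] \<alpha>\<beta>(2)] by metis
    then show "\<alpha> = \<beta>" using h \<alpha>\<beta>(3) by blast
  qed
qed

lemma LBH_rng:
  "LBH \<Longrightarrow> n \<in> NN \<Longrightarrow> \<sigma> \<in> arrows \<Sigma> \<Longrightarrow> \<tau> \<in> arrows \<Sigma> \<Longrightarrow> n \<sigma> \<noteq> 0 \<Longrightarrow> n \<tau> \<noteq> 0 \<Longrightarrow>
    rng G (q \<sigma>) = rng G (q \<tau>) \<Longrightarrow> q \<sigma> = q \<tau>"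
  and LBH_src:
  "LBH \<Longrightarrow> n \<in> NN \<Longrightarrow> \<sigma> \<in> arrows \<Sigma> \<Longrightarrow> \<tau> \<in> arrows \<Sigma> \<Longrightarrow> n \<sigma> \<noteq> 0 \<Longrightarrow> n \<tau> \<noteq> 0 \<Longrightarrow>
    src G (q \<sigma>) = src G (q \<tau>) \<Longrightarrow> q \<sigma> = q \<tau>"
  unfolding LBH_iff using supp_G_inj_iff[of n] NN_AA by blast+

section \<open>Conditional expectations onto the diagonal\<close>

definition unit_part :: "('s \<Rightarrow> 'r) \<Rightarrow> 's \<Rightarrow> 'r" where
  "unit_part f \<sigma> = (if q \<sigma> \<in> unit_space G then f \<sigma> else 0)"

lemma unit_part_BB [simp]:
  assumes "f \<in> AA"
  shows "unit_part f \<in> BB"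
proof (rule BB_I)
  show A: "unit_part f \<in> AA"
    using AA_restrict[OF assms G.openin_unit_space G.closedin_unit_space] unfolding unit_part_def[abs_def] .
  have "q \<sigma> \<in> unit_space G" if "unit_part f \<sigma> \<noteq> 0" for \<sigma>
    using that unfolding unit_part_def by (auto split: if_splits)
  then show "diagonal (unit_part f)" unfolding diagonal_def using A by simp
qed

lemma unit_part_diagonal: "diagonal b \<Longrightarrow> unit_part b = b"
  unfolding unit_part_def[abs_def] using diagonalD by fastforce

text \<open>The part of \<open>f\<close> off the unit space is a combination of indicators of slices off the unit
  space, and such an indicator has expectation \<open>n e\<close>, which is supported off the unit space too.\<close>

lemma conditional_expectation_eq_unit_part:
  assumes P: "conditional_expectation Alg BB P" and impl: "implemented_by_idempotents Alg BB P"
    and f: "f \<in> AA"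
  shows "P f = unit_part f"
proof -
  have PBB: "P a \<in> BB" if "a \<in> AA" for a
    using P that unfolding conditional_expectation_def by auto
  have Padd: "P (a + b) = P a + P b" if "a \<in> AA" "b \<in> AA" for a b
    using P that unfolding conditional_expectation_def by simp
  have Pscale: "P (\<lambda>\<sigma>. c * a \<sigma>) = (\<lambda>\<sigma>. c * P a \<sigma>)" if "a \<in> AA" for a c
    using P that unfolding conditional_expectation_def by simp
  have Pid: "P b = b" if "b \<in> BB" for b
    using P that unfolding conditional_expectation_def by simp
  have P0: "P 0 = 0" using Pid BB_subspace unfolding M.subspace_def by blast
  define g where "g = f - unit_part f"
  have g: "g \<in> AA" unfolding g_def by (rule AA_diff[OF f BB_AA[OF unit_part_BB[OF f]]])
  \<comment> \<open>This set is open because the unit space of \<open>G\<close> is closed; hence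
    \<open>g\<close> can be decomposed without touching the unit space.\<close>
  let ?W = "{\<sigma> \<in> arrows \<Sigma>. q \<sigma> \<in> arrows G - unit_space G}"
  have W: "openin (gtop \<Sigma>) ?W"
    using G.closedin_unit_space by (intro openin_q_preimage openin_diff) auto
  have meet: "\<exists>\<sigma> \<in> ?W. q \<sigma> = \<alpha>" if \<alpha>: "\<alpha> \<in> supp_G q g" for \<alpha>
  proof -
    obtain \<sigma> where \<sigma>: "\<sigma> \<in> arrows \<Sigma>" "g \<sigma> \<noteq> 0" "q \<sigma> = \<alpha>"
      using supp_G_E[OF AA_equivariant[OF g] \<alpha>] by metis
    have "q \<sigma> \<notin> unit_space G" using \<sigma>(2) unfolding g_def unit_part_def by auto
    then show ?thesis using \<sigma> by (intro bexI[of _ \<sigma>]) auto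
  qed
  have P_ind: "P (ind X) = 0" if X: "compact_slice X" "X \<subseteq> ?W" for X
  proof -
    obtain e where "e \<in> idempotents Alg BB" "P (ind X) = conv (ind X) e"
      using impl ind_NN[OF X(1)] unfolding implemented_by_idempotents_def Alg_simps by blast
    then obtain K where K: "compact_open_units K" "P (ind X) = conv (ind X) (chi K)"
      unfolding idempotents_iff by blast
    have "P (ind X) \<sigma> = 0" for \<sigma>
    proof (rule ccontr)
      assume nz: "P (ind X) \<sigma> \<noteq> 0"
      have B: "P (ind X) \<in> BB" using X PBB by simp
      have \<sigma>: "\<sigma> \<in> arrows \<Sigma>" using equivariant_arrow[OF AA_equivariant[OF BB_AA[OF B]]] nz by blast
      have "q \<sigma> \<in> unit_space G" using diagonalD[OF BB_diagonal[OF B] nz] .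
      moreover have "ind X \<sigma> \<noteq> 0" using nz K X \<sigma> by (auto simp: conv_chi_right split: if_splits)
      then have "q \<sigma> \<in> q ` X" using ind_nonzero_iff[OF compact_sliceD[OF X(1)] \<sigma>] by simp
      ultimately show False using X(2) by auto
    qed
    then show ?thesis by (intro ext) (simp only: zero_fun_def)
  qed
  have "g \<in> M.span {ind X | X. compact_slice X \<and> X \<subseteq> ?W \<and> q ` X \<subseteq> supp_G q g}"
    by (rule AA_decompose[OF g W meet])
  then have "g \<in> AA \<and> P g = 0"
  proof (induction rule: M.span_induct_alt)
    case base
    then show ?case using P0 AA_zero by blast
  next
    case (step c x y)
    then obtain X where X: "x = ind X" "compact_slice X" "X \<subseteq> ?W" by blast
    have y: "y \<in> AA" "P y = 0" using step.IH by blast+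
    have x: "x \<in> AA" "(\<lambda>\<sigma>. c * x \<sigma>) \<in> AA" using X by simp_all
    have "P x = 0" using P_ind[OF X(2,3)] X(1) by blast
    then have "P ((\<lambda>\<sigma>. c * x \<sigma>) + y) = 0"
      unfolding Padd[OF x(2) y(1)] Pscale[OF x(1)] y(2) by (auto simp: fun_eq_iff)
    then show ?case using AA_add[OF x(2) y(1)] by blast
  qed
  moreover have "f = unit_part f + g" unfolding g_def by simp
  then have "P f = P (unit_part f) + P g" using Padd[OF BB_AA[OF unit_part_BB[OF f]] g] by metis
  ultimately show ?thesis using Pid[OF unit_part_BB[OF f]] by (simp add: fun_eq_iff)
qed

lemma quasi_Cartan_imp_LBH:
  assumes "algebraic_quasi_Cartan_pair Alg BB"
  shows LBH
proof -
  obtain P where P: "conditional_expectation Alg BB P" "implemented_by_idempotents Alg BB P"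
    using assms unfolding algebraic_quasi_Cartan_pair_def by (elim conjE exE)
  \<comment> \<open>The idempotent that implements the expectation is some \<open>chi K\<close>, and
    \<open>m u \<noteq> 0\<close> forces \<open>q u \<in> K\<close>. Restricting sources or ranges
    to \<open>K\<close> gives the same function, the restriction to units; so
    \<open>\<gamma>\<close>, with one endpoint at \<open>q u\<close>, survives it and must lie over
    a unit.\<close>
  have key: "q \<gamma> \<in> unit_space G"
    if m: "m \<in> NN" and u: "u \<in> unit_space \<Sigma>" "m u \<noteq> 0" and \<gamma>: "\<gamma> \<in> arrows \<Sigma>" "m \<gamma> \<noteq> 0"
      and uq: "src G (q \<gamma>) = q u \<or> rng G (q \<gamma>) = q u" for m u \<gamma>
  proof -
    obtain e where e: "e \<in> idempotents Alg BB" "P m = conv m e" "conv m e = conv e m"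
      using P(2) m unfolding implemented_by_idempotents_def Alg_simps by blast
    then obtain K where K: "compact_open_units K" "P m = conv m (chi K)" "conv m (chi K) = conv (chi K) m"
      unfolding idempotents_iff by blast
    have up: "unit_part m = conv m (chi K)" "unit_part m = conv (chi K) m"
      using conditional_expectation_eq_unit_part[OF P NN_AA[OF m]] K by simp_all
    have ua: "u \<in> arrows \<Sigma>" using u unit_space_arrow by simp
    have "m u = (if q u \<in> K then m u else 0)"
      using fun_cong[OF up(1), of u] u ua K(1) m by (simp add: unit_part_def conv_chi_right)
    then have uK: "q u \<in> K" using u by (auto split: if_splits)
    have "unit_part m \<gamma> = m \<gamma>"
      by (rule disjE[OF uq]) (use uK fun_cong[OF up(1), of \<gamma>] fun_cong[OF up(2), of \<gamma>] K(1) m \<gamma> in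
        \<open>simp_all add: conv_chi_right conv_chi_left\<close>)
    then show ?thesis using \<gamma>(2) unfolding unit_part_def by (auto split: if_splits)
  qed
  have inj: "q \<sigma> = q \<tau>"
    if n: "n \<in> NN" and \<sigma>: "\<sigma> \<in> arrows \<Sigma>" "n \<sigma> \<noteq> 0" and \<tau>: "\<tau> \<in> arrows \<Sigma>" "n \<tau> \<noteq> 0"
      and eq: "rng G (q \<sigma>) = rng G (q \<tau>) \<or> src G (q \<sigma>) = src G (q \<tau>)" for n \<sigma> \<tau>
  proof -
    obtain X where X: "compact_slice X" "\<sigma> \<in> X" using slice_through[OF \<sigma>(1)] .
    define Y where "Y = ginv \<Sigma> ` X"
    have Y: "compact_slice Y" "ginv \<Sigma> \<sigma> \<in> Y" unfolding Y_def using compact_slice_inv X by auto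
    note sY = compact_sliceD[OF Y(1)]
    from eq show ?thesis
    proof
      assume r: "rng G (q \<sigma>) = rng G (q \<tau>)"
      let ?m = "conv (ind Y) n"
      have v: "?m \<rho> = n (\<sigma> \<odot> \<rho>)" if "\<rho> \<in> arrows \<Sigma>" "rng G (q \<rho>) = src G (q \<sigma>)" for \<rho>
        using conv_ind_left[OF sY _ Y(2) that(1), of n] n \<sigma> that by simp
      have "q (ginv \<Sigma> \<sigma> \<odot> \<tau>) \<in> unit_space G"
        by (rule key[of ?m "src \<Sigma> \<sigma>"]) (use n Y \<sigma> \<tau> r v[of "src \<Sigma> \<sigma>"] v[of "ginv \<Sigma> \<sigma> \<odot> \<tau>"] in simp_all)
      then show ?thesis using G.inv_mult_in_unit_space[of "q \<sigma>" "q \<tau>"] \<sigma> \<tau> r by simp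
    next
      assume s: "src G (q \<sigma>) = src G (q \<tau>)"
      \<comment> \<open>For equal sources the translation acts on the right: it moves
        \<open>\<sigma>\<close> to its range and \<open>\<tau>\<close> to
        \<open>\<tau> \<odot> ginv \<Sigma> \<sigma>\<close>.\<close>
      let ?m = "conv n (ind Y)"
      have v: "?m \<rho> = n (\<rho> \<odot> \<sigma>)" if "\<rho> \<in> arrows \<Sigma>" "src G (q \<rho>) = rng G (q \<sigma>)" for \<rho>
        using conv_ind_right[OF sY _ Y(2) that(1), of n] n \<sigma> that by simp
      have "q (\<tau> \<odot> ginv \<Sigma> \<sigma>) \<in> unit_space G"
        by (rule key[of ?m "rng \<Sigma> \<sigma>"]) (use n Y \<sigma> \<tau> s v[of "rng \<Sigma> \<sigma>"] v[of "\<tau> \<odot> ginv \<Sigma> \<sigma>"] in simp_all)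
      then have "ginv G (q \<sigma>) = ginv G (q \<tau>)"
        using G.mult_in_unit_spaceD[of "q \<tau>" "ginv G (q \<sigma>)"] \<sigma> \<tau> s by simp
      then show ?thesis using \<sigma> \<tau> G.inv_inv by (metis q_closed)
    qed
  qed
  show ?thesis
    unfolding LBH_iff
  proof (intro ballI conjI)
    fix n assume n: "n \<in> NN"
    show "inj_on (rng G) (supp_G q n)" "inj_on (src G) (supp_G q n)"
      unfolding supp_G_inj_iff[OF NN_AA[OF n]] using inj[OF n] by blast+
  qed
qed

section \<open>Spanning by idempotents and by normalisers\<close>

lemma BB_eq_span: "BB = M.span (idempotents Alg BB)"
proof
  show "BB \<subseteq> M.span (idempotents Alg BB)"
  proof
    fix f assume f: "f \<in> BB"
    let ?T = "{ind X | X. compact_slice X \<and> X \<subseteq> unit_space \<Sigma> \<and> q ` X \<subseteq> supp_G q f}"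
    have meet: "\<exists>\<sigma>\<in>unit_space \<Sigma>. q \<sigma> = \<alpha>" if \<alpha>: "\<alpha> \<in> supp_G q f" for \<alpha>
    proof -
      have "\<alpha> \<in> unit_space G"
        using supp_G_E[OF AA_equivariant[OF BB_AA[OF f]] \<alpha>] diagonalD[OF BB_diagonal[OF f]] by metis
      then show ?thesis by (intro bexI[of _ "i (\<alpha>, 1)"]) auto
    qed
    have "f \<in> M.span ?T" by (rule AA_decompose[OF BB_AA[OF f] openin_unit_space_\<Sigma> meet])
    moreover have "?T \<subseteq> idempotents Alg BB"
    proof
      fix e assume "e \<in> ?T"
      then obtain X where X: "e = ind X" "compact_slice X" "X \<subseteq> unit_space \<Sigma>" by blast
      have "X = unit_lift (q ` X)"
        unfolding unit_lift_def image_image using X(3) unit_eq_i by (force simp: image_iff)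
      moreover have "compact_open_units (q ` X)"
        unfolding compact_open_units_def using compact_slice_q_image[OF X(2)] X(3) by auto
      ultimately show "e \<in> idempotents Alg BB" using X(1) idempotents_iff by metis
    qed
    ultimately show "f \<in> M.span (idempotents Alg BB)" using M.span_mono by blast
  qed
  show "M.span (idempotents Alg BB) \<subseteq> BB"
    by (rule M.span_minimal[OF _ BB_subspace]) (auto simp: idempotents_def)
qed

lemma AA_eq_span: "AA = M.span NN"
proof
  have "{ind X | X. compact_slice X} \<subseteq> NN" by auto
  then show "AA \<subseteq> M.span NN" by (subst AA_span) (rule M.span_mono)
  have "M.subspace AA" by (subst AA_span) (rule M.subspace_span)
  then show "M.span NN \<subseteq> AA" by (intro M.span_minimal) auto
qed

text \<open>The expectation is restriction to the unit space. The local bisection hypothesis enters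
  in showing that it is implemented by idempotents.\<close>

lemma LBH_imp_quasi_Cartan:
  assumes LBH
  shows "algebraic_quasi_Cartan_pair Alg BB"
proof -
  have scale: "t = 0" if e: "e \<in> idempotents Alg BB - {0}" and te: "ascale Alg t e = 0" for t e
  proof -
    obtain K where K: "compact_open_units K" "e = chi K" using e idempotents_iff by blast
    have "e \<noteq> 0" using e by blast
    then have "K \<noteq> {}"
      using K(2) ind_eq_0[of _ "unit_lift {}"] unfolding unit_lift_def
      by (metis empty_iff ext image_empty zero_fun_def)
    then obtain x where x: "x \<in> K" by blast
    then have xu: "x \<in> unit_space G" using compact_open_units_subset[OF K(1)] by blast
    then have "chi K (i (x, 1)) = 1" using x K by (simp add: chi_unit)
    then show "t = 0" using fun_cong[OF te, of "i (x, 1)"] K(2) by simp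
  qed
  have local_units: "idempotents_local_units Alg BB"
    unfolding idempotents_local_units_def
  proof (intro allI impI)
    fix F assume "finite F \<and> F \<subseteq> acarrier Alg"
    then obtain K where "compact_open_units K" "\<forall>f \<in> F. conv (chi K) f = f \<and> conv f (chi K) = f"
      using finite_local_unit[of F] by auto
    then show "\<exists>e\<in>idempotents Alg BB. \<forall>a\<in>F. e \<star>\<^bsub>Alg\<^esub> a = a \<and> a \<star>\<^bsub>Alg\<^esub> e = a"
      using idempotents_iff by auto
  qed
  have "conditional_expectation Alg BB unit_part"
    unfolding conditional_expectation_def
  proof (intro conjI ballI allI)
    show "unit_part \<in> acarrier Alg \<rightarrow> BB" by simp
    fix a assume "a \<in> acarrier Alg"
    then have a: "a \<in> AA" by simp
    show "unit_part (a + b) = unit_part a + unit_part b" for b by (auto simp: fun_eq_iff unit_part_def)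
    show "unit_part (ascale Alg t a) = ascale Alg t (unit_part a)" for t
      by (auto simp: fun_eq_iff unit_part_def)
    fix b b' assume b: "b \<in> BB" "b' \<in> BB"
    have val: "conv (conv b c) b' \<sigma> = b (rng \<Sigma> \<sigma>) * c \<sigma> * b' (src \<Sigma> \<sigma>)" if "c \<in> AA" "\<sigma> \<in> arrows \<Sigma>" for c \<sigma>
      using b that conv_diagonal_right[of b' "conv b c" \<sigma>] conv_diagonal_left[of b c \<sigma>] by simp
    have "unit_part (conv (conv b a) b') = conv (conv b (unit_part a)) b'"
    proof (rule equivariant_eqI)
      show "equivariant (unit_part (conv (conv b a) b'))" "equivariant (conv (conv b (unit_part a)) b')"
        using a b AA_equivariant[OF BB_AA[OF unit_part_BB]] by simp_all
      fix \<sigma> assume \<sigma>: "\<sigma> \<in> arrows \<Sigma>"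
      show "unit_part (conv (conv b a) b') \<sigma> = conv (conv b (unit_part a)) b' \<sigma>"
        using val[OF a \<sigma>] val[OF BB_AA[OF unit_part_BB[OF a]] \<sigma>] by (simp add: unit_part_def)
    qed
    then show "unit_part (b \<star>\<^bsub>Alg\<^esub> a \<star>\<^bsub>Alg\<^esub> b') = b \<star>\<^bsub>Alg\<^esub> unit_part a \<star>\<^bsub>Alg\<^esub> b'" by simp
  qed (simp add: unit_part_diagonal)
  moreover have "faithful Alg BB unit_part"
    unfolding faithful_def
  proof (intro ballI impI)
    fix a assume "a \<in> acarrier Alg" and nz: "a \<noteq> 0"
    then have a: "a \<in> AA" by simp
    obtain \<sigma> where "a \<sigma> \<noteq> 0" using nz by (metis ext zero_fun_def)
    then have \<sigma>: "\<sigma> \<in> arrows \<Sigma>" "a \<sigma> \<noteq> 0" using equivariant_arrow[OF AA_equivariant[OF a]] by auto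
    obtain X where X: "compact_slice X" "\<sigma> \<in> X" using slice_through[OF \<sigma>(1)] .
    have Y: "compact_slice (ginv \<Sigma> ` X)" "ginv \<Sigma> \<sigma> \<in> ginv \<Sigma> ` X" using compact_slice_inv X by auto
    \<comment> \<open>Faithfulness: translating by a slice through the inverse of
      \<open>\<sigma>\<close> carries the nonzero value \<open>a \<sigma>\<close> to the unit
      \<open>src \<Sigma> \<sigma>\<close>.\<close>
    have "conv (ind (ginv \<Sigma> ` X)) a (src \<Sigma> \<sigma>) = a \<sigma>"
      using conv_ind_left[OF compact_sliceD[OF Y(1)] _ Y(2), of a "src \<Sigma> \<sigma>"] a \<sigma> by simp
    then have "unit_part (conv (ind (ginv \<Sigma> ` X)) a) (src \<Sigma> \<sigma>) \<noteq> 0"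
      using \<sigma> by (simp add: unit_part_def)
    then have "unit_part (conv (ind (ginv \<Sigma> ` X)) a) \<noteq> 0" by (metis zero_fun_def)
    then show "\<exists>n\<in>NN. unit_part (n \<star>\<^bsub>Alg\<^esub> a) \<noteq> 0"
      using ind_NN[OF Y(1)] by (intro bexI[of _ "ind (ginv \<Sigma> ` X)"]) auto
  qed
  moreover have "implemented_by_idempotents Alg BB unit_part"
    unfolding implemented_by_idempotents_def
  proof
    fix n assume n: "n \<in> NN"
    \<comment> \<open>An arrow of the support whose source or range lies in \<open>K\<close> shares
      that endpoint with a unit of the support, hence by the bisection property it is that unit. So
      restricting on either side by \<open>chi K\<close> leaves exactly the part over units.\<close>
    define K where "K = supp_G q n \<inter> unit_space G"
    have K: "compact_open_units K"
      unfolding K_def compact_open_units_def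
      using openin_supp_G[OF NN_AA[OF n]] compact_supp_G[OF NN_AA[OF n]] G.openin_unit_space
        G.closedin_unit_space by (auto intro: compact_Int_closedin)
    have eq: "unit_part n \<sigma> = (if f (q \<sigma>) \<in> K then n \<sigma> else 0)"
      if \<sigma>: "\<sigma> \<in> arrows \<Sigma>" and f: "f = src G \<or> f = rng G" for \<sigma> f
    proof (cases "n \<sigma> = 0")
      case False
      have "q \<sigma> \<in> unit_space G \<longleftrightarrow> f (q \<sigma>) \<in> K"
      proof
        assume u: "q \<sigma> \<in> unit_space G"
        then have "f (q \<sigma>) = q \<sigma>" using f by auto
        then show "f (q \<sigma>) \<in> K" unfolding K_def using u False \<sigma> n by simp
      next
        assume k: "f (q \<sigma>) \<in> K"
        then obtain \<tau> where \<tau>: "\<tau> \<in> arrows \<Sigma>" "n \<tau> \<noteq> 0" "q \<tau> = f (q \<sigma>)"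
          unfolding K_def using supp_G_E[OF AA_equivariant[OF NN_AA[OF n]]] by blast
        have "f (q \<tau>) = f (q \<sigma>)" using \<tau>(3) f \<sigma> by auto
        then have "q \<tau> = q \<sigma>"
          using f LBH_src[OF assms n \<tau>(1) \<sigma> \<tau>(2) False] LBH_rng[OF assms n \<tau>(1) \<sigma> \<tau>(2) False] by auto
        then show "q \<sigma> \<in> unit_space G" using \<tau>(3) k unfolding K_def by auto
      qed
      then show ?thesis unfolding unit_part_def by simp
    qed (simp add: unit_part_def)
    have up: "equivariant (unit_part n)" by (rule AA_equivariant[OF BB_AA[OF unit_part_BB[OF NN_AA[OF n]]]])
    have "unit_part n = conv n (chi K)"
      by (rule equivariant_eqI[OF up]) (use n K eq[of _ "src G"] in \<open>simp_all add: conv_chi_right\<close>)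
    moreover have "unit_part n = conv (chi K) n"
      by (rule equivariant_eqI[OF up]) (use n K eq[of _ "rng G"] in \<open>simp_all add: conv_chi_left\<close>)
    ultimately show "\<exists>e\<in>idempotents Alg BB. unit_part n = n \<star>\<^bsub>Alg\<^esub> e \<and> n \<star>\<^bsub>Alg\<^esub> e = e \<star>\<^bsub>Alg\<^esub> n"
      using idempotents_iff K by (intro bexI[of _ "chi K"]) auto
  qed
  ultimately show ?thesis
    unfolding algebraic_quasi_Cartan_pair_def Alg_simps(1,3)
    using r_algebra_Alg comm_subalgebra_BB scale local_units BB_eq_span AA_eq_span
    by (simp only: Alg_simps(3)) blast
qed


section \<open>Surjectivity of \<open>\<Phi>\<close>\<close>

abbreviation "\<Sigma>' \<equiv> ultrafilter_groupoid Alg BB"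

lemma normaliser_ultrafilterD:
  assumes "normaliser_ultrafilter Alg BB U"
  shows "U \<subseteq> NN - {0}" "U \<noteq> {}"
    and "m \<in> U \<Longrightarrow> m' \<in> U \<Longrightarrow> \<exists>k\<in>U. nle Alg BB k m \<and> nle Alg BB k m'"
    and "normaliser_filter Alg BB V \<Longrightarrow> U \<subseteq> V \<Longrightarrow> V = U"
    and "normaliser_filter Alg BB U"
  using assms unfolding normaliser_ultrafilter_def normaliser_filter_def by (elim conjE; simp)+

lemma arrows_\<Sigma>': "arrows \<Sigma>' = {U. normaliser_ultrafilter Alg BB U}"
proof -
  have "\<exists>n\<in>NN. n \<in> U" if "normaliser_ultrafilter Alg BB U" for U
    using normaliser_ultrafilterD(1,2)[OF that] by blast
  then show ?thesis unfolding ultrafilter_groupoid_def by auto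
qed

lemma Phi_image: "Phi G \<Sigma> i q ` arrows \<Sigma> = point_filter ` arrows \<Sigma>"
  by (intro image_cong refl Phi_eq)

text \<open>At \<open>rng \<Sigma> \<sigma>\<close> the product \<open>conv n (dag n)\<close> has
  the value \<open>1\<close>. If the row lies over one arrow, this value is a single product with
  the factor \<open>n \<sigma>\<close>, which is therefore invertible.\<close>

lemma singleton_row_unit:
  assumes n: "n \<in> NN" and \<sigma>: "\<sigma> \<in> arrows \<Sigma>" "n \<sigma> \<noteq> 0"
    and single: "\<And>\<tau>. \<tau> \<in> arrows \<Sigma> \<Longrightarrow> n \<tau> \<noteq> 0 \<Longrightarrow> rng G (q \<tau>) = rng G (q \<sigma>) \<Longrightarrow> q \<tau> = q \<sigma>"
  shows "n \<sigma> \<in> ring_units"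
proof -
  have k: "dag n \<in> AA" using dag_NN[OF n] by simp
  have "conv n (dag n) (rng \<Sigma> \<sigma>) = n \<sigma> * dag n (ginv \<Sigma> \<sigma> \<odot> rng \<Sigma> \<sigma>)"
    by (rule conv_single) (use n k \<sigma> single in simp_all)
  moreover have "rng G (q \<sigma>) \<in> Rg n" using in_rng_image_supp_G[OF NN_AA[OF n] \<sigma>] .
  then have "conv n (dag n) (rng \<Sigma> \<sigma>) = 1"
    using ninv_conv_eq_chi[OF NN_AA[OF n] ninv_dag[OF n]] chi_unit[of "Rg n" "rng \<Sigma> \<sigma>"]
      Rg_unit_space[OF NN_AA[OF n]] \<sigma> by (simp del: image_subset_iff)
  ultimately show ?thesis using ring_unitsI by metis
qed

lemma nle_rows: "n \<in> NN \<Longrightarrow> m \<in> NN \<Longrightarrow> nle Alg BB n m \<Longrightarrow> x \<in> Rg n \<Longrightarrow> row_eq x n m \<and> x \<in> Rg m"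
  using nle_iff[of n m] row_eq_mem_Rg[of n m x] NN_AA by blast

lemma nle_trans:
  assumes "k \<in> NN" "n \<in> NN" "m \<in> NN" "nle Alg BB k n" "nle Alg BB n m"
  shows "nle Alg BB k m"
  using assms nle_rows[of k n] nle_rows[of n m] nle_iff[of k m] row_eq_trans NN_AA by meson

text \<open>The sets \<open>Rg m\<close> have the finite intersection property: finitely many
  elements have a lower bound in \<open>U\<close>, it is not zero, and each of its nonzero rows is a
  nonzero row of all of them. Compactness of one \<open>Rg n\<close> gives a common point.\<close>

lemma ultrafilter_base_point:
  assumes U: "normaliser_ultrafilter Alg BB U"
  obtains x where "\<And>n. n \<in> U \<Longrightarrow> x \<in> Rg n"
proof -
  have UN: "U \<subseteq> NN - {0}" "U \<noteq> {}"
    and dir: "\<And>m m'. m \<in> U \<Longrightarrow> m' \<in> U \<Longrightarrow> \<exists>k\<in>U. nle Alg BB k m \<and> nle Alg BB k m'"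
    using normaliser_ultrafilterD(1-3)[OF U] by simp_all
  obtain n where n: "n \<in> U" using UN by blast
  have nN: "m \<in> NN" if "m \<in> U" for m using that UN by blast
  have lower: "\<exists>k\<in>U. \<forall>m\<in>F. nle Alg BB k m" if "finite F" "F \<subseteq> U" for F
    using that
  proof (induction F rule: finite_induct)
    case empty
    then show ?case using n by blast
  next
    case (insert m F)
    then obtain k where k: "k \<in> U" "\<forall>m\<in>F. nle Alg BB k m" by auto
    obtain l where l: "l \<in> U" "nle Alg BB l k" "nle Alg BB l m" using dir[of k m] k insert.prems by auto
    have "nle Alg BB l m'" if "m' \<in> F" for m'
      using nle_trans[OF nN[OF l(1)] nN[OF k(1)] _ l(2)] k(2) that nN insert.prems by blast
    then show ?case using l by blast
  qed
  have "\<exists>x \<in> Rg n. \<forall>m \<in> U. x \<in> Rg m"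
  proof (rule ccontr)
    assume none: "\<not> (\<exists>x \<in> Rg n. \<forall>m \<in> U. x \<in> Rg m)"
    have co: "compact_open_units (Rg m)" if "m \<in> U" for m using nN[OF that] by simp
    have RA: "Rg n \<subseteq> arrows G" using co[OF n] openin_subset unfolding compact_open_units_def by blast
    have "openin (gtop G) V" if "V \<in> (\<lambda>m. arrows G - Rg m) ` U" for V
      using that co unfolding compact_open_units_def by (auto intro!: G.openin_diff_compact)
    moreover have "Rg n \<subseteq> \<Union>((\<lambda>m. arrows G - Rg m) ` U)"
    proof
      fix x assume x: "x \<in> Rg n"
      then obtain m where "m \<in> U" "x \<notin> Rg m" using none by blast
      then show "x \<in> \<Union>((\<lambda>m. arrows G - Rg m) ` U)" using x RA by blast
    qed
    moreover have "compactin (gtop G) (Rg n)" using co[OF n] unfolding compact_open_units_def by simp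
    ultimately obtain \<F> where \<F>: "finite \<F>" "\<F> \<subseteq> (\<lambda>m. arrows G - Rg m) ` U" "Rg n \<subseteq> \<Union>\<F>"
      using compactinD[of "gtop G" "Rg n" "(\<lambda>m. arrows G - Rg m) ` U"] by metis
    obtain F where F: "F \<subseteq> U" "finite F" "\<F> = (\<lambda>m. arrows G - Rg m) ` F"
      using finite_subset_image[OF \<F>(1,2)] by blast
    obtain k where k: "k \<in> U" "\<forall>m\<in>insert n F. nle Alg BB k m"
      using lower[of "insert n F"] F n by auto
    have kN: "k \<in> NN" "k \<noteq> 0" using k(1) UN by auto
    obtain y where y: "y \<in> Rg k" using nonzero_Rg[OF NN_AA[OF kN(1)] kN(2)] by blast
    have yR: "y \<in> Rg m" if "m \<in> insert n F" for m
      using nle_rows[OF kN(1) nN _ y, of m] k(2) that n F(1) by blast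
    then have "y \<in> \<Union>\<F>" using \<F>(3) by (meson insertI1 subsetD)
    then obtain m where "m \<in> F" "y \<notin> Rg m" unfolding F(3) by (elim UnionE imageE) simp
    then show False using yR by blast
  qed
  then show ?thesis using that by blast
qed

lemma LBH_imp_surj:
  assumes LBH
  shows "arrows \<Sigma>' \<subseteq> point_filter ` arrows \<Sigma>"
proof
  fix U assume "U \<in> arrows \<Sigma>'"
  then have U: "normaliser_ultrafilter Alg BB U" unfolding arrows_\<Sigma>' by simp
  have UN: "U \<subseteq> NN - {0}" "U \<noteq> {}"
    and dir: "\<And>m m'. m \<in> U \<Longrightarrow> m' \<in> U \<Longrightarrow> \<exists>k\<in>U. nle Alg BB k m \<and> nle Alg BB k m'"
    using normaliser_ultrafilterD(1-3)[OF U] by simp_all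
  obtain x where x: "\<And>n. n \<in> U \<Longrightarrow> x \<in> Rg n" using ultrafilter_base_point[OF U] by blast
  obtain n where n: "n \<in> U" using UN by blast
  have nN: "m \<in> NN" if "m \<in> U" for m using that UN by blast
  obtain \<sigma>0 where \<sigma>0: "\<sigma>0 \<in> arrows \<Sigma>" "n \<sigma>0 \<noteq> 0" "rng G (q \<sigma>0) = x"
    using rng_image_supp_G_E[OF NN_AA[OF nN[OF n]] x[OF n]] .
  have t: "n \<sigma>0 \<in> ring_units"
    by (rule singleton_row_unit[OF nN[OF n] \<sigma>0(1,2)]) (use LBH_rng[OF assms nN[OF n] _ \<sigma>0(1)] \<sigma>0(2) in blast)
  \<comment> \<open>By equivariance, acting with the unit \<open>n \<sigma>0\<close> divides the
    value by itself, so \<open>n\<close> takes the value \<open>1\<close> at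
    \<open>\<sigma>\<close>.\<close>
  define \<sigma> where "\<sigma> = act (n \<sigma>0) \<sigma>0"
  have \<sigma>: "\<sigma> \<in> arrows \<Sigma>" "q \<sigma> = q \<sigma>0" unfolding \<sigma>_def using \<sigma>0 t by simp_all
  have n1: "n \<sigma> = 1" unfolding \<sigma>_def using \<sigma>0 t nN[OF n] by (simp add: equivariant_act)
  have "m \<in> point_filter \<sigma>" if m: "m \<in> U" for m
  proof -
    obtain k where k: "k \<in> U" "nle Alg BB k n" "nle Alg BB k m" using dir[OF n m] by blast
    have "row_eq x k n" "row_eq x k m"
      using nle_rows[OF nN[OF k(1)] nN[OF n] k(2) x[OF k(1)]]
        nle_rows[OF nN[OF k(1)] nN[OF m] k(3) x[OF k(1)]] by blast+
    then have r: "row_eq x n m" using row_eq_sym row_eq_trans by blast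
    have "m \<sigma> = 1" using row_eqD[OF r \<sigma>(1)] \<sigma> \<sigma>0(3) n1 by simp
    moreover have "m \<tau> = 0" if \<tau>: "\<tau> \<in> arrows \<Sigma>" "rng G (q \<tau>) = rng G (q \<sigma>)" "q \<tau> \<noteq> q \<sigma>" for \<tau>
    proof -
      have "n \<tau> = 0" using LBH_rng[OF assms nN[OF n] \<tau>(1) \<sigma>(1)] \<tau> n1 by auto
      then show ?thesis using row_eqD[OF r \<tau>(1)] \<tau>(2) \<sigma>(2) \<sigma>0(3) by simp
    qed
    ultimately show ?thesis unfolding point_filter_def using nN[OF m] by simp
  qed
  \<comment> \<open>\<open>U\<close> is maximal and contained in the filter on the left.\<close>
  then have "point_filter \<sigma> = U"
    using normaliser_ultrafilterD(4)[OF U normaliser_ultrafilterD(5)[OF point_filter_ultrafilter[OF \<sigma>(1)]]]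
    by blast
  then show "U \<in> point_filter ` arrows \<Sigma>" using \<sigma>(1) by blast
qed

lemma surj_imp_LBH:
  assumes surj: "arrows \<Sigma>' \<subseteq> point_filter ` arrows \<Sigma>"
  shows LBH
proof -
  have rinj: "q \<sigma> = q \<tau>"
    if n: "n \<in> NN" and \<sigma>: "\<sigma> \<in> arrows \<Sigma>" "n \<sigma> \<noteq> 0" and \<tau>: "\<tau> \<in> arrows \<Sigma>" "n \<tau> \<noteq> 0"
      and eq: "rng G (q \<sigma>) = rng G (q \<tau>)" for n \<sigma> \<tau>
  proof -
    let ?x = "rng G (q \<sigma>)"
    have x: "?x \<in> Rg n" using in_rng_image_supp_G[OF NN_AA[OF n] \<sigma>] .
    have "germ_filter n ?x \<in> arrows \<Sigma>'" unfolding arrows_\<Sigma>' using germ_filter_ultrafilter[OF n x] by simp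
    then obtain \<rho> where \<rho>: "\<rho> \<in> arrows \<Sigma>" "germ_filter n ?x = point_filter \<rho>" using surj by blast
    obtain X where X: "compact_slice X" "\<rho> \<in> X" using slice_through[OF \<rho>(1)] .
    have "germ_filter n ?x = germ_filter (ind X) (rng G (q \<rho>))"
      using \<rho>(2) point_filter_eq_germ_filter[OF X] by simp
    \<comment> \<open>Equality of filters does not say at once that \<open>\<rho>\<close> has the
      right range; it follows since a germ filter determines its base point.\<close>
    then have xr: "?x = rng G (q \<rho>)"
      using germ_filter_base_eq[OF n x ind_NN[OF X(1)] Rg_ind[OF X]] by simp
    have "n \<in> germ_filter n ?x" unfolding germ_filter_def using n by simp
    then have "n \<in> point_filter \<rho>" using \<rho>(2) by simp
    then have "q \<tau>' = q \<rho>" if "\<tau>' \<in> arrows \<Sigma>" "n \<tau>' \<noteq> 0" "rng G (q \<tau>') = rng G (q \<rho>)" for \<tau>'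
      using that unfolding point_filter_def by blast
    then show ?thesis using \<sigma> \<tau> eq xr by metis
  qed
  have sinj: "q \<sigma> = q \<tau>"
    if n: "n \<in> NN" and \<sigma>: "\<sigma> \<in> arrows \<Sigma>" "n \<sigma> \<noteq> 0" and \<tau>: "\<tau> \<in> arrows \<Sigma>" "n \<tau> \<noteq> 0"
      and eq: "src G (q \<sigma>) = src G (q \<tau>)" for n \<sigma> \<tau>
  proof -
    define k where "k = dag n"
    have k: "k \<in> NN" "ninv n k" unfolding k_def using dag_NN[OF n] ninv_dag[OF n] by auto
    have B: "conv n k \<in> BB" "conv k n \<in> BB" using ninv_conv_BB[OF NN_AA[OF n] k(2)] by blast+
    have "n \<sigma> = conv n (conv k n) \<sigma>"
      using k n unfolding ninv_iff by (simp add: conv_assoc)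
    also have "\<dots> = n \<sigma> * conv k n (src \<Sigma> \<sigma>)" using B n \<sigma> by (simp add: conv_diagonal_right)
    finally have "conv k n (src \<Sigma> \<sigma>) \<noteq> 0" using \<sigma> by auto
    then obtain \<gamma> where \<gamma>: "\<gamma> \<in> arrows \<Sigma>" "rng G (q \<gamma>) = src G (q \<sigma>)" "k \<gamma> \<noteq> 0"
      using conv_nonzeroE[OF AA_equivariant[OF NN_AA[OF k(1)]], of n "src \<Sigma> \<sigma>"] \<sigma>(1) by auto
    \<comment> \<open>Injectivity on ranges leaves one term in \<open>conv n k\<close> at
      \<open>\<rho> \<odot> \<gamma>\<close>, and \<open>n \<rho>\<close> is a unit, so the value is
      nonzero. But \<open>conv n k\<close> lives over units, so \<open>\<gamma>\<close> lies over
      the inverse of \<open>q \<rho>\<close>. Both \<open>\<sigma>\<close> and \<open>\<tau>\<close>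
      can play the part of \<open>\<rho>\<close>.\<close>
    have "q \<gamma> = ginv G (q \<rho>)" if \<rho>: "\<rho> \<in> arrows \<Sigma>" "n \<rho> \<noteq> 0" "src G (q \<rho>) = rng G (q \<gamma>)" for \<rho>
    proof -
      have "conv n k (\<rho> \<odot> \<gamma>) = n \<rho> * k (ginv \<Sigma> \<rho> \<odot> (\<rho> \<odot> \<gamma>))"
      proof (rule conv_single)
        fix \<rho>' assume "\<rho>' \<in> arrows \<Sigma>" "rng G (q \<rho>') = rng G (q (\<rho> \<odot> \<gamma>))" "n \<rho>' \<noteq> 0"
        then show "q \<rho>' = q \<rho>" using rinj[OF n _ _ \<rho>(1,2)] \<rho> \<gamma>(1) by simp
      qed (use n k \<rho> \<gamma> in simp_all)
      also have "\<dots> = n \<rho> * k \<gamma>" using \<rho> \<gamma> by simp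
      also have "\<dots> \<noteq> 0"
        using singleton_row_unit[OF n \<rho>(1,2)] rinj[OF n _ _ \<rho>(1,2)] \<gamma>(3)
        by (simp add: unit_mult_eq_0_iff)
      finally have "q (\<rho> \<odot> \<gamma>) \<in> unit_space G" using diagonalD[OF BB_diagonal[OF B(1)]] by blast
      then show ?thesis using \<rho> \<gamma> by (intro G.mult_in_unit_spaceD) simp_all
    qed
    then have "ginv G (q \<sigma>) = ginv G (q \<tau>)" using \<sigma> \<tau> \<gamma> eq by metis
    then show ?thesis using G.inv_inv q_closed \<sigma> \<tau> by metis
  qed
  show ?thesis
    unfolding LBH_iff
  proof (intro ballI conjI)
    fix n assume n: "n \<in> NN"
    show "inj_on (rng G) (supp_G q n)" "inj_on (src G) (supp_G q n)"
      unfolding supp_G_inj_iff[OF NN_AA[OF n]] using rinj[OF n] sinj[OF n] by blast+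
  qed
qed


section \<open>\<open>\<Phi>\<close> as an isomorphism\<close>

lemma point_filter_row:
  "m \<in> point_filter \<sigma> \<Longrightarrow> \<tau> \<in> arrows \<Sigma> \<Longrightarrow> rng G (q \<tau>) = rng G (q \<sigma>) \<Longrightarrow> m \<tau> \<noteq> 0 \<Longrightarrow> q \<tau> = q \<sigma>"
  and point_filter_value: "m \<in> point_filter \<sigma> \<Longrightarrow> m \<sigma> = 1"
  and point_filter_NN: "m \<in> point_filter \<sigma> \<Longrightarrow> m \<in> NN"
  unfolding point_filter_def by blast+

lemma ind_point_filter: "compact_slice X \<Longrightarrow> \<sigma> \<in> X \<Longrightarrow> ind X \<in> point_filter \<sigma>"
  by (simp add: point_filter_eq_germ_filter germ_filter_def)

text \<open>The vanishing condition is automatic when each nonzero row lies over one arrow. The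
  single condition \<open>m \<sigma> = 1\<close> makes membership easy to verify for products and
  open in \<open>\<sigma>\<close>.\<close>

lemma point_filter_LBH:
  assumes LBH "\<sigma> \<in> arrows \<Sigma>"
  shows "m \<in> point_filter \<sigma> \<longleftrightarrow> m \<in> NN \<and> m \<sigma> = 1"
proof
  assume m: "m \<in> NN \<and> m \<sigma> = 1"
  then have "m \<tau> \<noteq> 0 \<Longrightarrow> q \<tau> = q \<sigma>" if "\<tau> \<in> arrows \<Sigma>" "rng G (q \<tau>) = rng G (q \<sigma>)" for \<tau>
    using LBH_rng[OF assms(1), of m \<tau> \<sigma>] assms(2) that by simp
  then show "m \<in> point_filter \<sigma>" unfolding point_filter_def using m by blast
qed (auto simp: point_filter_def)

lemma conv_point_filter:
  assumes "composable \<Sigma> a b" "m \<in> point_filter a" "n \<in> point_filter b"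
  shows "conv m n (a \<odot> b) = 1"
proof -
  have ab: "a \<in> arrows \<Sigma>" "b \<in> arrows \<Sigma>" "src G (q a) = rng G (q b)"
    using assms(1) composable_iff[of a b] by auto
  note N = point_filter_NN[OF assms(2)] point_filter_NN[OF assms(3)]
  have "conv m n (a \<odot> b) = m a * n (ginv \<Sigma> a \<odot> (a \<odot> b))"
  proof (rule conv_single)
    fix \<rho> assume "\<rho> \<in> arrows \<Sigma>" "rng G (q \<rho>) = rng G (q (a \<odot> b))" "m \<rho> \<noteq> 0"
    then show "q \<rho> = q a" using point_filter_row[OF assms(2)] ab by simp
  qed (use ab N in simp_all)
  then show ?thesis
    using ab point_filter_value[OF assms(2)] point_filter_value[OF assms(3)] by simp
qed

text \<open>If the source of \<open>a\<close> and the range of \<open>b\<close> differ, disjoint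
  compact open neighbourhoods of these units cut the indicators of slices down to elements of the
  two filters whose product is zero.\<close>

lemma composable_point_filter:
  assumes a: "a \<in> arrows \<Sigma>" and b: "b \<in> arrows \<Sigma>" and LBH
    and nz: "\<And>m n. m \<in> point_filter a \<Longrightarrow> n \<in> point_filter b \<Longrightarrow> conv m n \<noteq> 0"
  shows "composable \<Sigma> a b"
proof (rule ccontr)
  assume "\<not> composable \<Sigma> a b"
  then have ne: "src G (q a) \<noteq> rng G (q b)" using a b composable_iff by simp
  obtain X Y where X: "compact_slice X" "a \<in> X" and Y: "compact_slice Y" "b \<in> Y"
    using slice_through a b by metis
  have "compactin (gtop G) {rng G (q b)}" using b by simp
  then have "openin (gtop G) (arrows G - {rng G (q b)})" by (intro G.openin_diff_compact) auto
  then obtain K where K: "compact_open_units K" "src G (q a) \<in> K" "K \<subseteq> arrows G - {rng G (q b)}"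
    by (rule unit_neighbourhood[of "arrows G - {rng G (q b)}" "src G (q a)"]) (use ne a b in auto)
  \<comment> \<open>Compact sets are closed in the Hausdorff \<open>G\<close>, so the second
    neighbourhood can be taken in the complement of the first.\<close>
  have "openin (gtop G) (arrows G - K)"
    using K(1) unfolding compact_open_units_def by (intro G.openin_diff_compact) auto
  moreover have "rng G (q b) \<in> arrows G - K" using K(3) b by auto
  ultimately obtain L where L: "compact_open_units L" "rng G (q b) \<in> L" "L \<subseteq> arrows G - K"
    by (rule unit_neighbourhood) (use b in simp)
  let ?m = "conv (ind X) (chi K)" and ?n = "conv (chi L) (ind Y)"
  have "?m \<in> point_filter a" "?n \<in> point_filter b"
    using K L X Y a b ind_one[of X a] ind_one[of Y b]
    by (simp_all add: point_filter_LBH[OF \<open>LBH\<close>] conv_chi_right conv_chi_left)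
  then have "conv ?m ?n \<noteq> 0" by (rule nz)
  moreover have "conv (chi K) ?n = 0"
  proof (rule equivariant_eqI[OF _ equivariant_zero])
    fix \<sigma> assume "\<sigma> \<in> arrows \<Sigma>"
    then show "conv (chi K) ?n \<sigma> = 0 \<sigma>" using K L Y by (auto simp: conv_chi_left)
  qed (use K L Y in simp)
  then have "conv ?m ?n = 0"
    using K L X Y conv_assoc[of "ind X" "chi K" ?n] conv_zero_right[of "ind X"] by simp
  ultimately show False by contradiction
qed

text \<open>A product of members has the value \<open>1\<close> at \<open>a \<odot> b\<close>, and
  so has everything above it. Conversely, a member \<open>p\<close> agrees near the range of
  \<open>a \<odot> b\<close> with a product of indicators of slices, and shrinking the first factor
  makes the product smaller than \<open>p\<close>.\<close>

lemma mult_point_filter: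
  assumes LBH and ab: "composable \<Sigma> a b"
  shows "up_closure Alg BB {conv m n | m n. m \<in> point_filter a \<and> n \<in> point_filter b} = point_filter (a \<odot> b)"
    (is "?U = _")
proof (intro equalityI subsetI)
  have arr: "a \<in> arrows \<Sigma>" "b \<in> arrows \<Sigma>" "a \<odot> b \<in> arrows \<Sigma>" using composable_closed[OF ab] by auto
  {
    fix p assume "p \<in> ?U"
    then obtain m n where mn: "p \<in> NN" "m \<in> point_filter a" "n \<in> point_filter b" "nle Alg BB (conv m n) p"
      unfolding up_closure_def by blast
    have w: "conv m n \<in> NN" "conv m n (a \<odot> b) = 1"
      using point_filter_NN mn(2,3) conv_point_filter[OF ab mn(2,3)] by auto
    then have "rng G (q (a \<odot> b)) \<in> Rg (conv m n)"
      using in_rng_image_supp_G[OF NN_AA[OF w(1)] arr(3)] by simp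
    then have "row_eq (rng G (q (a \<odot> b))) (conv m n) p" using nle_rows[OF w(1) mn(1,4)] by blast
    then have "p (a \<odot> b) = 1" using row_eqD[OF _ arr(3) refl] w(2) by metis
    then show "p \<in> point_filter (a \<odot> b)" using point_filter_LBH[OF assms(1) arr(3)] mn(1) by blast
  next
    fix p assume p: "p \<in> point_filter (a \<odot> b)"
    obtain X Y Z where X: "compact_slice X" "a \<in> X" and Y: "compact_slice Y" "b \<in> Y"
      and Z: "compact_slice Z" "a \<odot> b \<in> Z"
      using slice_through arr by metis
    let ?m = "ind X" and ?n = "ind Y" and ?x = "rng G (q (a \<odot> b))"
    let ?w = "conv ?m ?n"
    have mn: "?m \<in> point_filter a" "?n \<in> point_filter b" using ind_point_filter X Y by auto
    have wN: "?w \<in> NN" using X Y by simp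
    have w: "?w \<in> point_filter (a \<odot> b)"
      using point_filter_LBH[OF assms(1) arr(3)] wN conv_point_filter[OF ab mn] by blast
    have pN: "p \<in> NN" using point_filter_NN[OF p] .
    have "row_eq ?x ?w p"
      using w p unfolding point_filter_eq_germ_filter[OF Z] germ_filter_def
      using row_eq_sym row_eq_trans by blast
    moreover have "?x \<in> unit_space G" using arr by (intro G.rng_in_unit_space q_closed)
    ultimately obtain K where K: "compact_open_units K" "?x \<in> K" "\<And>y. y \<in> K \<Longrightarrow> row_eq y ?w p"
      using row_eq_near[OF NN_AA[OF wN] NN_AA[OF pN]] by metis
    \<comment> \<open>Cutting the left factor by ranges cuts the whole product by ranges, since the
      indicator of \<open>K\<close> stands on the far left.\<close>
    let ?m' = "conv (chi K) ?m"
    have "src G (q a) = rng G (q b)" using ab arr composable_iff[of a b] by simp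
    then have "?x = rng G (q a)" using arr by simp
    then have "?m' \<in> point_filter a"
      using point_filter_LBH[OF assms(1) arr(1)] K X ind_one[of X a] arr(1) by (simp add: conv_chi_left)
    moreover have e: "conv ?m' ?n = conv (chi K) ?w" using K X Y by (simp add: conv_assoc)
    have "nle Alg BB (conv (chi K) ?w) p"
    proof (subst nle_iff)
      show "conv (chi K) ?w \<in> NN" using K wN by simp
      show "\<forall>y\<in>Rg (conv (chi K) ?w). row_eq y (conv (chi K) ?w) p"
        using Rg_chi[OF K(1) NN_AA[OF wN]] row_eq_chi[OF K(1) NN_AA[OF wN]] K(3) row_eq_trans by blast
    qed (use pN in simp)
    ultimately have "conv ?m' ?n \<in> {conv m n | m n. m \<in> point_filter a \<and> n \<in> point_filter b}"
      "nle Alg BB (conv ?m' ?n) p"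
      using mn(2) by (blast, simp only: e)
    then show "p \<in> ?U" unfolding up_closure_def using pN by blast
  }
qed

text \<open>Equal filters have the same base point, so \<open>a\<close> and \<open>b\<close> have
  equal range. The indicator of a slice through \<open>a\<close> then has the value \<open>1\<close>
  at \<open>b\<close> too, which puts \<open>b\<close> into the same slice.\<close>

lemma inj_point_filter: "inj_on point_filter (arrows \<Sigma>)"
proof (rule inj_onI)
  fix a b assume a: "a \<in> arrows \<Sigma>" and b: "b \<in> arrows \<Sigma>" and eq: "point_filter a = point_filter b"
  obtain X Y where X: "compact_slice X" "a \<in> X" and Y: "compact_slice Y" "b \<in> Y"
    using slice_through a b by metis
  have "rng G (q a) = rng G (q b)"
    using germ_filter_base_eq[OF ind_NN[OF X(1)] Rg_ind[OF X] ind_NN[OF Y(1)] Rg_ind[OF Y]] eq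
      point_filter_eq_germ_filter[OF X] point_filter_eq_germ_filter[OF Y] by simp
  moreover have "ind X b = 1" using point_filter_value ind_point_filter[OF X] eq by simp
  then have "b \<in> X" using ind_eq_1_iff X b by simp
  ultimately show "a = b" using slice_rng[OF compact_sliceD[OF X(1)] X(2)] by simp
qed

lemma surj_imp_iso:
  assumes surj: "arrows \<Sigma>' \<subseteq> point_filter ` arrows \<Sigma>"
  shows "topological_groupoid_iso \<Sigma> \<Sigma>' (Phi G \<Sigma> i q)"
proof -
  let ?\<Phi> = "Phi G \<Sigma> i q"
  note LBH = surj_imp_LBH[OF surj]
  have \<Phi>: "?\<Phi> \<sigma> = point_filter \<sigma>" if "\<sigma> \<in> arrows \<Sigma>" for \<sigma> using Phi_eq[OF that] .
  have image: "?\<Phi> ` arrows \<Sigma> = arrows \<Sigma>'"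
    using surj point_filter_ultrafilter unfolding Phi_image arrows_\<Sigma>' by blast
  let ?V = "\<lambda>n. {U. normaliser_ultrafilter Alg BB U \<and> n \<in> U}"
  have top: "gtop \<Sigma>' = topology_generated_by (?V ` NN)" unfolding ultrafilter_groupoid_def by simp
  have "homeomorphic_map (gtop \<Sigma>) (gtop \<Sigma>') ?\<Phi>"
  proof (rule bijective_open_imp_homeomorphic_map)
    show "continuous_map (gtop \<Sigma>) (gtop \<Sigma>') ?\<Phi>"
      unfolding top
    proof (rule continuous_on_generated_topo)
      fix W assume "W \<in> ?V ` NN"
      then obtain n where n: "n \<in> NN" "W = ?V n" by blast
      \<comment> \<open>The preimage of a basic open set is a level set of a locally constant
        function.\<close>
      have "?\<Phi> -` W \<inter> arrows \<Sigma> = {\<sigma> \<in> arrows \<Sigma>. n \<sigma> \<in> {1}}"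
        using n \<Phi> point_filter_LBH[OF LBH] point_filter_ultrafilter by auto
      then show "openin (gtop \<Sigma>) (?\<Phi> -` W \<inter> arrows \<Sigma>)"
        using openin_AA_preimage[OF NN_AA[OF n(1)], of "{1}"] by simp
    next
      show "?\<Phi> ` arrows \<Sigma> \<subseteq> \<Union>(?V ` NN)" using image unfolding top by simp
    qed
    show "open_map (gtop \<Sigma>) (gtop \<Sigma>') ?\<Phi>"
      unfolding open_map_def
    proof (intro allI impI)
      fix W assume W: "openin (gtop \<Sigma>) W"
      show "openin (gtop \<Sigma>') (?\<Phi> ` W)"
      proof (subst openin_subopen, intro ballI)
        fix U assume "U \<in> ?\<Phi> ` W"
        then obtain \<sigma> where \<sigma>: "\<sigma> \<in> W" "U = ?\<Phi> \<sigma>" by blast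
        have a: "\<sigma> \<in> arrows \<Sigma>" using \<sigma> openin_subset[OF W] by blast
        obtain X where X: "compact_slice X" "\<sigma> \<in> X" "X \<subseteq> W"
          using compact_slice_neighbourhood[OF W \<sigma>(1)] by metis
        have "openin (gtop \<Sigma>') (?V (ind X))"
          unfolding top using X by (intro topology_generated_by_Basis) simp
        moreover have "U \<in> ?V (ind X)"
          using \<sigma> \<Phi>[OF a] point_filter_ultrafilter[OF a] ind_point_filter[OF X(1,2)] by simp
        \<comment> \<open>By surjectivity a member of the basic set is some
          \<open>point_filter \<tau>\<close>, and the value \<open>1\<close> of \<open>ind X\<close>
          at \<open>\<tau>\<close> puts \<open>\<tau>\<close> into \<open>X\<close>. Thus images of
          small slices are neighbourhoods.\<close>
        moreover have "?V (ind X) \<subseteq> ?\<Phi> ` W"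
        proof
          fix U' assume U': "U' \<in> ?V (ind X)"
          then obtain \<tau> where \<tau>: "\<tau> \<in> arrows \<Sigma>" "U' = point_filter \<tau>" using surj unfolding arrows_\<Sigma>' by blast
          then have "ind X \<tau> = 1" using U' point_filter_value by simp
          then have "\<tau> \<in> X" using ind_eq_1_iff X(1) \<tau> by simp
          then show "U' \<in> ?\<Phi> ` W" using \<tau> \<Phi>[OF \<tau>(1)] X(3) by blast
        qed
        ultimately show "\<exists>T. openin (gtop \<Sigma>') T \<and> U \<in> T \<and> T \<subseteq> ?\<Phi> ` W" by blast
      qed
    qed
    show "?\<Phi> ` arrows \<Sigma> = arrows \<Sigma>'" by (rule image)
    show "inj_on ?\<Phi> (arrows \<Sigma>)" using inj_point_filter \<Phi> by (simp add: inj_on_def)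
  qed
  then obtain \<psi> where \<psi>: "homeomorphic_maps (gtop \<Sigma>) (gtop \<Sigma>') ?\<Phi> \<psi>"
    unfolding homeomorphic_map_maps by blast
  then have inv: "\<psi> (?\<Phi> \<sigma>) = \<sigma>" if "\<sigma> \<in> arrows \<Sigma>" for \<sigma>
    using that unfolding homeomorphic_maps_def by blast
  have comp: "composable \<Sigma>' (?\<Phi> a) (?\<Phi> b) \<longleftrightarrow> composable \<Sigma> a b"
    if "a \<in> arrows \<Sigma>" "b \<in> arrows \<Sigma>" for a b
  proof -
    have "composable \<Sigma>' (?\<Phi> a) (?\<Phi> b) \<longleftrightarrow> (\<forall>m \<in> point_filter a. \<forall>n \<in> point_filter b. conv m n \<noteq> 0)"
      unfolding ultrafilter_groupoid_def using \<Phi> point_filter_ultrafilter that by simp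
    also have "\<dots> \<longleftrightarrow> composable \<Sigma> a b"
    proof
      assume "composable \<Sigma> a b"
      then show "\<forall>m \<in> point_filter a. \<forall>n \<in> point_filter b. conv m n \<noteq> 0"
        using conv_point_filter by (metis zero_fun_def zero_neq_one)
    qed (use composable_point_filter[OF that LBH] in blast)
    finally show ?thesis .
  qed
  have mult: "?\<Phi> a \<odot>\<^bsub>\<Sigma>'\<^esub> ?\<Phi> b = ?\<Phi> (a \<odot> b)" if "composable \<Sigma> a b" for a b
    using mult_point_filter[OF LBH that] composable_closed[OF that] \<Phi>
    unfolding ultrafilter_groupoid_def by simp
  have "groupoid_hom \<Sigma> \<Sigma>' ?\<Phi>"
    unfolding groupoid_hom_def
  proof (intro conjI allI impI)
    show "?\<Phi> \<in> arrows \<Sigma> \<rightarrow> arrows \<Sigma>'" using image by blast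
    fix a b assume ab: "composable \<Sigma> a b"
    then show "composable \<Sigma>' (?\<Phi> a) (?\<Phi> b)" using comp composable_closed by blast
    show "?\<Phi> (a \<odot> b) = ?\<Phi> a \<odot>\<^bsub>\<Sigma>'\<^esub> ?\<Phi> b" using mult[OF ab] by simp
  qed
  moreover have "groupoid_hom \<Sigma>' \<Sigma> \<psi>"
    unfolding groupoid_hom_def
  proof (intro conjI allI impI)
    show "\<psi> \<in> arrows \<Sigma>' \<rightarrow> arrows \<Sigma>" unfolding image[symmetric] using inv by auto
    fix U V assume UV: "composable \<Sigma>' U V"
    then have "U \<in> arrows \<Sigma>'" "V \<in> arrows \<Sigma>'"
      unfolding arrows_\<Sigma>' by (simp_all add: ultrafilter_groupoid_def)
    then obtain a b where a: "a \<in> arrows \<Sigma>" "U = ?\<Phi> a" and b: "b \<in> arrows \<Sigma>" "V = ?\<Phi> b"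
      unfolding image[symmetric] by blast
    have ab: "composable \<Sigma> a b" using UV a b comp by simp
    then show "composable \<Sigma> (\<psi> U) (\<psi> V)" using a b inv by simp
    have "U \<odot>\<^bsub>\<Sigma>'\<^esub> V = ?\<Phi> (a \<odot> b)" using mult[OF ab] a b by simp
    then show "\<psi> (U \<odot>\<^bsub>\<Sigma>'\<^esub> V) = \<psi> U \<odot> \<psi> V"
      using inv composable_closed[OF ab] a b by simp
  qed
  ultimately show ?thesis unfolding topological_groupoid_iso_def using \<psi> by blast
qed

lemma surj_iff: "Phi G \<Sigma> i q ` arrows \<Sigma> = arrows \<Sigma>' \<longleftrightarrow> arrows \<Sigma>' \<subseteq> point_filter ` arrows \<Sigma>"
  using point_filter_ultrafilter unfolding Phi_image arrows_\<Sigma>' by blast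

end

theorem theorem8p7:
  fixes G :: "'g tgroupoid" and \<Sigma> :: "'s tgroupoid"
    and i :: "'g \<times> 'r::comm_ring_1 \<Rightarrow> 's" and q :: "'s \<Rightarrow> 'g"
    and A :: "('r, 's \<Rightarrow> 'r) ralgebra" and B :: "('s \<Rightarrow> 'r) set"
    and \<Sigma>' :: "('s \<Rightarrow> 'r) set tgroupoid" and \<Phi> :: "'s \<Rightarrow> ('s \<Rightarrow> 'r) set"
  assumes "indecomposable_ring TYPE('r)"
    and "ample G" and "Hausdorff_space (gtop G)"
    and "discrete_twist G \<Sigma> i q"
    and "A = steinberg_algebra G \<Sigma> i q"
    and "B = steinberg_diagonal G \<Sigma> i q"
    and "\<Sigma>' = ultrafilter_groupoid A B"
    and "\<Phi> = Phi G \<Sigma> i q"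
  shows "(algebraic_quasi_Cartan_pair A B \<longleftrightarrow> local_bisection_hypothesis G \<Sigma> i q) \<and>
         (local_bisection_hypothesis G \<Sigma> i q \<longleftrightarrow>
            \<Phi> ` arrows \<Sigma> = arrows \<Sigma>' \<and> topological_groupoid_iso \<Sigma> \<Sigma>' \<Phi>) \<and>
         (\<Phi> ` arrows \<Sigma> = arrows \<Sigma>' \<longrightarrow> topological_groupoid_iso \<Sigma> \<Sigma>' \<Phi>)"
proof -
  interpret indecomposable_twist \<Sigma> G i q
    by unfold_locales (use assms(1-4) in \<open>auto simp: indecomposable_ring_def\<close>)
  show ?thesis
    unfolding assms(5-8)
    using quasi_Cartan_imp_LBH LBH_imp_quasi_Cartan LBH_imp_surj surj_imp_LBH surj_imp_iso surj_iff
    by blast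
qed

end
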